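(* Let $G$ be a subgroup of a direct product of two free groups. Then $G$ is $p$-conjugacy separable for at least two distinct primes $p$ if and only if $G$ is itself isomorphic to a direct product of two free groups (one or both of which may be trivial).
   Context: For a prime $p$, a group $G$ is $p$-conjugacy separable if for any two non-conjugate elements $x,y\in G$ there is a homomorphism $\varphi$ from $G$ to a finite $p$-group $M$ such that $\varphi(x)$ and $\varphi(y)$ are not conjugate in $M$. Free groups may have arbitrary rank. *)

theory Defs
  imports "HOL-Computational_Algebra.Primes" "HOL-Algebra.Coset"
begin

section \<open>Free groups of arbitrary rank\<close>

text \<open>A letter \<open>(x, True)\<close> stands for the generator \<open>x\<close>, and \<open>(x, False)\<close> for its formal inverse.\<close>

type_synonym 'a letter = "'a \<times> bool"

definition inv_letter :: "'a letter \<Rightarrow> 'a letter" where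
  "inv_letter l = (fst l, \<not> snd l)"

fun reduced :: "'a letter list \<Rightarrow> bool" where
  "reduced (l # m # w) \<longleftrightarrow> m \<noteq> inv_letter l \<and> reduced (m # w)"
| "reduced _ \<longleftrightarrow> True"

text \<open>The reduced form of \<open>l # w\<close>, for a reduced word \<open>w\<close>.\<close>

fun red_cons :: "'a letter \<Rightarrow> 'a letter list \<Rightarrow> 'a letter list" where
  "red_cons l (m # w) = (if m = inv_letter l then w else l # m # w)"
| "red_cons l [] = [l]"

text \<open>The free group with basis \<open>X\<close>: reduced words, multiplied by concatenation followed by
  free reduction.\<close>

definition free_group :: "'a set \<Rightarrow> 'a letter list monoid" where
  "free_group X =
     \<lparr>carrier = {w \<in> lists (X \<times> UNIV). reduced w},
      mult = (\<lambda>u v. foldr red_cons u v),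
      one = []\<rparr>"

text \<open>The basis may be taken in the element type of \<open>G\<close> without loss of generality, since a free
  group contains a basis; see \<open>is_free_groupI\<close> below.\<close>

definition is_free_group :: "'a monoid \<Rightarrow> bool" where
  "is_free_group G \<longleftrightarrow> group G \<and> (\<exists>X :: 'a set. G \<cong> free_group X)"

section \<open>Conjugacy separability\<close>

definition conjugate_in :: "('a, 'm) monoid_scheme \<Rightarrow> 'a \<Rightarrow> 'a \<Rightarrow> bool" where
  "conjugate_in G x y \<longleftrightarrow> (\<exists>g \<in> carrier G. y = g \<otimes>\<^bsub>G\<^esub> x \<otimes>\<^bsub>G\<^esub> inv\<^bsub>G\<^esub> g)"

text \<open>The order of an infinite group is \<open>0\<close> and hence not a power of \<open>p\<close>, so finiteness is implied.\<close>

definition finite_p_group :: "nat \<Rightarrow> ('a, 'm) monoid_scheme \<Rightarrow> bool" where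
  "finite_p_group p M \<longleftrightarrow> group M \<and> (\<exists>n. order M = p ^ n)"

text \<open>Every finite group has an isomorphic copy with elements of type \<^typ>\<open>nat\<close>, so the following
  ranges over all finite \<open>p\<close>-groups; see \<open>finite_p_group_nat_copy\<close> below.\<close>

definition p_conjugacy_separable :: "nat \<Rightarrow> ('a, 'm) monoid_scheme \<Rightarrow> bool" where
  "p_conjugacy_separable p G \<longleftrightarrow>
     (\<forall>x \<in> carrier G. \<forall>y \<in> carrier G. \<not> conjugate_in G x y \<longrightarrow>
        (\<exists>(M :: nat monoid) \<phi>. finite_p_group p M \<and> \<phi> \<in> hom G M \<and>
           \<not> conjugate_in M (\<phi> x) (\<phi> y)))"

section \<open>Adequacy of the definitions\<close>

lemma inv_letter_simps [simp]:
  "inv_letter (inv_letter l) = l" "inv_letter l \<noteq> l" "l \<noteq> inv_letter l"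
  "fst (inv_letter l) = fst l" "inv_letter l = inv_letter m \<longleftrightarrow> l = m"
  by (auto simp: inv_letter_def prod_eq_iff)

lemma inv_letter_mem [simp]: "inv_letter l \<in> X \<times> UNIV \<longleftrightarrow> l \<in> X \<times> UNIV"
  by (cases l) (auto simp: inv_letter_def)

lemma reduced_tl: "reduced (l # w) \<Longrightarrow> reduced w"
  by (cases w) auto

lemma reduced_red_cons: "reduced w \<Longrightarrow> reduced (red_cons l w)"
  by (cases w) (auto dest: reduced_tl)

lemma reduced_foldr: "reduced v \<Longrightarrow> reduced (foldr red_cons u v)"
  by (induction u) (auto intro: reduced_red_cons)

lemma lists_red_cons:
  "l \<in> X \<times> UNIV \<Longrightarrow> w \<in> lists (X \<times> UNIV) \<Longrightarrow> red_cons l w \<in> lists (X \<times> UNIV)"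
  by (cases w) auto

lemma lists_foldr:
  "u \<in> lists (X \<times> UNIV) \<Longrightarrow> v \<in> lists (X \<times> UNIV) \<Longrightarrow> foldr red_cons u v \<in> lists (X \<times> UNIV)"
proof (induction u)
  case (Cons l u)
  then show ?case using lists_red_cons[of l X "foldr red_cons u v"] by auto
qed simp

lemma red_cons_cancel: "reduced w \<Longrightarrow> red_cons l (red_cons (inv_letter l) w) = w"
  by (cases w rule: reduced.cases) auto

lemma red_cons_reduced: "reduced (l # w) \<Longrightarrow> red_cons l w = l # w"
  by (cases w) auto

lemma foldr_red_cons_Nil: "reduced u \<Longrightarrow> foldr red_cons u [] = u"
proof (induction u)
  case (Cons l u)
  then show ?case using reduced_tl[of l u] red_cons_reduced[of l u] by simp
qed simp

lemma foldr_red_cons: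
  assumes "reduced v" shows "foldr red_cons (red_cons l u) v = red_cons l (foldr red_cons u v)"
proof (cases u)
  case (Cons m w)
  have "reduced (foldr red_cons w v)"
    using assms by (rule reduced_foldr)
  then show ?thesis
    using Cons red_cons_cancel[of "foldr red_cons w v" l] by simp
qed auto

lemma foldr_red_cons_assoc:
  "reduced w \<Longrightarrow> foldr red_cons (foldr red_cons u v) w = foldr red_cons u (foldr red_cons v w)"
  by (induction u) (auto simp: foldr_red_cons)

lemma foldr_red_cons_inverse:
  "reduced v \<Longrightarrow> foldr red_cons (map inv_letter (rev u)) (foldr red_cons u v) = v"
proof (induction u)
  case (Cons l u)
  have "red_cons (inv_letter l) (red_cons l (foldr red_cons u v)) = foldr red_cons u v"
    using red_cons_cancel[of "foldr red_cons u v" "inv_letter l"] reduced_foldr[OF Cons.prems] by simp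
  then show ?case using Cons by simp
qed simp

theorem group_free_group: "group (free_group X)"
proof (rule groupI)
  fix u assume u: "u \<in> carrier (free_group X)"
  define v where "v = foldr red_cons (map inv_letter (rev u)) []"
  have "u \<in> lists (X \<times> UNIV)"
    using u by (simp add: free_group_def)
  then have "map inv_letter (rev u) \<in> lists (X \<times> UNIV)"
    by (induction u) (use inv_letter_mem in auto)
  then have "v \<in> carrier (free_group X)"
    unfolding v_def free_group_def by (simp add: reduced_foldr lists_foldr del: in_lists_conv_set)
  moreover have "v \<otimes>\<^bsub>free_group X\<^esub> u = \<one>\<^bsub>free_group X\<^esub>"
  proof -
    have "foldr red_cons v u = foldr red_cons (map inv_letter (rev u)) (foldr red_cons [] u)"
      using u unfolding v_def by (subst foldr_red_cons_assoc) (auto simp: free_group_def)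
    also have "\<dots> = []"
      using foldr_red_cons_inverse[of "[]" u] u by (simp add: foldr_red_cons_Nil free_group_def)
    finally show ?thesis by (simp add: free_group_def)
  qed
  ultimately show "\<exists>v\<in>carrier (free_group X). v \<otimes>\<^bsub>free_group X\<^esub> u = \<one>\<^bsub>free_group X\<^esub>" by blast
qed (auto simp: free_group_def reduced_foldr lists_foldr foldr_red_cons_assoc simp del: in_lists_conv_set)

definition gen :: "'a \<Rightarrow> 'a letter list" where "gen x = [(x, True)]"

text \<open>Universal property of \<open>free_group X\<close>; the value of the homomorphism on a word is the
  product of the values of its letters.\<close>

definition letter_val :: "('b, 'm) monoid_scheme \<Rightarrow> ('a \<Rightarrow> 'b) \<Rightarrow> 'a letter \<Rightarrow> 'b" where
  "letter_val H f l = (if snd l then f (fst l) else inv\<^bsub>H\<^esub> f (fst l))"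

definition word_val :: "('b, 'm) monoid_scheme \<Rightarrow> ('a \<Rightarrow> 'b) \<Rightarrow> 'a letter list \<Rightarrow> 'b" where
  "word_val H f w = foldr (\<lambda>l h. letter_val H f l \<otimes>\<^bsub>H\<^esub> h) w \<one>\<^bsub>H\<^esub>"

lemma word_val_simps [simp]:
  "word_val H f [] = \<one>\<^bsub>H\<^esub>"
  "word_val H f (l # w) = letter_val H f l \<otimes>\<^bsub>H\<^esub> word_val H f w"
  by (simp_all add: word_val_def)

theorem free_group_universal:
  assumes "group H" and f: "f \<in> X \<rightarrow> carrier H"
  shows "word_val H f \<in> hom (free_group X) H" "\<And>x. x \<in> X \<Longrightarrow> word_val H f (gen x) = f x"
    and "\<And>\<psi>. \<lbrakk>\<psi> \<in> hom (free_group X) H; \<And>x. x \<in> X \<Longrightarrow> \<psi> (gen x) = f x;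
           w \<in> carrier (free_group X)\<rbrakk> \<Longrightarrow> \<psi> w = word_val H f w"
proof -
  interpret H: group H by fact
  have lv: "letter_val H f l \<in> carrier H" if "l \<in> X \<times> UNIV" for l
    using that f by (auto simp: letter_val_def)
  have lvi: "letter_val H f (inv_letter l) = inv\<^bsub>H\<^esub> letter_val H f l" if "l \<in> X \<times> UNIV" for l
    using that f by (auto simp: letter_val_def inv_letter_def Pi_iff)
  have wv: "word_val H f w \<in> carrier H" if "w \<in> lists (X \<times> UNIV)" for w
    using that by (induction w) (auto intro!: lv)
  have rc: "word_val H f (red_cons l w) = letter_val H f l \<otimes>\<^bsub>H\<^esub> word_val H f w"
    if l: "l \<in> X \<times> UNIV" and w: "w \<in> lists (X \<times> UNIV)" for l w
  proof (cases w)
    case (Cons m u)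
    then have "u \<in> lists (X \<times> UNIV)" using w by simp
    then show ?thesis
      using Cons lv[OF l] wv by (simp add: lvi[OF l] H.m_assoc[symmetric])
  qed simp
  have fr: "word_val H f (foldr red_cons u v) = word_val H f u \<otimes>\<^bsub>H\<^esub> word_val H f v"
    if "u \<in> lists (X \<times> UNIV)" "v \<in> lists (X \<times> UNIV)" for u v
    using that(1)
  proof (induction u)
    case Nil then show ?case using wv[OF that(2)] by simp
  next
    case (Cons l u)
    then show ?case
      using rc[OF Cons.hyps(1) lists_foldr[OF Cons.hyps(2) that(2)]] lv[OF Cons.hyps(1)]
        wv[OF Cons.hyps(2)] wv[OF that(2)] by (simp add: H.m_assoc)
  qed
  show "word_val H f \<in> hom (free_group X) H"
    using wv fr by (auto simp: hom_def free_group_def simp del: in_lists_conv_set)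
  show "word_val H f (gen x) = f x" if "x \<in> X" for x
    using funcset_mem[OF f that] by (simp add: gen_def letter_val_def)
  fix \<psi> w
  assume \<psi>: "\<psi> \<in> hom (free_group X) H" and gen: "\<And>x. x \<in> X \<Longrightarrow> \<psi> (gen x) = f x"
    and w: "w \<in> carrier (free_group X)"
  interpret F: group "free_group X" by (rule group_free_group)
  interpret \<psi>: group_hom "free_group X" H \<psi>
    using \<psi> by unfold_locales
  have one: "\<psi> [] = \<one>\<^bsub>H\<^esub>" using \<psi>.hom_one by (simp add: free_group_def)
  have lt: "\<psi> [l] = letter_val H f l" if "l \<in> X \<times> UNIV" for l
  proof (cases "snd l")
    case True
    then show ?thesis using that gen[of "fst l"]
      by (cases l) (auto simp: letter_val_def gen_def)
  next
    case False
    have gc: "gen (fst l) \<in> carrier (free_group X)" "[l] \<in> carrier (free_group X)"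
      using that by (auto simp: gen_def free_group_def)
    have "[l] \<otimes>\<^bsub>free_group X\<^esub> gen (fst l) = \<one>\<^bsub>free_group X\<^esub>"
      using False by (cases l) (simp add: gen_def free_group_def inv_letter_def)
    then have "[l] = inv\<^bsub>free_group X\<^esub> gen (fst l)"
      using gc F.inv_equality by metis
    then have "\<psi> [l] = inv\<^bsub>H\<^esub> \<psi> (gen (fst l))"
      using \<psi>.hom_inv gc by metis
    then show ?thesis using False that gen[of "fst l"]
      by (cases l) (auto simp: letter_val_def)
  qed
  show "\<psi> w = word_val H f w"
    using w
  proof (induction w)
    case Nil then show ?case by (simp add: one)
  next
    case (Cons l w)
    have l: "l \<in> X \<times> UNIV" and w: "w \<in> carrier (free_group X)" "[l] \<in> carrier (free_group X)"
      and red: "red_cons l w = l # w"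
      using Cons.prems by (auto simp: free_group_def dest: reduced_tl intro: red_cons_reduced)
    have "l # w = [l] \<otimes>\<^bsub>free_group X\<^esub> w"
      using red by (simp add: free_group_def)
    then show ?case
      using \<psi>.hom_mult[OF w(2,1)] Cons.IH[OF w(1)] lt[OF l] by (metis word_val_simps(2))
  qed
qed

lemma word_val_gen:
  "w \<in> carrier (free_group X) \<Longrightarrow> word_val (free_group X) gen w = w"
  using free_group_universal(3)[OF group_free_group, of gen X X "\<lambda>w. w" w]
  by (auto simp: hom_def gen_def free_group_def)

lemma free_group_cong:
  fixes X :: "'a set" and Y :: "'b set"
  assumes "bij_betw h X Y"
  shows "free_group X \<cong> free_group Y"
proof -
  define k where "k = inv_into X h"
  have h: "h x \<in> Y" "k (h x) = x" if "x \<in> X" for x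
    using that assms by (auto simp: k_def bij_betw_def)
  have k: "k y \<in> X" "h (k y) = y" if "y \<in> Y" for y
    using that assms unfolding k_def bij_betw_def by (auto intro: inv_into_into f_inv_into_f)
  define \<phi> where "\<phi> = word_val (free_group Y) (\<lambda>x. gen (h x))"
  define \<psi> where "\<psi> = word_val (free_group X) (\<lambda>y. gen (k y))"
  have gh: "(\<lambda>x. gen (h x)) \<in> X \<rightarrow> carrier (free_group Y)"
    using h by (auto simp: gen_def free_group_def)
  have gk: "(\<lambda>y. gen (k y)) \<in> Y \<rightarrow> carrier (free_group X)"
    using k by (auto simp: gen_def free_group_def)
  note \<phi> = free_group_universal[OF group_free_group gh, folded \<phi>_def]
  note \<psi> = free_group_universal[OF group_free_group gk, folded \<psi>_def]
  have X: "gen \<in> X \<rightarrow> carrier (free_group X)" and Y: "gen \<in> Y \<rightarrow> carrier (free_group Y)"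
    by (auto simp: gen_def free_group_def)
  have "\<psi> (\<phi> w) = w" if "w \<in> carrier (free_group X)" for w
    using free_group_universal(3)[OF group_free_group X, of "\<psi> \<circ> \<phi>"] that
      hom_compose[OF \<phi>(1) \<psi>(1)] \<phi>(2) \<psi>(2) h by (simp add: word_val_gen)
  moreover have "\<phi> (\<psi> w) = w" if "w \<in> carrier (free_group Y)" for w
    using free_group_universal(3)[OF group_free_group Y, of "\<phi> \<circ> \<psi>"] that
      hom_compose[OF \<psi>(1) \<phi>(1)] \<phi>(2) \<psi>(2) k by (simp add: word_val_gen)
  ultimately have "bij_betw \<phi> (carrier (free_group X)) (carrier (free_group Y))"
    using hom_in_carrier[OF \<phi>(1)] hom_in_carrier[OF \<psi>(1)]
    by (intro bij_betw_byWitness[where f' = \<psi>]) auto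
  then show ?thesis using \<phi>(1) by (auto intro: is_isoI isoI)
qed

theorem is_free_groupI:
  fixes G :: "'a monoid" and X :: "'b set"
  assumes G: "group G" and iso: "G \<cong> free_group X"
  shows "is_free_group G"
proof -
  obtain \<phi> where \<phi>: "\<phi> \<in> iso (free_group X) G"
    using group.iso_sym[OF G iso] by (auto simp: is_iso_def)
  have "inj_on gen X" "gen ` X \<subseteq> carrier (free_group X)"
    by (auto simp: inj_on_def gen_def free_group_def)
  moreover have "inj_on \<phi> (carrier (free_group X))"
    using \<phi> by (simp add: iso_iff)
  ultimately have "inj_on (\<phi> \<circ> gen) X"
    using comp_inj_on inj_on_subset by blast
  then have "bij_betw (\<phi> \<circ> gen) X ((\<phi> \<circ> gen) ` X)"
    by (rule inj_on_imp_bij_betw)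
  from iso_trans[OF iso free_group_cong[OF this]] show ?thesis
    using G by (auto simp: is_free_group_def)
qed

text \<open>Whether \<open>G\<close> is a direct product of two free groups can be tested on factors whose
  elements have the same type as those of \<open>G\<close>.\<close>

lemma group_iso_copy:
  assumes "group K" and "inj_on j (carrier K)"
  shows "\<exists>K'. group K' \<and> carrier K' = j ` carrier K \<and> j \<in> iso K (K' :: 'b monoid)"
proof -
  interpret K: group K by fact
  define i where "i = inv_into (carrier K) j"
  define K' where "K' = \<lparr>carrier = j ` carrier K, mult = (\<lambda>x y. j (i x \<otimes>\<^bsub>K\<^esub> i y)), one = j \<one>\<^bsub>K\<^esub>\<rparr>"
  have [simp]: "i (j x) = x" if "x \<in> carrier K" for x
    using that assms by (simp add: i_def)
  have hom: "j \<in> hom K K'"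
    by (auto simp: hom_def K'_def)
  then have iso: "j \<in> iso K K'"
    using assms by (auto simp: iso_iff K'_def)
  have "group (K'\<lparr>one := j \<one>\<^bsub>K\<^esub>\<rparr>)"
    using K.iso_imp_img_group[OF iso] .
  then have "group K'" by (simp add: K'_def)
  with iso show ?thesis by (auto simp: K'_def)
qed

theorem direct_product_of_free_groups_any_type:
  fixes G :: "'a monoid" and K :: "'b monoid" and L :: "'c monoid"
  assumes G: "group G" and K: "is_free_group K" and L: "is_free_group L" and iso: "G \<cong> K \<times>\<times> L"
  shows "\<exists>(K' :: 'a monoid) (L' :: 'a monoid).
           is_free_group K' \<and> is_free_group L' \<and> G \<cong> K' \<times>\<times> L'"
proof -
  have gK: "group K" and gL: "group L" using K L by (auto simp: is_free_group_def)
  interpret K: group K by fact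
  interpret L: group L by fact
  obtain \<phi> where \<phi>: "\<phi> \<in> iso (K \<times>\<times> L) G"
    using group.iso_sym[OF G iso] by (auto simp: is_iso_def)
  have "inj_on (\<lambda>k. \<phi> (k, \<one>\<^bsub>L\<^esub>)) (carrier K)" "inj_on (\<lambda>l. \<phi> (\<one>\<^bsub>K\<^esub>, l)) (carrier L)"
    using \<phi> K.one_closed L.one_closed unfolding iso_iff inj_on_def DirProd_def by fastforce+
  then obtain K' L' :: "'a monoid" and i j where
    K': "group K'" "i \<in> iso K K'" and L': "group L'" "j \<in> iso L L'"
    using group_iso_copy[OF gK] group_iso_copy[OF gL] by metis
  have "K' \<cong> K" "L' \<cong> L"
    using K.iso_sym L.iso_sym K'(2) L'(2) is_isoI by blast+
  then have "is_free_group K'" "is_free_group L'"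
    using K L K'(1) L'(1) unfolding is_free_group_def
    by (meson is_free_groupI is_free_group_def iso_trans)+
  moreover have "G \<cong> K' \<times>\<times> L'"
    using iso_trans[OF iso] K.DirProd_iso_trans[OF is_isoI[OF K'(2)] is_isoI[OF L'(2)]] .
  ultimately show ?thesis by blast
qed

theorem finite_p_group_nat_copy:
  fixes M :: "('a, 'm) monoid_scheme"
  assumes "prime p" and M: "finite_p_group p M"
  shows "\<exists>M' :: nat monoid. finite_p_group p M' \<and> M \<cong> M'"
proof -
  obtain n where g: "group M" and n: "order M = p ^ n"
    using M by (auto simp: finite_p_group_def)
  then have "finite (carrier M)"
    using \<open>prime p\<close> by (metis card.infinite order_def not_prime_0 power_not_zero)
  then obtain j :: "'a \<Rightarrow> nat" where "inj_on j (carrier M)"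
    using finite_imp_inj_to_nat_seg by blast
  then obtain M' :: "nat monoid" where "group M'" "j \<in> iso M M'"
    using group_iso_copy[OF g] by blast
  then show ?thesis
    using n iso_same_order[of j M M'] by (auto simp: finite_p_group_def intro: is_isoI)
qed

end

theory Submission
  imports Defs "HOL-Algebra.Elementary_Groups" "HOL-Algebra.Multiplicative_Group" "HOL-Library.Nat_Bijection"
begin

text \<open>
  A free group is \<open>p\<close>-conjugacy separable for every prime \<open>p\<close>: unless two non-conjugate words are
  told apart in \<open>\<int>/p\<^sup>k\<close>, some map onto \<open>\<int>/p\<close> kills both but not all of their letters. Rewriting the words
  in a Schreier basis of its kernel shortens them, and a finite \<open>p\<close>-quotient that separates the rewritten
  words yields one of the whole group by a wreath product with \<open>\<int>/p\<close>.

  Conversely, by Nielsen--Schreier \<open>G\<close> is a subdirect product of two free groups. Let \<open>K\<^sub>1\<close> and \<open>K\<^sub>2\<close> be the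
  kernels of the projections. If one of them is central, \<open>G\<close> splits over it. Otherwise every coset of the image
  of \<open>K\<^sub>2\<close> in the first factor, and of \<open>K\<^sub>1\<close> in the second, contains an element whose centralizer is the cyclic group it
  generates. With such elements one builds, for \<open>r\<close> prime to \<open>p\<close> and \<open>g\<close> not a power of its \<open>r\<close>-th power modulo
  \<open>K\<^sub>1K\<^sub>2\<close>, two non-conjugate elements of \<open>G\<close> that are conjugate in all finite \<open>p\<close>-quotients. So every element of
  \<open>G/K\<^sub>1K\<^sub>2\<close> is a power of its \<open>r\<close>-th power for all \<open>r\<close> prime to one of the two given primes, which forces
  \<open>G = K\<^sub>1K\<^sub>2\<close>, and \<open>G\<close> is the product of its projections.
\<close>

section \<open>Words in a group\<close>

text \<open>Rewriting is done on unreduced words over one countable alphabet, so a single induction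
  on the total length covers all the subgroups met on the way. The induction dictates the character:
  it must be exactly 1 on some letter s that occurs, so that powers of s form the transversal and an
  occurrence of s can disappear. The rewritten form of a word depends on the coset at which reading
  starts, and conjugation in the wreath product mixes these forms; hence all p forms of one word are
  separated at once from a single form of the other.

  One prime does not suffice for the converse argument: separability at p makes a class t of
  \<open>G/K\<^sub>1K\<^sub>2\<close> a power of t^r only for r prime to p, and every t of p-power
  order satisfies this. The centralizers matter because a conjugating element is determined only up
  to a centralizer; proper powers would spoil the argument, so the coset representatives are built
  from words without a proper period.\<close>

lemma (in group) inv_cancel [simp]:
  assumes "x \<in> carrier G" "y \<in> carrier G"
  shows "inv x \<otimes> (x \<otimes> y) = y" "x \<otimes> (inv x \<otimes> y) = y"
  using assms by (simp_all add: m_assoc[symmetric])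

lemma (in group) conjugate_in_sym: "conjugate_in G x y \<Longrightarrow> x \<in> carrier G \<Longrightarrow> conjugate_in G y x"
  unfolding conjugate_in_def
  by (metis inv_closed inv_inv inv_solve_left inv_solve_right m_closed)

lemma (in group) conjugate_in_trans:
  assumes "conjugate_in G x y" "conjugate_in G y z" "x \<in> carrier G"
  shows "conjugate_in G x z"
proof -
  obtain g h where "g \<in> carrier G" "h \<in> carrier G" "y = g \<otimes> x \<otimes> inv g" "z = h \<otimes> y \<otimes> inv h"
    using assms by (auto simp: conjugate_in_def)
  then have "h \<otimes> g \<in> carrier G" "z = h \<otimes> g \<otimes> x \<otimes> inv (h \<otimes> g)"
    using assms(3) by (simp_all add: m_assoc inv_mult_group)
  then show ?thesis unfolding conjugate_in_def by blast
qed

lemma (in group_hom) hom_conjugate_in: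
  assumes "conjugate_in G x y" "x \<in> carrier G"
  shows "conjugate_in H (h x) (h y)"
  using assms by (auto simp: conjugate_in_def intro!: bexI[of _ "h _"])

lemma (in group) letter_val_closed:
  "f \<in> X \<rightarrow> carrier G \<Longrightarrow> l \<in> X \<times> UNIV \<Longrightarrow> letter_val G f l \<in> carrier G"
  by (auto simp: letter_val_def)

lemma (in group) word_val_closed:
  assumes "f \<in> X \<rightarrow> carrier G" "w \<in> lists (X \<times> UNIV)"
  shows "word_val G f w \<in> carrier G"
  using assms(2) by (induction w) (auto intro!: letter_val_closed[OF assms(1)])

lemma (in group) word_val_append:
  assumes f: "f \<in> X \<rightarrow> carrier G" and u: "u \<in> lists (X \<times> UNIV)" and v: "v \<in> lists (X \<times> UNIV)"
  shows "word_val G f (u @ v) = word_val G f u \<otimes> word_val G f v"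
  using u
proof (induction u)
  case (Cons l u)
  then show ?case
    using letter_val_closed[OF f, of l] word_val_closed[OF f Cons.hyps(2)] word_val_closed[OF f v]
    by (simp add: m_assoc)
qed (simp add: word_val_closed[OF f v])

lemma word_val_cong:
  "(\<And>a. a \<in> fst ` set w \<Longrightarrow> f a = g a) \<Longrightarrow> word_val H f w = word_val H g w"
  by (induction w) (auto simp: letter_val_def)

lemma word_val_map_letters: "word_val H f (map (\<lambda>(a, b). (h a, b)) w) = word_val H (f \<circ> h) w"
  by (induction w) (auto simp: letter_val_def)

lemma gen_in_carrier [simp]: "gen x \<in> carrier (free_group X) \<longleftrightarrow> x \<in> X"
  by (auto simp: gen_def free_group_def)

lemma group_hom_word_val:
  assumes "group H" "f \<in> X \<rightarrow> carrier H"
  shows "group_hom (free_group X) H (word_val H f)"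
  using free_group_universal(1)[OF assms] assms group_free_group by (intro group_hom.intro group_hom_axioms.intro)

lemma (in group_hom) hom_word_val:
  assumes f: "f \<in> X \<rightarrow> carrier G" and w: "w \<in> lists (X \<times> UNIV)"
  shows "h (word_val G f w) = word_val H (\<lambda>x. h (f x)) w"
  using w
proof (induction w)
  case (Cons l w)
  have "h (letter_val G f l) = letter_val H (\<lambda>x. h (f x)) l"
    using f Cons.hyps(1) by (auto simp: letter_val_def Pi_iff)
  then show ?case
    using Cons G.letter_val_closed[OF f Cons.hyps(1)] G.word_val_closed[OF f Cons.hyps(2)] by simp
qed simp

lemma hom_free_group_eqI:
  assumes H: "group H" and \<phi>: "\<phi> \<in> hom (free_group X) H" and \<psi>: "\<psi> \<in> hom (free_group X) H"
    and gen: "\<And>x. x \<in> X \<Longrightarrow> \<phi> (gen x) = \<psi> (gen x)" and w: "w \<in> carrier (free_group X)"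
  shows "\<phi> w = \<psi> w"
proof -
  have f: "(\<lambda>x. \<psi> (gen x)) \<in> X \<rightarrow> carrier H"
    using hom_in_carrier[OF \<psi>] by simp
  show ?thesis
    using free_group_universal(3)[OF H f \<phi> _ w] free_group_universal(3)[OF H f \<psi> _ w] gen by simp
qed

text \<open>The homomorphism to the integers with prescribed values on the generators, evaluated on
  words that need not be reduced. An indicator function for \<open>c\<close> gives the exponent sum
  of one letter.\<close>

definition word_exp :: "('a \<Rightarrow> int) \<Rightarrow> 'a letter list \<Rightarrow> int" where
  "word_exp c w = (\<Sum>l\<leftarrow>w. if snd l then c (fst l) else - c (fst l))"

lemma word_exp_simps [simp]:
  "word_exp c [] = 0"
  "word_exp c (l # w) = (if snd l then c (fst l) else - c (fst l)) + word_exp c w"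
  "word_exp c (u @ v) = word_exp c u + word_exp c v"
  by (simp_all add: word_exp_def)

lemma word_exp_add: "word_exp (\<lambda>a. c a + d a) w = word_exp c w + word_exp d w"
  by (induction w) auto

lemma word_exp_mult: "word_exp (\<lambda>a. k * c a) w = k * word_exp c w"
  by (induction w) (auto simp: algebra_simps)

lemma word_val_integer_mod_group:
  assumes "n > 0"
  shows "word_val (integer_mod_group n) (\<lambda>a. c a mod int n) w = word_exp c w mod int n"
proof (induction w)
  case (Cons l w)
  have "letter_val (integer_mod_group n) (\<lambda>a. c a mod int n) l = (if snd l then c (fst l) else - c (fst l)) mod int n"
    using assms by (simp add: letter_val_def carrier_integer_mod_group mod_minus_eq)
  then show ?case using Cons by (simp add: mod_add_eq)
qed simp

lemma (in group) word_val_single_letter: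
  assumes "f a \<in> carrier G" "\<And>l. l \<in> set w \<Longrightarrow> fst l = a"
  shows "word_val G f w = f a [^] word_exp (\<lambda>_. 1) w"
  using assms(2)
proof (induction w)
  case (Cons l w)
  then have "letter_val G f l = f a [^] (if snd l then 1 else - 1 :: int)"
    using assms(1) int_pow_neg[of "f a" 1] by (auto simp: letter_val_def)
  then show ?case
    using Cons assms(1) int_pow_mult[of "f a"] by (cases l) auto
qed simp

section \<open>Regular wreath products\<close>

text \<open>The coordinate at \<open>c\<close> of a product continues in the second factor at
  \<open>c\<close> times \<open>a\<close>: a homomorphism into this group reads a word along paths
  in the Cayley graph of \<Gamma>, one coordinate for each starting point. Functions are
  extensional, so that the carrier is finite when both groups are.\<close>

definition wreath :: "('m, 'x) monoid_scheme \<Rightarrow> ('g, 'y) monoid_scheme \<Rightarrow> ('g \<times> ('g \<Rightarrow> 'm)) monoid" where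
  "wreath M \<Gamma> = \<lparr>carrier = carrier \<Gamma> \<times> (carrier \<Gamma> \<rightarrow>\<^sub>E carrier M),
     mult = (\<lambda>(a, m) (b, n). (a \<otimes>\<^bsub>\<Gamma>\<^esub> b, \<lambda>c\<in>carrier \<Gamma>. m c \<otimes>\<^bsub>M\<^esub> n (c \<otimes>\<^bsub>\<Gamma>\<^esub> a))),
     one = (\<one>\<^bsub>\<Gamma>\<^esub>, \<lambda>c\<in>carrier \<Gamma>. \<one>\<^bsub>M\<^esub>)\<rparr>"

lemma wreath_simps:
  "carrier (wreath M \<Gamma>) = carrier \<Gamma> \<times> (carrier \<Gamma> \<rightarrow>\<^sub>E carrier M)"
  "(a, m) \<otimes>\<^bsub>wreath M \<Gamma>\<^esub> (b, n) = (a \<otimes>\<^bsub>\<Gamma>\<^esub> b, \<lambda>c\<in>carrier \<Gamma>. m c \<otimes>\<^bsub>M\<^esub> n (c \<otimes>\<^bsub>\<Gamma>\<^esub> a))"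
  "\<one>\<^bsub>wreath M \<Gamma>\<^esub> = (\<one>\<^bsub>\<Gamma>\<^esub>, \<lambda>c\<in>carrier \<Gamma>. \<one>\<^bsub>M\<^esub>)"
  by (simp_all add: wreath_def)

lemma group_wreath:
  assumes "group M" "group \<Gamma>"
  shows "group (wreath M \<Gamma>)"
proof -
  interpret M: group M by fact
  interpret \<Gamma>: group \<Gamma> by fact
  show ?thesis
  proof (rule groupI)
    fix x y assume "x \<in> carrier (wreath M \<Gamma>)" "y \<in> carrier (wreath M \<Gamma>)"
    then show "x \<otimes>\<^bsub>wreath M \<Gamma>\<^esub> y \<in> carrier (wreath M \<Gamma>)"
      by (cases x, cases y) (auto simp: wreath_simps PiE_iff)
  next
    show "\<one>\<^bsub>wreath M \<Gamma>\<^esub> \<in> carrier (wreath M \<Gamma>)"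
      by (auto simp: wreath_simps)
  next
    fix x y z
    assume "x \<in> carrier (wreath M \<Gamma>)" "y \<in> carrier (wreath M \<Gamma>)" "z \<in> carrier (wreath M \<Gamma>)"
    then show "x \<otimes>\<^bsub>wreath M \<Gamma>\<^esub> y \<otimes>\<^bsub>wreath M \<Gamma>\<^esub> z = x \<otimes>\<^bsub>wreath M \<Gamma>\<^esub> (y \<otimes>\<^bsub>wreath M \<Gamma>\<^esub> z)"
      by (cases x, cases y, cases z)
        (auto simp: wreath_simps PiE_iff \<Gamma>.m_assoc M.m_assoc intro!: restrict_ext)
  next
    fix x assume "x \<in> carrier (wreath M \<Gamma>)"
    then show "\<one>\<^bsub>wreath M \<Gamma>\<^esub> \<otimes>\<^bsub>wreath M \<Gamma>\<^esub> x = x"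
      by (cases x) (auto simp: wreath_simps PiE_iff extensional_def fun_eq_iff)
  next
    fix x assume x: "x \<in> carrier (wreath M \<Gamma>)"
    obtain a m where am: "x = (a, m)" by fastforce
    define y where "y = (inv\<^bsub>\<Gamma>\<^esub> a, \<lambda>c\<in>carrier \<Gamma>. inv\<^bsub>M\<^esub> m (c \<otimes>\<^bsub>\<Gamma>\<^esub> inv\<^bsub>\<Gamma>\<^esub> a))"
    have "y \<in> carrier (wreath M \<Gamma>)"
      using x by (auto simp: am y_def wreath_simps PiE_iff)
    moreover have "y \<otimes>\<^bsub>wreath M \<Gamma>\<^esub> x = \<one>\<^bsub>wreath M \<Gamma>\<^esub>"
      using x by (auto simp: am y_def wreath_simps PiE_iff intro!: restrict_ext)
    ultimately show "\<exists>y\<in>carrier (wreath M \<Gamma>). y \<otimes>\<^bsub>wreath M \<Gamma>\<^esub> x = \<one>\<^bsub>wreath M \<Gamma>\<^esub>" by blast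
  qed
qed

text \<open>If \<open>(a, m)\<close> conjugates the first base element into the second, the
  coordinates at \<open>c\<close> show that \<open>m c\<close> conjugates the value of
  \<open>n\<close> at \<open>c\<close> times \<open>a\<close> into \<open>n' c\<close>. Conjugation
  permutes the coordinates, hence the unknown \<open>d\<close>.\<close>

lemma wreath_conjugate:
  assumes "group M" "group \<Gamma>" and n: "n \<in> carrier \<Gamma> \<rightarrow> carrier M" and n': "n' \<in> carrier \<Gamma> \<rightarrow> carrier M"
    and conj: "conjugate_in (wreath M \<Gamma>) (\<one>\<^bsub>\<Gamma>\<^esub>, restrict n (carrier \<Gamma>)) (\<one>\<^bsub>\<Gamma>\<^esub>, restrict n' (carrier \<Gamma>))"
    and c: "c \<in> carrier \<Gamma>"
  shows "\<exists>d \<in> carrier \<Gamma>. conjugate_in M (n d) (n' c)"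
proof -
  interpret M: group M by fact
  interpret \<Gamma>: group \<Gamma> by fact
  interpret W: group "wreath M \<Gamma>" by (rule group_wreath) fact+
  let ?n = "(\<one>\<^bsub>\<Gamma>\<^esub>, restrict n (carrier \<Gamma>))" and ?n' = "(\<one>\<^bsub>\<Gamma>\<^esub>, restrict n' (carrier \<Gamma>))"
  obtain a m where am: "(a, m) \<in> carrier (wreath M \<Gamma>)"
    "?n' = (a, m) \<otimes>\<^bsub>wreath M \<Gamma>\<^esub> ?n \<otimes>\<^bsub>wreath M \<Gamma>\<^esub> inv\<^bsub>wreath M \<Gamma>\<^esub> (a, m)"
    using conj unfolding conjugate_in_def by (metis surj_pair)
  have "?n \<in> carrier (wreath M \<Gamma>)"
    using n by (auto simp: wreath_simps)
  then have "?n' \<otimes>\<^bsub>wreath M \<Gamma>\<^esub> (a, m) = (a, m) \<otimes>\<^bsub>wreath M \<Gamma>\<^esub> ?n"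
    using am by (simp add: W.m_assoc)
  moreover have a: "a \<in> carrier \<Gamma>" and m: "m c \<in> carrier M"
    using am(1) c by (auto simp: wreath_simps)
  ultimately have "(\<lambda>c\<in>carrier \<Gamma>. restrict n' (carrier \<Gamma>) c \<otimes>\<^bsub>M\<^esub> m (c \<otimes>\<^bsub>\<Gamma>\<^esub> \<one>\<^bsub>\<Gamma>\<^esub>)) =
      (\<lambda>c\<in>carrier \<Gamma>. m c \<otimes>\<^bsub>M\<^esub> restrict n (carrier \<Gamma>) (c \<otimes>\<^bsub>\<Gamma>\<^esub> a))"
    by (simp only: wreath_simps prod.inject)
  from fun_cong[OF this, of c] have "n' c \<otimes>\<^bsub>M\<^esub> m c = m c \<otimes>\<^bsub>M\<^esub> n (c \<otimes>\<^bsub>\<Gamma>\<^esub> a)"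
    using a c by simp
  then have "n' c = m c \<otimes>\<^bsub>M\<^esub> n (c \<otimes>\<^bsub>\<Gamma>\<^esub> a) \<otimes>\<^bsub>M\<^esub> inv\<^bsub>M\<^esub> m c"
    using funcset_mem[OF n, of "c \<otimes>\<^bsub>\<Gamma>\<^esub> a"] funcset_mem[OF n' c] c a m by (subst M.inv_solve_right) auto
  then show ?thesis
    using a c m by (auto simp: conjugate_in_def intro!: bexI[of _ "c \<otimes>\<^bsub>\<Gamma>\<^esub> a"])
qed

lemma order_wreath:
  assumes "finite (carrier \<Gamma>)"
  shows "order (wreath M \<Gamma>) = order \<Gamma> * order M ^ order \<Gamma>"
  using assms by (simp add: order_def wreath_simps card_cartesian_product card_PiE)

section \<open>Free groups are \<open>p\<close>-conjugacy separable\<close>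

text \<open>Unreduced words over a fixed countable alphabet: the rewritten words then have the same
  type as the original ones, which the induction on length needs.\<close>

definition word_separable :: "nat \<Rightarrow> nat letter list \<Rightarrow> nat letter list \<Rightarrow> bool" where
  "word_separable p u v \<longleftrightarrow> (\<exists>(M :: nat monoid) f. finite_p_group p M \<and> f \<in> UNIV \<rightarrow> carrier M \<and>
     \<not> conjugate_in M (word_val M f u) (word_val M f v))"

text \<open>Products and wreath products leave the type of naturals in which separability asks for
  its quotients. An isomorphic copy brings them back, with one assignment \<open>f'\<close> serving
  all words at once.\<close>

lemma finite_p_group_copy_words:
  fixes M :: "('m, 'x) monoid_scheme"
  assumes "prime p" and M: "finite_p_group p M" and f: "f \<in> UNIV \<rightarrow> carrier M"
  shows "\<exists>(M' :: nat monoid) f'. finite_p_group p M' \<and> f' \<in> UNIV \<rightarrow> carrier M' \<and>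
    (\<forall>u v. conjugate_in M' (word_val M' f' u) (word_val M' f' v) \<longrightarrow>
       conjugate_in M (word_val M f u) (word_val M f v))"
proof -
  interpret M: group M using M by (simp add: finite_p_group_def)
  obtain M' :: "nat monoid" where M': "finite_p_group p M'" and "M \<cong> M'"
    using finite_p_group_nat_copy[OF assms(1,2)] by blast
  then obtain h where h: "h \<in> iso M' M"
    using M.iso_sym by (auto simp: is_iso_def)
  interpret M': group M' using M' by (simp add: finite_p_group_def)
  interpret h: group_hom M' M h
    using h by unfold_locales (simp add: iso_def)
  define f' where "f' = (\<lambda>a. inv_into (carrier M') h (f a))"
  have im: "f a \<in> h ` carrier M'" for a
    using h f by (auto simp: iso_iff)
  have f': "f' \<in> UNIV \<rightarrow> carrier M'" and hf: "h (f' a) = f a" for a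
    using im by (auto simp: f'_def inv_into_into f_inv_into_f)
  have w: "word_val M' f' w \<in> carrier M'" "h (word_val M' f' w) = word_val M f w" for w
    using M'.word_val_closed[OF f', of w] h.hom_word_val[OF f', of w] by (simp_all add: hf)
  have "conjugate_in M (word_val M f u) (word_val M f v)"
    if "conjugate_in M' (word_val M' f' u) (word_val M' f' v)" for u v
    using h.hom_conjugate_in[OF that w(1)] by (simp add: w)
  then show ?thesis using M' f' by blast
qed

lemma word_separableI:
  assumes "prime p" "finite_p_group p M" "f \<in> UNIV \<rightarrow> carrier M"
    and "\<not> conjugate_in M (word_val M f u) (word_val M f v)"
  shows "word_separable p u v"
  using finite_p_group_copy_words[OF assms(1-3)] assms(4) unfolding word_separable_def by blast

lemma word_separable_sym: "word_separable p u v \<Longrightarrow> word_separable p v u"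
  unfolding word_separable_def finite_p_group_def
  by (metis UNIV_Times_UNIV group.conjugate_in_sym group.word_val_closed lists_UNIV UNIV_I)

lemma word_val_DirProd:
  assumes "group M" "group N" "f \<in> X \<rightarrow> carrier M" "g \<in> X \<rightarrow> carrier N" "w \<in> lists (X \<times> UNIV)"
  shows "word_val (M \<times>\<times> N) (\<lambda>a. (f a, g a)) w = (word_val M f w, word_val N g w)"
proof -
  interpret M: group M by fact
  interpret N: group N by fact
  interpret P: group "M \<times>\<times> N" by (rule DirProd_group) fact+
  interpret fst: group_hom "M \<times>\<times> N" M fst by unfold_locales (auto simp: hom_def)
  interpret snd: group_hom "M \<times>\<times> N" N snd by unfold_locales (auto simp: hom_def)
  have "(\<lambda>a. (f a, g a)) \<in> X \<rightarrow> carrier (M \<times>\<times> N)"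
    using assms(3,4) by auto
  from fst.hom_word_val[OF this assms(5)] snd.hom_word_val[OF this assms(5)]
  show ?thesis by (simp add: prod_eq_iff)
qed

lemma word_separable_family:
  assumes p: "prime p" and "finite V" "\<And>v. v \<in> V \<Longrightarrow> word_separable p u v"
  shows "\<exists>(M :: nat monoid) f. finite_p_group p M \<and> f \<in> UNIV \<rightarrow> carrier M \<and>
    (\<forall>v\<in>V. \<not> conjugate_in M (word_val M f u) (word_val M f v))"
  using assms(2,3)
proof (induction V rule: finite_induct)
  case empty
  have "finite_p_group p (integer_mod_group 1)"
    by (auto simp: finite_p_group_def order_def carrier_integer_mod_group intro: exI[of _ 0])
  from finite_p_group_copy_words[OF p this, of "\<lambda>_. 0"] show ?case
    by (auto simp: carrier_integer_mod_group)
next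
  case (insert v V)
  obtain M :: "nat monoid" and f where M: "finite_p_group p M" "f \<in> UNIV \<rightarrow> carrier M"
    "\<And>v. v \<in> V \<Longrightarrow> \<not> conjugate_in M (word_val M f u) (word_val M f v)"
    using insert by blast
  obtain N :: "nat monoid" and g where N: "finite_p_group p N" "g \<in> UNIV \<rightarrow> carrier N"
    "\<not> conjugate_in N (word_val N g u) (word_val N g v)"
    using insert.prems[of v] unfolding word_separable_def by blast
  have gr: "group M" "group N"
    using M N by (auto simp: finite_p_group_def)
  obtain m n where "order M = p ^ m" "order N = p ^ n"
    using M N by (auto simp: finite_p_group_def)
  then have "order (M \<times>\<times> N) = p ^ (m + n)"
    by (simp add: order_def card_cartesian_product power_add)
  then have MN: "finite_p_group p (M \<times>\<times> N)"
    using DirProd_group[OF gr] by (auto simp: finite_p_group_def)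
  have "(\<lambda>a. (f a, g a)) \<in> UNIV \<rightarrow> carrier (M \<times>\<times> N)"
    using M(2) N(2) by auto
  from finite_p_group_copy_words[OF p MN this]
  obtain P :: "nat monoid" and h where P: "finite_p_group p P" "h \<in> UNIV \<rightarrow> carrier P"
    "\<And>u v. conjugate_in P (word_val P h u) (word_val P h v) \<Longrightarrow>
       conjugate_in (M \<times>\<times> N) (word_val M f u, word_val N g u) (word_val M f v, word_val N g v)"
    using word_val_DirProd[OF gr M(2) N(2)] by auto
  have "conjugate_in M a a' \<and> conjugate_in N b b'" if "conjugate_in (M \<times>\<times> N) (a, b) (a', b')" for a b a' b'
    using that gr by (auto simp: conjugate_in_def)
  then have "\<not> conjugate_in P (word_val P h u) (word_val P h w)" if "w \<in> insert v V" for w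
    using that P(3) M(3) N(3) by blast
  then show ?case using P(1,2) by blast
qed

text \<open>A word is read by the automaton with states \<open>\<int>/p\<close> in which the letter \<open>a\<close> moves the
  state by \<open>\<chi> a\<close>. An edge, given by a positive letter and its initial state, emits a new letter,
  except that the edges of \<open>s\<close> that form the spanning tree \<open>0, 1, \<dots>, p - 1\<close> emit nothing.\<close>

definition next_state :: "nat \<Rightarrow> (nat \<Rightarrow> int) \<Rightarrow> int \<Rightarrow> nat letter \<Rightarrow> int" where
  "next_state p \<chi> c l = (c + (if snd l then \<chi> (fst l) else - \<chi> (fst l))) mod int p"

definition emit :: "nat \<Rightarrow> (nat \<Rightarrow> int) \<Rightarrow> nat \<Rightarrow> int \<Rightarrow> nat letter \<Rightarrow> nat letter list" where
  "emit p \<chi> s c l = (let e = if snd l then c else next_state p \<chi> c l in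
     if fst l = s \<and> e \<noteq> int p - 1 then [] else [(prod_encode (fst l, nat e), snd l)])"

primrec emits :: "nat \<Rightarrow> (nat \<Rightarrow> int) \<Rightarrow> nat \<Rightarrow> int \<Rightarrow> nat letter list \<Rightarrow> nat letter list" where
  "emits p \<chi> s c [] = []"
| "emits p \<chi> s c (l # w) = emit p \<chi> s c l @ emits p \<chi> s (next_state p \<chi> c l) w"

lemma next_state_range: "p > 0 \<Longrightarrow> next_state p \<chi> c l \<in> {0..<int p}"
  by (simp add: next_state_def)

lemma next_state_word_exp:
  "(next_state p \<chi> c l + word_exp \<chi> w) mod int p = (c + word_exp \<chi> (l # w)) mod int p"
  by (simp add: next_state_def mod_simps) (simp add: algebra_simps)

lemma length_emit_le: "length (emit p \<chi> s c l) \<le> 1"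
  by (simp add: emit_def Let_def)

lemma length_emits_le: "length (emits p \<chi> s c w) \<le> length w"
proof (induction w arbitrary: c)
  case (Cons l w)
  show ?case using Cons[of "next_state p \<chi> c l"] length_emit_le[of p \<chi> s c l] by simp
qed simp

text \<open>Each letter permutes the states, so a run may be prescribed by its state at any position
  and continued backwards. Placing an occurrence of \<open>s\<close> on a tree edge makes it emit
  nothing, while no letter emits more than one.\<close>

lemma length_emits_less:
  assumes "prime p" "\<chi> s = 1" "s \<in> fst ` set w"
  shows "\<exists>c\<in>{0..<int p}. length (emits p \<chi> s c w) < length w"
  using assms(3)
proof (induction w)
  case (Cons l w)
  have p: "int p \<ge> 2" using prime_ge_2_nat[OF assms(1)] by simp
  show ?case
  proof (cases "fst l = s")
    case True
    \<comment> \<open>Read positively, \<open>s\<close> crosses the tree edge from 0 to 1; read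
      negatively, it crosses the same edge from 1 to 0. This edge is in the tree because p is at
      least 2.\<close>
    define c :: int where "c = (if snd l then 0 else 1)"
    have "emit p \<chi> s c l = []"
      using p True by (auto simp: emit_def c_def next_state_def assms(2))
    then have "length (emits p \<chi> s c (l # w)) < length (l # w)"
      using length_emits_le[of p \<chi> s _ w] by (simp add: le_imp_less_Suc)
    then show ?thesis using p by (intro bexI[of _ c]) (auto simp: c_def)
  next
    case False
    then obtain c where c: "c \<in> {0..<int p}" "length (emits p \<chi> s c w) < length w"
      using Cons by auto
    define d where "d = next_state p \<chi> c (inv_letter l)"
    have "next_state p \<chi> d l = c"
      using c(1) by (auto simp: d_def next_state_def inv_letter_def mod_diff_left_eq mod_add_left_eq)
    then have "length (emits p \<chi> s d (l # w)) < length (l # w)"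
      using c(2) length_emit_le[of p \<chi> s d l] by simp
    moreover have "d \<in> {0..<int p}"
      using next_state_range[of p] p unfolding d_def by simp
    ultimately show ?thesis by blast
  qed
qed simp

text \<open>The recursion of \<open>emits\<close> is the multiplication of the wreath product: the
  first component moves the state, and the coordinate at \<open>c\<close> collects the output of the
  run from \<open>c\<close>. This induces a quotient of the whole group from one of the kernel of
  \<chi> modulo p, as in the Kaloujnine-Krasner embedding.\<close>

lemma word_val_wreath_emits:
  fixes M :: "('m, 'x) monoid_scheme" and \<chi> :: "nat \<Rightarrow> int" and s :: nat
  assumes "group M" and p: "p > 0" and g: "g \<in> UNIV \<rightarrow> carrier M"
  defines "\<Gamma> \<equiv> integer_mod_group p"
  defines "f \<equiv> \<lambda>a. (\<chi> a mod int p, \<lambda>c\<in>carrier \<Gamma>. word_val M g (emit p \<chi> s c (a, True)))"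
  shows "f \<in> UNIV \<rightarrow> carrier (wreath M \<Gamma>)"
    and "word_val (wreath M \<Gamma>) f w =
      (word_exp \<chi> w mod int p, \<lambda>c\<in>carrier \<Gamma>. word_val M g (emits p \<chi> s c w))"
proof -
  interpret M: group M by fact
  have \<Gamma>: "group \<Gamma>" by (simp add: \<Gamma>_def)
  interpret W: group "wreath M \<Gamma>" using \<Gamma> M.is_group by (intro group_wreath)
  have c\<Gamma>: "carrier \<Gamma> = {0..<int p}" using p by (simp add: \<Gamma>_def carrier_integer_mod_group)
  have [simp]: "a \<otimes>\<^bsub>\<Gamma>\<^esub> b = (a + b) mod int p" "\<one>\<^bsub>\<Gamma>\<^esub> = 0" for a b by (simp_all add: \<Gamma>_def)
  have wv [simp]: "word_val M g w \<in> carrier M" for w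
    using M.word_val_closed[OF g] by simp
  show f: "f \<in> UNIV \<rightarrow> carrier (wreath M \<Gamma>)"
    using p by (auto simp: f_def wreath_simps c\<Gamma>)
  have lv: "letter_val (wreath M \<Gamma>) f l =
      ((if snd l then \<chi> (fst l) else - \<chi> (fst l)) mod int p, \<lambda>c\<in>carrier \<Gamma>. word_val M g (emit p \<chi> s c l))" for l
  proof (cases "snd l")
    case True
    then show ?thesis by (cases l) (simp add: letter_val_def f_def)
  next
    case False
    define a where "a = fst l"
    have l: "l = (a, False)" using False by (simp add: a_def prod_eq_iff)
    let ?y = "((- \<chi> a) mod int p, \<lambda>c\<in>carrier \<Gamma>. word_val M g (emit p \<chi> s c l))"
    \<comment> \<open>A negative letter read in state \<open>c\<close> crosses backwards the edge of
      \<open>a\<close> that starts at \<open>c\<close> - \<chi> \<open>a\<close>.\<close>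
    have e: "word_val M g (emit p \<chi> s c l) = inv\<^bsub>M\<^esub> word_val M g (emit p \<chi> s ((c - \<chi> a) mod int p) (a, True))" for c
      using funcset_mem[OF g] by (auto simp: emit_def Let_def l next_state_def letter_val_def)
    have "?y \<otimes>\<^bsub>wreath M \<Gamma>\<^esub> f a = \<one>\<^bsub>wreath M \<Gamma>\<^esub>"
      using p by (auto simp: f_def wreath_simps c\<Gamma> e mod_add_right_eq mod_add_left_eq intro!: restrict_ext)
    moreover have "?y \<in> carrier (wreath M \<Gamma>)"
      using p by (auto simp: wreath_simps c\<Gamma>)
    ultimately have "inv\<^bsub>wreath M \<Gamma>\<^esub> f a = ?y"
      using f by (intro W.inv_equality) auto
    then show ?thesis by (simp add: letter_val_def l)
  qed
  show "word_val (wreath M \<Gamma>) f w =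
      (word_exp \<chi> w mod int p, \<lambda>c\<in>carrier \<Gamma>. word_val M g (emits p \<chi> s c w))"
  proof (induction w)
    case Nil
    show ?case by (simp add: wreath_simps restrict_def)
  next
    case (Cons l w)
    have "word_val M g (emits p \<chi> s c (l # w)) =
        word_val M g (emit p \<chi> s c l) \<otimes>\<^bsub>M\<^esub> word_val M g (emits p \<chi> s (next_state p \<chi> c l) w)" for c
      using M.word_val_append[OF g] by simp
    moreover have "(c + (if snd l then \<chi> (fst l) else - \<chi> (fst l)) mod int p) mod int p = next_state p \<chi> c l" for c
      by (simp add: next_state_def mod_add_right_eq)
    moreover have "next_state p \<chi> c l \<in> carrier \<Gamma>" for c
      using next_state_range[OF p] by (simp add: c\<Gamma>)
    ultimately show ?case
      by (auto simp: Cons lv wreath_simps mod_add_eq intro!: restrict_ext)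
  qed
qed

text \<open>\<open>h\<close> sends the letter coded by \<open>(a, e)\<close> to the Schreier
  generator of that edge, for the transversal of the powers of \<open>s\<close>. On tree edges this
  generator is trivial since \<chi> is 1 at \<open>s\<close>, in accordance with emitting nothing;
  along a run the generators telescope.\<close>

lemma word_val_emits_decode:
  fixes p :: nat and \<chi> :: "nat \<Rightarrow> int" and s :: nat
  assumes "prime p" and \<chi>: "\<chi> s = 1"
  defines "F \<equiv> free_group (UNIV :: nat set)"
  defines "h \<equiv> \<lambda>n. case prod_decode n of (a, e) \<Rightarrow>
    gen s [^]\<^bsub>F\<^esub> int e \<otimes>\<^bsub>F\<^esub> gen a \<otimes>\<^bsub>F\<^esub> inv\<^bsub>F\<^esub> (gen s [^]\<^bsub>F\<^esub> ((int e + \<chi> a) mod int p))"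
  shows "h \<in> UNIV \<rightarrow> carrier F"
    and "c \<in> {0..<int p} \<Longrightarrow> word_val F h (emits p \<chi> s c w) =
      gen s [^]\<^bsub>F\<^esub> c \<otimes>\<^bsub>F\<^esub> word_val F gen w \<otimes>\<^bsub>F\<^esub> inv\<^bsub>F\<^esub> (gen s [^]\<^bsub>F\<^esub> ((c + word_exp \<chi> w) mod int p))"
proof -
  interpret F: group F unfolding F_def by (rule group_free_group)
  have gF [simp]: "gen a \<in> carrier F" for a by (simp add: F_def)
  show h: "h \<in> UNIV \<rightarrow> carrier F" by (auto simp: h_def split: prod.splits)
  have p: "int p > 0" using prime_gt_0_nat[OF assms(1)] by simp
  have wF: "word_val F gen w \<in> carrier F" for w
    using F.word_val_closed[of gen UNIV w] by simp
  have lF: "letter_val F gen l \<in> carrier F" for l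
    using F.letter_val_closed[of gen UNIV l] by simp
  have edge: "word_val F h (emit p \<chi> s c (a, True)) =
      gen s [^]\<^bsub>F\<^esub> c \<otimes>\<^bsub>F\<^esub> gen a \<otimes>\<^bsub>F\<^esub> inv\<^bsub>F\<^esub> (gen s [^]\<^bsub>F\<^esub> ((c + \<chi> a) mod int p))"
    if c: "c \<in> {0..<int p}" for c a
  proof (cases "a = s \<and> c \<noteq> int p - 1")
    case True
    have "gen s [^]\<^bsub>F\<^esub> (c + 1) = gen s [^]\<^bsub>F\<^esub> c \<otimes>\<^bsub>F\<^esub> gen s"
      using F.int_pow_mult[of "gen s" c 1] by simp
    then show ?thesis using True c \<chi> by (simp add: emit_def)
  next
    case False
    then show ?thesis using c by (auto simp: emit_def letter_val_def h_def)
  qed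
  have letter: "word_val F h (emit p \<chi> s c l) =
      gen s [^]\<^bsub>F\<^esub> c \<otimes>\<^bsub>F\<^esub> letter_val F gen l \<otimes>\<^bsub>F\<^esub> inv\<^bsub>F\<^esub> (gen s [^]\<^bsub>F\<^esub> next_state p \<chi> c l)"
    if c: "c \<in> {0..<int p}" for c l
  proof (cases "snd l")
    case True
    then show ?thesis using edge[OF c, of "fst l"]
      by (cases l) (simp add: next_state_def letter_val_def)
  next
    case False
    define a where "a = fst l"
    have l: "l = (a, False)" using False by (simp add: a_def prod_eq_iff)
    define e where "e = next_state p \<chi> c l"
    have e: "e \<in> {0..<int p}" using next_state_range p by (simp add: e_def)
    have ec: "(e + \<chi> a) mod int p = c"
      using c by (simp add: e_def next_state_def l mod_diff_left_eq mod_add_left_eq)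
    have "word_val F h (emit p \<chi> s c l) = inv\<^bsub>F\<^esub> word_val F h (emit p \<chi> s e (a, True))"
      using funcset_mem[OF h] by (auto simp: emit_def Let_def l e_def letter_val_def)
    then show ?thesis
      unfolding edge[OF e] ec by (simp add: l letter_val_def F.inv_mult_group F.m_assoc e_def)
  qed
  show "word_val F h (emits p \<chi> s c w) =
      gen s [^]\<^bsub>F\<^esub> c \<otimes>\<^bsub>F\<^esub> word_val F gen w \<otimes>\<^bsub>F\<^esub> inv\<^bsub>F\<^esub> (gen s [^]\<^bsub>F\<^esub> ((c + word_exp \<chi> w) mod int p))"
    if "c \<in> {0..<int p}"
    using that
  proof (induction w arbitrary: c)
    case (Cons l w)
    have "next_state p \<chi> c l \<in> {0..<int p}" using next_state_range p by simp
    then show ?case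
      using Cons.IH F.word_val_append[OF h] letter[OF Cons.prems] next_state_word_exp[of p \<chi> c l w]
      by (simp add: F.m_assoc wF lF)
  qed simp
qed

text \<open>Both words return to their starting state, so decoding the output of a run gives a
  conjugate of the word by a power of \<open>s\<close>. A conjugacy between rewritten words would
  thus make \<open>u\<close> and \<open>v\<close> conjugate. The start for \<open>u\<close> is
  chosen with a shorter output, and no output of \<open>v\<close> is longer than \<open>v\<close>,
  so the induction hypothesis applies to every start of \<open>v\<close>.\<close>

lemma word_separable_step:
  assumes p: "prime p" and \<chi>: "\<chi> s = 1" and u: "int p dvd word_exp \<chi> u" and v: "int p dvd word_exp \<chi> v"
    and s: "s \<in> fst ` set u"
    and IH: "\<And>u' v'. length u' + length v' < length u + length v \<Longrightarrow>
      \<not> conjugate_in (free_group UNIV) (word_val (free_group UNIV) gen u') (word_val (free_group UNIV) gen v') \<Longrightarrow>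
      word_separable p u' v'"
    and nc: "\<not> conjugate_in (free_group UNIV) (word_val (free_group UNIV) gen u) (word_val (free_group UNIV) gen v)"
  shows "word_separable p u v"
proof -
  define F where "F = free_group (UNIV :: nat set)"
  interpret F: group F unfolding F_def by (rule group_free_group)
  have gF: "gen \<in> UNIV \<rightarrow> carrier F" and gs: "gen s \<in> carrier F" by (simp_all add: F_def)
  have wF [simp]: "word_val F gen w \<in> carrier F" for w
    using F.word_val_closed[OF gF] by simp
  note decode = word_val_emits_decode[where \<chi> = \<chi> and s = s, OF p \<chi>, folded F_def]
  define h where "h = (\<lambda>n. case prod_decode n of (a, e) \<Rightarrow>
    gen s [^]\<^bsub>F\<^esub> int e \<otimes>\<^bsub>F\<^esub> gen a \<otimes>\<^bsub>F\<^esub> inv\<^bsub>F\<^esub> (gen s [^]\<^bsub>F\<^esub> ((int e + \<chi> a) mod int p)))"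
  note decode = decode[folded h_def]
  interpret h: group_hom F F "word_val F h"
    using group_hom_word_val[OF F.is_group decode(1)] by (simp add: F_def)
  have conj_decode: "conjugate_in F (word_val F gen w) (word_val F h (emits p \<chi> s c w))"
    if "c \<in> {0..<int p}" "int p dvd word_exp \<chi> w" for c w
  proof -
    have "(c + word_exp \<chi> w) mod int p = c"
      using that by (metis add.right_neutral atLeastLessThan_iff dvd_imp_mod_0 mod_add_right_eq mod_pos_pos_trivial)
    then show ?thesis using decode(2)[OF that(1), of w] F.int_pow_closed[OF gs] by (auto simp: conjugate_in_def)
  qed
  obtain c where c: "c \<in> {0..<int p}" "length (emits p \<chi> s c u) < length u"
    using length_emits_less[where w = u and \<chi> = \<chi> and s = s, OF p \<chi> s] by blast
  have "word_separable p (emits p \<chi> s c u) (emits p \<chi> s i v)" if i: "i \<in> {0..<int p}" for i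
  proof (rule IH)
    show "length (emits p \<chi> s c u) + length (emits p \<chi> s i v) < length u + length v"
      using c(2) length_emits_le[of p \<chi> s i v] by simp
    show "\<not> conjugate_in (free_group UNIV) (word_val (free_group UNIV) gen (emits p \<chi> s c u))
       (word_val (free_group UNIV) gen (emits p \<chi> s i v))"
    proof
      assume "conjugate_in (free_group UNIV) (word_val (free_group UNIV) gen (emits p \<chi> s c u))
       (word_val (free_group UNIV) gen (emits p \<chi> s i v))"
      then have "conjugate_in F (word_val F h (word_val F gen (emits p \<chi> s c u)))
          (word_val F h (word_val F gen (emits p \<chi> s i v)))"
        using h.hom_conjugate_in wF unfolding F_def by blast
      moreover have "word_val F h (word_val F gen w) = word_val F h w" for w
      proof -
        have "word_val F h (gen x) = h x" for x
          using free_group_universal(2)[OF F.is_group decode(1)] by simp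
        then show ?thesis using h.hom_word_val[OF gF, of w] by simp
      qed
      ultimately have "conjugate_in F (word_val F h (emits p \<chi> s c u)) (word_val F h (emits p \<chi> s i v))"
        by simp
      then have "conjugate_in F (word_val F gen u) (word_val F gen v)"
        using conj_decode[OF c(1) u] conj_decode[OF i v] wF h.hom_closed F.conjugate_in_trans F.conjugate_in_sym
          F.word_val_closed[OF decode(1)] by (metis UNIV_I UNIV_Times_UNIV lists_UNIV)
      then show False using nc by (simp add: F_def)
    qed
  qed
  \<comment> \<open>One quotient must handle all starts of \<open>v\<close>: conjugation in the
    wreath product can move any coordinate of \<open>v\<close> to the coordinate
    \<open>c\<close>.\<close>
  then have "\<exists>(M :: nat monoid) g. finite_p_group p M \<and> g \<in> UNIV \<rightarrow> carrier M \<and>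
      (\<forall>w\<in>(\<lambda>i. emits p \<chi> s i v) ` {0..<int p}. \<not> conjugate_in M (word_val M g (emits p \<chi> s c u)) (word_val M g w))"
    by (intro word_separable_family[OF p]) blast+
  then obtain M :: "nat monoid" and g where M: "finite_p_group p M" and g: "g \<in> UNIV \<rightarrow> carrier M"
    and nM: "\<And>i. i \<in> {0..<int p} \<Longrightarrow>
      \<not> conjugate_in M (word_val M g (emits p \<chi> s c u)) (word_val M g (emits p \<chi> s i v))"
    by blast
  interpret M: group M using M by (simp add: finite_p_group_def)
  have p0: "p > 0" using prime_gt_0_nat[OF p] .
  define \<Gamma> where "\<Gamma> = integer_mod_group p"
  have \<Gamma>: "group \<Gamma>" "carrier \<Gamma> = {0..<int p}" "\<one>\<^bsub>\<Gamma>\<^esub> = 0"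
    using p0 by (simp_all add: \<Gamma>_def carrier_integer_mod_group)
  define f where "f = (\<lambda>a. (\<chi> a mod int p, \<lambda>c\<in>carrier \<Gamma>. word_val M g (emit p \<chi> s c (a, True))))"
  note W = word_val_wreath_emits[OF M.is_group p0 g, of \<chi> s, folded \<Gamma>_def, folded f_def]
  obtain k where "order M = p ^ k" using M by (auto simp: finite_p_group_def)
  then have "order (wreath M \<Gamma>) = p ^ (1 + k * p)"
    using \<Gamma> by (simp add: order_wreath) (simp add: order_def power_mult)
  then have fpW: "finite_p_group p (wreath M \<Gamma>)"
    using group_wreath[OF M.is_group \<Gamma>(1)] unfolding finite_p_group_def by blast
  have gM: "word_val M g w \<in> carrier M" for w
    using M.word_val_closed[OF g] by simp
  interpret W: group "wreath M \<Gamma>" by (rule group_wreath) (fact M.is_group \<Gamma>)+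
  have "\<not> conjugate_in (wreath M \<Gamma>) (word_val (wreath M \<Gamma>) f u) (word_val (wreath M \<Gamma>) f v)"
  proof
    assume "conjugate_in (wreath M \<Gamma>) (word_val (wreath M \<Gamma>) f u) (word_val (wreath M \<Gamma>) f v)"
    \<comment> \<open>Turned around so that the fixed coordinate \<open>c\<close> belongs to
      \<open>u\<close>, and the coordinate found by \<open>wreath_conjugate\<close> to
      \<open>v\<close>.\<close>
    then have "conjugate_in (wreath M \<Gamma>) (word_val (wreath M \<Gamma>) f v) (word_val (wreath M \<Gamma>) f u)"
      using W.conjugate_in_sym W.word_val_closed[OF W(1), of u] by simp
    then have "conjugate_in (wreath M \<Gamma>)
        (\<one>\<^bsub>\<Gamma>\<^esub>, \<lambda>c\<in>carrier \<Gamma>. word_val M g (emits p \<chi> s c v)) (\<one>\<^bsub>\<Gamma>\<^esub>, \<lambda>c\<in>carrier \<Gamma>. word_val M g (emits p \<chi> s c u))"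
      using u v by (simp add: W(2) \<Gamma>(3) dvd_imp_mod_0)
    from wreath_conjugate[OF M.is_group \<Gamma>(1) _ _ this, of c]
    obtain i where "i \<in> {0..<int p}" "conjugate_in M (word_val M g (emits p \<chi> s i v)) (word_val M g (emits p \<chi> s c u))"
      using gM c(1) \<Gamma>(2) by auto
    then show False using nM M.conjugate_in_sym gM by blast
  qed
  then show ?thesis using word_separableI[OF p fpW W(1)] by blast
qed

section \<open>Exponent sums and the induction on word length\<close>

lemma word_separable_of_exp:
  assumes p: "prime p" and ne: "word_exp \<chi> u \<noteq> word_exp \<chi> v"
  shows "word_separable p u v"
proof -
  \<comment> \<open>This k is positive, and \<open>p ^ k\<close> exceeds it, so \<open>p ^ k\<close>
    cannot divide it. In an abelian quotient conjugacy is equality.\<close>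
  define k where "k = nat \<bar>word_exp \<chi> u - word_exp \<chi> v\<bar>"
  define n where "n = p ^ k"
  have n: "n > 0" "k < n"
    using prime_gt_1_nat[OF p] power_gt_expt by (auto simp: n_def)
  define \<Gamma> where "\<Gamma> = integer_mod_group n"
  interpret \<Gamma>: comm_group \<Gamma> by (simp add: \<Gamma>_def)
  have fp: "finite_p_group p \<Gamma>"
    using n(1) \<Gamma>.is_group unfolding finite_p_group_def
    by (intro conjI exI[of _ k]) (auto simp: order_def \<Gamma>_def carrier_integer_mod_group n_def nat_power_eq)
  have f: "(\<lambda>a. \<chi> a mod int n) \<in> UNIV \<rightarrow> carrier \<Gamma>"
    using n by (auto simp: \<Gamma>_def carrier_integer_mod_group)
  have "word_val \<Gamma> (\<lambda>a. \<chi> a mod int n) u \<noteq> word_val \<Gamma> (\<lambda>a. \<chi> a mod int n) v"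
  proof
    assume "word_val \<Gamma> (\<lambda>a. \<chi> a mod int n) u = word_val \<Gamma> (\<lambda>a. \<chi> a mod int n) v"
    then have "int n dvd word_exp \<chi> u - word_exp \<chi> v"
      using n by (simp add: \<Gamma>_def word_val_integer_mod_group mod_eq_dvd_iff)
    then have "int n dvd int k" by (simp add: k_def)
    then have "k = 0" using n by (meson int_dvd_int_iff nat_dvd_not_less not_gr0)
    then show False using ne by (simp add: k_def)
  qed
  moreover have "x = y" if "conjugate_in \<Gamma> x y" "x \<in> carrier \<Gamma>" for x y
    using that by (auto simp: conjugate_in_def \<Gamma>.m_comm \<Gamma>.m_assoc)
  ultimately have "\<not> conjugate_in \<Gamma> (word_val \<Gamma> (\<lambda>a. \<chi> a mod int n) u) (word_val \<Gamma> (\<lambda>a. \<chi> a mod int n) v)"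
    using \<Gamma>.word_val_closed[OF f, of u] by auto
  then show ?thesis using word_separableI[OF p fp f] by blast
qed

text \<open>Supplies the coefficients of a character on two letters with exponent sums
  \<open>x\<close> and \<open>y\<close>: it vanishes modulo p on the word and is exactly 1 on one of
  the letters. If p does not divide \<open>x\<close>, one inverts \<open>x\<close> modulo p to solve
  for \<alpha>.\<close>

lemma prime_dvd_linear_combination:
  fixes x y :: int
  assumes p: "prime p"
  shows "\<exists>\<alpha> \<beta>. int p dvd \<alpha> * x + \<beta> * y \<and> (\<alpha> = 1 \<and> \<beta> = 0 \<or> \<beta> = 1)"
proof (cases "int p dvd x")
  case True
  then show ?thesis by (intro exI[of _ 1] exI[of _ 0]) auto
next
  case False
  have "prime (int p)" using p by simp
  then have "coprime (int p) x"
    using False prime_imp_coprime by blast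
  then obtain m k where mk: "m * int p + k * x = 1"
    using bezout_int[of "int p" x] by (auto simp: coprime_iff_gcd_eq_1)
  have "- y * k * x + 1 * y = y * (m * int p + k * x) - y * k * x"
    using mk by simp
  also have "\<dots> = int p * (y * m)" by (simp add: algebra_simps)
  finally have "- y * k * x + 1 * y = int p * (y * m)" .
  then show ?thesis
    by (intro exI[of _ "- y * k"] exI[of _ 1]) simp
qed

text \<open>If all exponent sums agree and only one letter occurs, both words are the same power.
  Otherwise two letters provide a character that vanishes modulo p on \<open>u\<close>, hence on
  \<open>v\<close>, and equals 1 at a letter \<open>s\<close> of one of the words; the shortening
  step applies to that word.\<close>

lemma word_separable:
  assumes p: "prime p"
    and "\<not> conjugate_in (free_group UNIV) (word_val (free_group UNIV) gen u) (word_val (free_group UNIV) gen v)"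
  shows "word_separable p u v"
  using assms(2)
proof (induction "length u + length v" arbitrary: u v rule: less_induct)
  case less
  define F where "F = free_group (UNIV :: nat set)"
  interpret F: group F unfolding F_def by (rule group_free_group)
  have wF: "word_val F gen w \<in> carrier F" for w
    using F.word_val_closed[of gen UNIV w] by (simp add: F_def)
  show ?case
  proof (cases "\<exists>\<chi>. word_exp \<chi> u \<noteq> word_exp \<chi> v")
    case True
    then show ?thesis using word_separable_of_exp[OF p] by blast
  next
    case False
    then have eq: "word_exp \<chi> u = word_exp \<chi> v" for \<chi> by blast
    show ?thesis
    proof (cases "\<exists>a\<in>fst ` set (u @ v). \<exists>b\<in>fst ` set (u @ v). a \<noteq> b")
      case True
      then obtain a b where ab: "a \<in> fst ` set (u @ v)" "b \<in> fst ` set (u @ v)" "a \<noteq> b" by blast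
      let ?\<delta> = "\<lambda>a b. if b = a then 1 else (0 :: int)"
      obtain \<alpha> \<beta> where \<alpha>\<beta>: "int p dvd \<alpha> * word_exp (?\<delta> a) u + \<beta> * word_exp (?\<delta> b) u"
        "\<alpha> = 1 \<and> \<beta> = 0 \<or> \<beta> = 1"
        using prime_dvd_linear_combination[OF p] by blast
      define \<chi> where "\<chi> = (\<lambda>c. \<alpha> * ?\<delta> a c + \<beta> * ?\<delta> b c)"
      have u: "int p dvd word_exp \<chi> u"
        using \<alpha>\<beta>(1) unfolding \<chi>_def word_exp_add word_exp_mult .
      then have v: "int p dvd word_exp \<chi> v" by (simp add: eq)
      obtain s where s: "\<chi> s = 1" "s \<in> fst ` set u \<or> s \<in> fst ` set v"
        using \<alpha>\<beta>(2) ab that[of a] that[of b] by (auto simp: \<chi>_def)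
      show ?thesis
      proof (cases "s \<in> fst ` set u")
        case True
        show ?thesis
          by (rule word_separable_step[where \<chi> = \<chi> and s = s]) (use p s True u v less in auto)
      next
        case False
        have "\<not> conjugate_in (free_group UNIV) (word_val (free_group UNIV) gen v) (word_val (free_group UNIV) gen u)"
          using less.prems F.conjugate_in_sym wF unfolding F_def by blast
        then have "word_separable p v u"
          by (rule word_separable_step[where \<chi> = \<chi> and s = s, rotated 6]) (use p s False u v less.hyps in auto)
        then show ?thesis by (rule word_separable_sym)
      qed
    next
      case False
      define a where "a = fst (hd (u @ v))"
      have a: "fst l = a" if "l \<in> set (u @ v)" for l
      proof -
        have "hd (u @ v) \<in> set (u @ v)" using that by (intro hd_in_set) auto
        then show ?thesis using False that unfolding a_def by blast
      qed
      have "word_val F gen u = word_val F gen v"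
        using F.word_val_single_letter[of gen a u] F.word_val_single_letter[of gen a v] a eq by (simp add: F_def)
      moreover have "conjugate_in F (word_val F gen u) (word_val F gen u)"
        using wF by (auto simp: conjugate_in_def intro!: bexI[of _ "\<one>\<^bsub>F\<^esub>"])
      ultimately show ?thesis using less.prems by (simp add: F_def)
    qed
  qed
qed

text \<open>Two words involve only finitely many letters, which are numbered by \<open>j\<close>.
  The map \<open>k\<close> inverts the numbering and kills all other naturals, so a conjugacy of the
  numbered words would map to one of \<open>x\<close> and \<open>y\<close>.\<close>

theorem p_conjugacy_separable_free_group:
  fixes X :: "'a set"
  assumes p: "prime p"
  shows "p_conjugacy_separable p (free_group X)"
  unfolding p_conjugacy_separable_def
proof (intro ballI impI)
  fix x y assume x: "x \<in> carrier (free_group X)" and y: "y \<in> carrier (free_group X)"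
    and nc: "\<not> conjugate_in (free_group X) x y"
  interpret FX: group "free_group X" by (rule group_free_group)
  interpret F: group "free_group UNIV" by (rule group_free_group)
  have "finite (fst ` set (x @ y))" by simp
  then obtain j :: "'a \<Rightarrow> nat" where j: "inj_on j (fst ` set (x @ y))"
    using finite_imp_inj_to_nat_seg by blast
  define enc where "enc = map (\<lambda>(a :: 'a, b :: bool). (j a, b))"
  define k where "k = (\<lambda>n. if n \<in> j ` fst ` set (x @ y) then gen (inv_into (fst ` set (x @ y)) j n) else \<one>\<^bsub>free_group X\<^esub>)"
  have sub: "fst ` set (x @ y) \<subseteq> X"
    using x y by (auto simp: free_group_def)
  have k: "k \<in> UNIV \<rightarrow> carrier (free_group X)"
    using sub by (auto simp: k_def inv_into_into[THEN subsetD[OF sub]] simp del: set_append)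
  interpret k: group_hom "free_group UNIV" "free_group X" "word_val (free_group X) k"
    using k by (intro group_hom_word_val FX.is_group)
  have decode: "word_val (free_group X) k (word_val (free_group UNIV) gen (enc w)) = w"
    if w: "w \<in> {x, y}" for w
  proof -
    have "word_val (free_group X) k (gen n) = k n" for n
      using free_group_universal(2)[OF FX.is_group k] by simp
    then have "word_val (free_group X) k (word_val (free_group UNIV) gen (enc w)) = word_val (free_group X) (k \<circ> j) w"
      using k.hom_word_val[of gen UNIV "enc w"] by (simp add: enc_def word_val_map_letters)
    also have "\<dots> = word_val (free_group X) gen w"
    proof (rule word_val_cong)
      fix a assume "a \<in> fst ` set w"
      then have "a \<in> fst ` set (x @ y)" using w by auto
      then show "(k \<circ> j) a = gen a" using inv_into_f_f[OF j] by (simp add: k_def del: set_append)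
    qed
    also have "\<dots> = w" using w x y by (auto intro: word_val_gen)
    finally show ?thesis .
  qed
  have "\<not> conjugate_in (free_group UNIV) (word_val (free_group UNIV) gen (enc x)) (word_val (free_group UNIV) gen (enc y))"
    using k.hom_conjugate_in[of "word_val (free_group UNIV) gen (enc x)" "word_val (free_group UNIV) gen (enc y)"]
      decode nc F.word_val_closed[of gen UNIV "enc x"] by auto
  from word_separable[OF p this]
  obtain M :: "nat monoid" and f where M: "finite_p_group p M" and f: "f \<in> UNIV \<rightarrow> carrier M"
    and nM: "\<not> conjugate_in M (word_val M f (enc x)) (word_val M f (enc y))"
    by (auto simp: word_separable_def)
  \<comment> \<open>Outside the letters of \<open>x\<close> and \<open>y\<close> the numbering need
    not be injective; \<open>f \<circ> j\<close> still assigns a value to every generator.\<close>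
  have "word_val M (f \<circ> j) \<in> hom (free_group X) M"
    using M f by (intro free_group_universal(1)) (auto simp: finite_p_group_def)
  then show "\<exists>(M :: nat monoid) \<phi>. finite_p_group p M \<and> \<phi> \<in> hom (free_group X) M \<and> \<not> conjugate_in M (\<phi> x) (\<phi> y)"
    using M nM by (auto simp: enc_def word_val_map_letters)
qed

section \<open>Subgroups of free groups\<close>

lemma reduced_append1: "reduced (u @ v) \<Longrightarrow> reduced u"
  by (induction u rule: reduced.induct) auto

lemma reduced_append2: "reduced (u @ v) \<Longrightarrow> reduced v"
  by (induction u) (auto dest: reduced_tl)

lemma length_foldr_red_cons: "length (foldr red_cons u v) \<le> length u + length v"
proof (induction u)
  case (Cons l u)
  have "length (red_cons l w) \<le> Suc (length w)" for w by (cases w) auto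
  from this[of "foldr red_cons u v"] Cons show ?case by simp
qed simp

lemma free_group_simps:
  "\<one>\<^bsub>free_group X\<^esub> = []" "u \<otimes>\<^bsub>free_group X\<^esub> v = foldr red_cons u v"
  by (simp_all add: free_group_def)

lemma letter_in_free_group: "[l] \<in> carrier (free_group X) \<longleftrightarrow> fst l \<in> X"
  by (cases l) (auto simp: free_group_def)

lemma mult_free_group_reduced:
  "reduced (u @ v) \<Longrightarrow> u \<otimes>\<^bsub>free_group X\<^esub> v = u @ v"
  using foldr_red_cons_Nil[of "u @ v"] foldr_red_cons_Nil[of v] reduced_append2[of u v]
  by (simp add: free_group_simps)

text \<open>The identity for \<open>P\<close> says that w \<mapsto> (w, P(_, w)) is a homomorphism
  into the wreath product of \<open>M\<close> with the free group, and likewise for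
  \<open>Q\<close>; homomorphisms are determined by their values on the generators.\<close>

lemma cocycle_eqI:
  fixes M :: "('m, 'x) monoid_scheme"
  assumes "group M"
    and P: "\<And>g w. g \<in> carrier (free_group X) \<Longrightarrow> w \<in> carrier (free_group X) \<Longrightarrow> P g w \<in> carrier M"
    and Q: "\<And>g w. g \<in> carrier (free_group X) \<Longrightarrow> w \<in> carrier (free_group X) \<Longrightarrow> Q g w \<in> carrier M"
    and P_mult: "\<And>g u v. g \<in> carrier (free_group X) \<Longrightarrow> u \<in> carrier (free_group X) \<Longrightarrow> v \<in> carrier (free_group X) \<Longrightarrow>
      P g (u \<otimes>\<^bsub>free_group X\<^esub> v) = P g u \<otimes>\<^bsub>M\<^esub> P (g \<otimes>\<^bsub>free_group X\<^esub> u) v"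
    and Q_mult: "\<And>g u v. g \<in> carrier (free_group X) \<Longrightarrow> u \<in> carrier (free_group X) \<Longrightarrow> v \<in> carrier (free_group X) \<Longrightarrow>
      Q g (u \<otimes>\<^bsub>free_group X\<^esub> v) = Q g u \<otimes>\<^bsub>M\<^esub> Q (g \<otimes>\<^bsub>free_group X\<^esub> u) v"
    and gen: "\<And>g x. g \<in> carrier (free_group X) \<Longrightarrow> x \<in> X \<Longrightarrow> P g (gen x) = Q g (gen x)"
    and "g \<in> carrier (free_group X)" "w \<in> carrier (free_group X)"
  shows "P g w = Q g w"
proof -
  interpret M: group M by fact
  interpret F: group "free_group X" by (rule group_free_group)
  interpret W: group "wreath M (free_group X)" by (intro group_wreath M.is_group F.is_group)
  define \<Phi> where "\<Phi> R w = (w, \<lambda>g\<in>carrier (free_group X). R g w)" for R :: "'a letter list \<Rightarrow> 'a letter list \<Rightarrow> 'm" and w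
  have hom: "\<Phi> P \<in> hom (free_group X) (wreath M (free_group X))" "\<Phi> Q \<in> hom (free_group X) (wreath M (free_group X))"
    using P P_mult Q Q_mult by (auto simp: \<Phi>_def hom_def wreath_simps intro!: restrict_ext)
  have "\<Phi> P w = \<Phi> Q w"
  proof (rule hom_free_group_eqI[OF W.is_group hom _ assms(8)])
    fix x assume "x \<in> X"
    then show "\<Phi> P (gen x) = \<Phi> Q (gen x)"
      using gen by (auto simp: \<Phi>_def intro!: restrict_ext)
  qed
  then have "(\<lambda>g\<in>carrier (free_group X). P g w) = (\<lambda>g\<in>carrier (free_group X). Q g w)"
    by (simp add: \<Phi>_def)
  from fun_cong[OF this, of g] show ?thesis using assms(7) by simp
qed

text \<open>For \<open>d\<close> one takes the least length of a word in the coset. Deleting the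
  last letter of a shortest word leads to a coset with smaller \<open>d\<close>, the parent.
  Representatives are composed along the parents rather than chosen as shortest words, as
  independent choices need not be closed under prefixes.\<close>

lemma schreier_transversal:
  fixes X :: "'a set"
  assumes "subgroup H (free_group X)"
  defines "S \<equiv> rcosets\<^bsub>free_group X\<^esub> H"
  shows "\<exists>(t :: 'a letter list set \<Rightarrow> 'a letter list) par (d :: _ \<Rightarrow> nat). t H = [] \<and>
    (\<forall>C\<in>S. t C \<in> carrier (free_group X) \<and> C = H #>\<^bsub>free_group X\<^esub> t C) \<and>
    (\<forall>C\<in>S. \<forall>C' l. C \<noteq> H \<longrightarrow> par C = (C', l) \<longrightarrow> C' \<in> S \<and> fst l \<in> X \<and>
       C = C' #>\<^bsub>free_group X\<^esub> [l] \<and> t C = t C' \<otimes>\<^bsub>free_group X\<^esub> [l] \<and> d C' < d C)"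
proof -
  define F where "F = free_group X"
  interpret F: group F unfolding F_def by (rule group_free_group)
  interpret H: subgroup H F using assms by (simp add: F_def)
  have S: "S = rcosets\<^bsub>F\<^esub> H" by (simp add: S_def F_def)
  define d where "d C = (LEAST n. \<exists>w\<in>C. length w = n)" for C :: "'a letter list set"
  have d_le: "d C \<le> length w" if "w \<in> C" for C w
    unfolding d_def using that by (auto intro: Least_le)
  have d_ex: "\<exists>w\<in>C. length w = d C" if "C \<noteq> {}" for C
    unfolding d_def by (rule LeastI_ex) (use that in auto)
  have S_ne: "C \<noteq> {}" and S_carrier: "C \<subseteq> carrier F" if "C \<in> S" for C
    using that S F.rcosets_part_G[OF H.subgroup_axioms] H.rcosets_non_empty by auto
  have S_eq: "C = H #>\<^bsub>F\<^esub> w" if "C \<in> S" "w \<in> C" for C w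
    using that F.repr_independence[OF _ _ H.subgroup_axioms] S by (auto simp: RCOSETS_def)
  have mem: "w \<in> H #>\<^bsub>F\<^esub> w" "H #>\<^bsub>F\<^esub> w \<in> S" if "w \<in> carrier F" for w
    using that F.rcos_self[OF _ H.subgroup_axioms] S F.rcosetsI[OF H.subset] by auto
  have d0: "C = H" if "C \<in> S" "d C = 0" for C
    using d_ex[OF S_ne[OF that(1)]] that S_eq[OF that(1), of "[]"] F.coset_mult_one[OF H.subset]
    by (simp add: F_def free_group_simps)
  have "\<exists>C' l. C' \<in> S \<and> fst l \<in> X \<and> C = C' #>\<^bsub>F\<^esub> [l] \<and> d C = Suc (d C')" if C: "C \<in> S" "C \<noteq> H" for C
  proof -
    obtain w where w: "w \<in> C" "length w = d C" using d_ex[OF S_ne[OF C(1)]] by blast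
    have "w \<noteq> []" using d0 C w by auto
    then obtain u l where ul: "w = u @ [l]" by (metis rev_exhaust)
    have wF: "w \<in> carrier F" using S_carrier C w by blast
    then have u: "u \<in> carrier F" and l: "[l] \<in> carrier F" and "w = u \<otimes>\<^bsub>F\<^esub> [l]"
      using mult_free_group_reduced[of u "[l]" X] reduced_append1[of u "[l]"]
      by (auto simp: ul F_def free_group_def)
    then have CC: "C = (H #>\<^bsub>F\<^esub> u) #>\<^bsub>F\<^esub> [l]"
      using S_eq[OF C(1) w(1)] F.coset_mult_assoc[OF H.subset u l] by simp
    have "d (H #>\<^bsub>F\<^esub> u) \<le> length u" using d_le mem(1)[OF u] by blast
    moreover have "d C \<le> Suc (d (H #>\<^bsub>F\<^esub> u))"
    proof -
      obtain v where v: "v \<in> H #>\<^bsub>F\<^esub> u" "length v = d (H #>\<^bsub>F\<^esub> u)"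
        using d_ex[OF S_ne[OF mem(2)[OF u]]] by blast
      then have "v \<otimes>\<^bsub>F\<^esub> [l] \<in> C" unfolding CC by (auto simp: r_coset_def)
      then have "d C \<le> length (v \<otimes>\<^bsub>F\<^esub> [l])" by (rule d_le)
      also have "\<dots> \<le> Suc (length v)"
        using length_foldr_red_cons[of v "[l]"] by (simp add: F_def free_group_simps)
      finally show ?thesis using v by simp
    qed
    ultimately have "d C = Suc (d (H #>\<^bsub>F\<^esub> u))" using w ul by simp
    moreover have "fst l \<in> X" using l by (simp add: F_def letter_in_free_group)
    ultimately show ?thesis using mem(2)[OF u] CC by blast
  qed
  then have "\<forall>C. \<exists>q. C \<in> S \<longrightarrow> C \<noteq> H \<longrightarrow> fst q \<in> S \<and> fst (snd q) \<in> X \<and> C = fst q #>\<^bsub>F\<^esub> [snd q] \<and> d C = Suc (d (fst q))"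
    by (metis fst_conv snd_conv)
  then obtain par where par: "\<And>C. C \<in> S \<Longrightarrow> C \<noteq> H \<Longrightarrow>
      fst (par C) \<in> S \<and> fst (snd (par C)) \<in> X \<and> C = fst (par C) #>\<^bsub>F\<^esub> [snd (par C)] \<and> d C = Suc (d (fst (par C)))"
    by (metis (no_types))
  define r where "r = rec_nat (\<lambda>C. []) (\<lambda>n r C. r (fst (par C)) \<otimes>\<^bsub>F\<^esub> [snd (par C)])"
  define t where "t C = r (d C) C" for C
  have "[] \<in> H" using H.one_closed by (simp add: F_def free_group_simps)
  then have dH: "d H = 0" using d_le[of "[]" H] by simp
  have tH: "t H = []" by (simp add: t_def dH r_def)
  have t_par: "t C = t (fst (par C)) \<otimes>\<^bsub>F\<^esub> [snd (par C)]" if "C \<in> S" "C \<noteq> H" for C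
    using par[OF that] by (simp add: t_def r_def)
  have t: "t C \<in> carrier F \<and> C = H #>\<^bsub>F\<^esub> t C" if "C \<in> S" for C
    using that
  proof (induction "d C" arbitrary: C rule: less_induct)
    case less
    show ?case
    proof (cases "C = H")
      case True
      then show ?thesis using tH F.coset_mult_one[OF H.subset] F.one_closed by (simp add: F_def free_group_simps)
    next
      case False
      note q = par[OF less.prems False]
      have IH: "t (fst (par C)) \<in> carrier F" "fst (par C) = H #>\<^bsub>F\<^esub> t (fst (par C))"
        using less.hyps[of "fst (par C)"] q by auto
      have l: "[snd (par C)] \<in> carrier F" using q by (simp add: F_def letter_in_free_group)
      have "C = H #>\<^bsub>F\<^esub> (t (fst (par C)) \<otimes>\<^bsub>F\<^esub> [snd (par C)])"
        using q IH F.coset_mult_assoc[OF H.subset IH(1) l] by metis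
      then show ?thesis using t_par[OF less.prems False] IH(1) l by simp
    qed
  qed
  show ?thesis
    unfolding F_def[symmetric]
  proof (intro exI conjI ballI allI impI)
    show "t H = []" by fact
    show "t C \<in> carrier F" "C = H #>\<^bsub>F\<^esub> t C" if "C \<in> S" for C using t[OF that] by auto
    show "C' \<in> S" "fst l \<in> X" "C = C' #>\<^bsub>F\<^esub> [l]" "t C = t C' \<otimes>\<^bsub>F\<^esub> [l]" "d C' < d C"
      if "C \<in> S" "C \<noteq> H" "par C = (C', l)" for C C' l
      using par[OF that(1,2)] t_par[OF that(1,2)] that(3) by auto
  qed
qed

text \<open>The basis consists of the edges of the coset graph outside the spanning tree given by
  the parents. Reading a word along the graph and recording such edges (\<open>rd\<close>) is
  inverse to sending an edge to its Schreier generator (\<open>\<beta>\<close>). Defined as a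
  homomorphism into a wreath product, the reading respects free reduction by construction, so no
  cancellation has to be studied.\<close>

theorem nielsen_schreier:
  fixes X :: "'a set"
  assumes "subgroup H (free_group X)"
  shows "\<exists>Y :: ('a letter list set \<times> 'a) set. (free_group X)\<lparr>carrier := H\<rparr> \<cong> free_group Y"
proof -
  define F where "F = free_group X"
  interpret F: group F unfolding F_def by (rule group_free_group)
  interpret H: subgroup H F using assms by (simp add: F_def)
  define S where "S = rcosets\<^bsub>F\<^esub> H"
  obtain t par d where tr: "t H = []"
    "\<forall>C\<in>S. t C \<in> carrier F \<and> C = H #>\<^bsub>F\<^esub> t C"
    "\<forall>C\<in>S. \<forall>C' l. C \<noteq> H \<longrightarrow> par C = (C', l) \<longrightarrow> C' \<in> S \<and> fst l \<in> X \<and>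
       C = C' #>\<^bsub>F\<^esub> [l] \<and> t C = t C' \<otimes>\<^bsub>F\<^esub> [l] \<and> d C' < (d C :: nat)"
    using schreier_transversal[OF assms, folded F_def, folded S_def] by (elim exE conjE) (rule that)
  have tH: "t H = \<one>\<^bsub>F\<^esub>" using tr(1) by (simp add: F_def free_group_simps)
  have t: "t C \<in> carrier F" "C = H #>\<^bsub>F\<^esub> t C" if "C \<in> S" for C
    using tr(2) that by blast+
  have par: "C' \<in> S \<and> fst l \<in> X \<and> C = C' #>\<^bsub>F\<^esub> [l] \<and> t C = t C' \<otimes>\<^bsub>F\<^esub> [l] \<and> d C' < d C"
    if "C \<in> S" "C \<noteq> H" "par C = (C', l)" for C C' l
    using tr(3) that by blast
  have gF: "gen x \<in> carrier F" "[(x, False)] \<in> carrier F" "[(x, False)] \<otimes>\<^bsub>F\<^esub> gen x = \<one>\<^bsub>F\<^esub>" if "x \<in> X" for x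
    using that by (auto simp: F_def letter_in_free_group free_group_simps gen_def inv_letter_def)
  have SI: "H #>\<^bsub>F\<^esub> g \<in> S" if "g \<in> carrier F" for g
    using that F.rcosetsI[OF H.subset] by (simp add: S_def)
  have assoc: "(H #>\<^bsub>F\<^esub> g) #>\<^bsub>F\<^esub> k = H #>\<^bsub>F\<^esub> (g \<otimes>\<^bsub>F\<^esub> k)" if "g \<in> carrier F" "k \<in> carrier F" for g k
    using F.coset_mult_assoc[OF H.subset that] .
  have SM: "C #>\<^bsub>F\<^esub> g \<in> S" if "C \<in> S" "g \<in> carrier F" for C g
    using t[OF that(1)] that(2) assoc SI by (metis F.m_closed)
  \<comment> \<open>A tree edge is crossed either towards the child, whose parent letter is then
    positive, or towards the parent, the parent letter being negative.\<close>
  define tree where "tree C x \<longleftrightarrow> (C #>\<^bsub>F\<^esub> gen x \<noteq> H \<and> par (C #>\<^bsub>F\<^esub> gen x) = (C, (x, True))) \<or>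
      (C \<noteq> H \<and> par C = (C #>\<^bsub>F\<^esub> gen x, (x, False)))" for C x
  define Y where "Y = {(C, x). C \<in> S \<and> x \<in> X \<and> \<not> tree C x}"
  define K where "K = free_group Y"
  interpret K: group K unfolding K_def by (rule group_free_group)
  define lab where "lab C x = (if tree C x then \<one>\<^bsub>K\<^esub> else gen (C, x))" for C x
  have lab: "lab C x \<in> carrier K" if "C \<in> S" "x \<in> X" for C x
    using that unfolding lab_def K_def by (simp add: Y_def group.is_monoid[OF group_free_group] monoid.one_closed)
  define f where "f x = (gen x, \<lambda>g\<in>carrier F. lab (H #>\<^bsub>F\<^esub> g) x)" for x
  interpret W: group "wreath K F" by (intro group_wreath K.is_group F.is_group)
  have f: "f \<in> X \<rightarrow> carrier (wreath K F)"
    using SI lab gF by (auto simp: f_def wreath_simps)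
  define \<Phi> where "\<Phi> = word_val (wreath K F) f"
  have \<Phi>: "\<Phi> \<in> hom F (wreath K F)" "\<And>x. x \<in> X \<Longrightarrow> \<Phi> (gen x) = f x"
    using free_group_universal(1,2)[OF W.is_group f] by (simp_all add: \<Phi>_def F_def)
  have "fst \<in> hom (wreath K F) F"
    by (auto simp: hom_def wreath_simps)
  then have "fst \<circ> \<Phi> \<in> hom F F" using \<Phi>(1) by (rule hom_compose[rotated])
  then have fst: "fst (\<Phi> w) = w" if "w \<in> carrier F" for w
    using hom_free_group_eqI[of F "fst \<circ> \<Phi>" X "\<lambda>w. w" w] that \<Phi>(2) F.is_group
    by (auto simp: F_def[symmetric] f_def hom_def)
  define rd where "rd g w = snd (\<Phi> w) g" for g w
  have rd: "rd g w \<in> carrier K" if "g \<in> carrier F" "w \<in> carrier F" for g w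
    using hom_in_carrier[OF \<Phi>(1) that(2)] that(1) by (auto simp: rd_def wreath_simps mem_Times_iff)
  have rd_mult: "rd g (u \<otimes>\<^bsub>F\<^esub> v) = rd g u \<otimes>\<^bsub>K\<^esub> rd (g \<otimes>\<^bsub>F\<^esub> u) v"
    if "g \<in> carrier F" "u \<in> carrier F" "v \<in> carrier F" for g u v
  proof -
    have "\<Phi> (u \<otimes>\<^bsub>F\<^esub> v) = (u, snd (\<Phi> u)) \<otimes>\<^bsub>wreath K F\<^esub> (v, snd (\<Phi> v))"
      using hom_mult[OF \<Phi>(1)] that fst by (metis prod.collapse)
    then show ?thesis using that by (simp add: rd_def wreath_simps)
  qed
  have rd_gen: "rd g (gen x) = lab (H #>\<^bsub>F\<^esub> g) x" if "g \<in> carrier F" "x \<in> X" for g x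
    using that \<Phi>(2) by (simp add: rd_def f_def)
  have rd_one: "rd g \<one>\<^bsub>F\<^esub> = \<one>\<^bsub>K\<^esub>" if "g \<in> carrier F" for g
    using rd_mult[OF that, of "\<one>\<^bsub>F\<^esub>" "\<one>\<^bsub>F\<^esub>"] rd[OF that, of "\<one>\<^bsub>F\<^esub>"] that by simp
  \<comment> \<open>Left translation by H keeps the coset of every position, so both readings see
    the same labels. This makes the reading from the identity multiplicative on H.\<close>
  have H_shift: "rd (h \<otimes>\<^bsub>F\<^esub> g) w = rd g w" if h: "h \<in> H" and gw: "g \<in> carrier F" "w \<in> carrier F" for h g w
  proof (rule cocycle_eqI[where X = X and M = K and P = "\<lambda>g. rd (h \<otimes>\<^bsub>F\<^esub> g)" and Q = rd, folded F_def])
    have hF: "h \<in> carrier F" using h H.subset by blast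
    show "rd (h \<otimes>\<^bsub>F\<^esub> g) (u \<otimes>\<^bsub>F\<^esub> v) = rd (h \<otimes>\<^bsub>F\<^esub> g) u \<otimes>\<^bsub>K\<^esub> rd (h \<otimes>\<^bsub>F\<^esub> (g \<otimes>\<^bsub>F\<^esub> u)) v"
      if "g \<in> carrier F" "u \<in> carrier F" "v \<in> carrier F" for g u v
      using that hF rd_mult[of "h \<otimes>\<^bsub>F\<^esub> g"] by (simp add: F.m_assoc)
    show "rd (h \<otimes>\<^bsub>F\<^esub> g) (gen x) = rd g (gen x)" if "g \<in> carrier F" "x \<in> X" for g x
      using that hF assoc[OF hF] H.rcos_const[OF F.is_group h] by (simp add: rd_gen)
  qed (use h H.subset gw K.is_group rd rd_mult in auto)
  define \<beta> where "\<beta> = word_val F (\<lambda>(C, x). t C \<otimes>\<^bsub>F\<^esub> gen x \<otimes>\<^bsub>F\<^esub> inv\<^bsub>F\<^esub> t (C #>\<^bsub>F\<^esub> gen x))"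
  have edge_H: "t C \<otimes>\<^bsub>F\<^esub> gen x \<otimes>\<^bsub>F\<^esub> inv\<^bsub>F\<^esub> t (C #>\<^bsub>F\<^esub> gen x) \<in> H" if C: "C \<in> S" and x: "x \<in> X" for C x
  proof -
    have "t C \<otimes>\<^bsub>F\<^esub> gen x \<in> H #>\<^bsub>F\<^esub> t (C #>\<^bsub>F\<^esub> gen x)"
      using t(2)[OF SM[OF C gF(1)[OF x]]] t[OF C] assoc[OF t(1)[OF C] gF(1)[OF x]]
        F.rcos_self[OF _ H.subgroup_axioms, of "t C \<otimes>\<^bsub>F\<^esub> gen x"] gF(1)[OF x]
      by (metis F.m_closed)
    then show ?thesis
      using t(1)[OF SM[OF C gF(1)[OF x]]] H.rcos_module_imp[OF F.is_group] by blast
  qed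
  have bF: "(\<lambda>(C, x). t C \<otimes>\<^bsub>F\<^esub> gen x \<otimes>\<^bsub>F\<^esub> inv\<^bsub>F\<^esub> t (C #>\<^bsub>F\<^esub> gen x)) \<in> Y \<rightarrow> carrier F"
    using edge_H H.subset by (auto simp: Y_def)
  interpret \<beta>: group_hom K F \<beta>
    unfolding \<beta>_def K_def by (rule group_hom_word_val[OF F.is_group bF])
  have \<beta>_gen: "\<beta> (gen (C, x)) = t C \<otimes>\<^bsub>F\<^esub> gen x \<otimes>\<^bsub>F\<^esub> inv\<^bsub>F\<^esub> t (C #>\<^bsub>F\<^esub> gen x)" if "(C, x) \<in> Y" for C x
    using free_group_universal(2)[OF F.is_group bF that] by (simp add: \<beta>_def)
  have \<beta>_H: "\<beta> w \<in> H" if "w \<in> carrier K" for w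
  proof -
    have "w \<in> lists (Y \<times> UNIV)" using that by (simp add: K_def free_group_def)
    then show ?thesis unfolding \<beta>_def
      by (induction w) (use edge_H in \<open>auto simp: letter_val_def Y_def intro!: H.m_closed\<close>)
  qed
  \<comment> \<open>Both sides are cocycles in \<open>g\<close> and \<open>w\<close>, the right one
    by telescoping, so comparing them on single generators suffices; across a tree edge both are
    trivial.\<close>
  have \<beta>_rd: "\<beta> (rd g w) = t (H #>\<^bsub>F\<^esub> g) \<otimes>\<^bsub>F\<^esub> w \<otimes>\<^bsub>F\<^esub> inv\<^bsub>F\<^esub> t (H #>\<^bsub>F\<^esub> (g \<otimes>\<^bsub>F\<^esub> w))"
    if gw: "g \<in> carrier F" "w \<in> carrier F" for g w
  proof (rule cocycle_eqI[where X = X and M = F and P = "\<lambda>g w. \<beta> (rd g w)" and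
        Q = "\<lambda>g w. t (H #>\<^bsub>F\<^esub> g) \<otimes>\<^bsub>F\<^esub> w \<otimes>\<^bsub>F\<^esub> inv\<^bsub>F\<^esub> t (H #>\<^bsub>F\<^esub> (g \<otimes>\<^bsub>F\<^esub> w))", folded F_def])
    fix g x assume g: "g \<in> carrier F" and x: "x \<in> X"
    define C where "C = H #>\<^bsub>F\<^esub> g"
    have C: "C \<in> S" and Cx: "C #>\<^bsub>F\<^esub> gen x \<in> S" and Cx_eq: "H #>\<^bsub>F\<^esub> (g \<otimes>\<^bsub>F\<^esub> gen x) = C #>\<^bsub>F\<^esub> gen x"
      using g gF(1)[OF x] SI SM assoc by (simp_all add: C_def)
    have "\<beta> (lab C x) = t C \<otimes>\<^bsub>F\<^esub> gen x \<otimes>\<^bsub>F\<^esub> inv\<^bsub>F\<^esub> t (C #>\<^bsub>F\<^esub> gen x)"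
    proof (cases "tree C x")
      case True
      then have "t C \<otimes>\<^bsub>F\<^esub> gen x = t (C #>\<^bsub>F\<^esub> gen x)"
        unfolding tree_def
      proof
        assume "C #>\<^bsub>F\<^esub> gen x \<noteq> H \<and> par (C #>\<^bsub>F\<^esub> gen x) = (C, (x, True))"
        then show ?thesis using par[OF Cx] by (metis gen_def)
      next
        assume "C \<noteq> H \<and> par C = (C #>\<^bsub>F\<^esub> gen x, (x, False))"
        then have "t C = t (C #>\<^bsub>F\<^esub> gen x) \<otimes>\<^bsub>F\<^esub> [(x, False)]" using par[OF C] by blast
        then show ?thesis using gF[OF x] t(1)[OF Cx] by (simp add: F.m_assoc)
      qed
      then show ?thesis using True t(1)[OF Cx] by (simp add: lab_def)
    next
      case False
      then show ?thesis using \<beta>_gen C x by (simp add: lab_def Y_def)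
    qed
    then show "\<beta> (rd g (gen x)) = t (H #>\<^bsub>F\<^esub> g) \<otimes>\<^bsub>F\<^esub> gen x \<otimes>\<^bsub>F\<^esub> inv\<^bsub>F\<^esub> t (H #>\<^bsub>F\<^esub> (g \<otimes>\<^bsub>F\<^esub> gen x))"
      using g x by (simp add: rd_gen Cx_eq C_def)
  qed (use gw F.is_group rd rd_mult SI t(1) in \<open>auto simp: F.m_assoc\<close>)
  \<comment> \<open>The path of a representative stays in the tree, where all labels are
    trivial.\<close>
  have rd_t: "rd \<one>\<^bsub>F\<^esub> (t C) = \<one>\<^bsub>K\<^esub>" if "C \<in> S" for C
    using that
  proof (induction "d C" arbitrary: C rule: less_induct)
    case less
    show ?case
    proof (cases "C = H")
      case True
      then show ?thesis by (simp add: tH rd_one)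
    next
      case False
      obtain C' x b where q: "par C = (C', (x, b))" by (metis surj_pair)
      have p: "C' \<in> S" "x \<in> X" "C = C' #>\<^bsub>F\<^esub> [(x, b)]" "t C = t C' \<otimes>\<^bsub>F\<^esub> [(x, b)]" "d C' < d C"
        using par[OF less.prems False q] by auto
      have tC': "t C' \<in> carrier F" "C' = H #>\<^bsub>F\<^esub> t C'" and l: "[(x, b)] \<in> carrier F"
        using t p(1,2) by (auto simp: F_def letter_in_free_group)
      have "rd (t C') [(x, b)] = \<one>\<^bsub>K\<^esub>"
      proof (cases b)
        case True
        then have "tree C' x" using p q False by (simp add: tree_def gen_def)
        then show ?thesis using True tC' p(2) rd_gen[of "t C'" x] by (simp add: lab_def gen_def)
      next
        case b: False
        have CH: "H #>\<^bsub>F\<^esub> (t C' \<otimes>\<^bsub>F\<^esub> [(x, b)]) = C"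
          using assoc[OF tC'(1) l] unfolding tC'(2)[symmetric] p(3)[symmetric] ..
        have "C #>\<^bsub>F\<^esub> gen x = H #>\<^bsub>F\<^esub> (t C' \<otimes>\<^bsub>F\<^esub> [(x, b)] \<otimes>\<^bsub>F\<^esub> gen x)"
          using assoc[OF _ gF(1)[OF p(2)], of "t C' \<otimes>\<^bsub>F\<^esub> [(x, b)]"] tC'(1) l CH by simp
        also have "\<dots> = C'"
          using tC' gF[OF p(2)] b by (simp add: F.m_assoc)
        finally have "tree C x" using q False b by (simp add: tree_def)
        moreover note CH
        ultimately have "rd (t C' \<otimes>\<^bsub>F\<^esub> [(x, b)]) (gen x) = \<one>\<^bsub>K\<^esub>"
          using rd_gen[of "t C' \<otimes>\<^bsub>F\<^esub> [(x, b)]" x] tC' l p(2) by (simp add: lab_def)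
        then show ?thesis
          using rd_mult[OF tC'(1) l gF(1)[OF p(2)]] gF(3)[OF p(2)] b rd_one[OF tC'(1)] rd[OF tC'(1) l] by simp
      qed
      then show ?thesis
        using rd_mult[OF F.one_closed tC'(1) l] p(4) less.hyps[OF p(5) p(1)] tC'(1) by simp
    qed
  qed
  let ?H = "F\<lparr>carrier := H\<rparr>"
  have hom: "rd \<one>\<^bsub>F\<^esub> \<in> hom ?H K"
  proof (rule homI)
    fix h k assume "h \<in> carrier ?H" "k \<in> carrier ?H"
    then have "h \<in> H" "k \<in> H" "h \<in> carrier F" "k \<in> carrier F" using H.subset by auto
    then show "rd \<one>\<^bsub>F\<^esub> h \<in> carrier K" "rd \<one>\<^bsub>F\<^esub> (h \<otimes>\<^bsub>?H\<^esub> k) = rd \<one>\<^bsub>F\<^esub> h \<otimes>\<^bsub>K\<^esub> rd \<one>\<^bsub>F\<^esub> k"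
      using rd rd_mult[of "\<one>\<^bsub>F\<^esub>" h k] H_shift[of h "\<one>\<^bsub>F\<^esub>" k] by auto
  qed
  have \<beta>rd: "\<beta> (rd \<one>\<^bsub>F\<^esub> h) = h" if "h \<in> H" for h
    using that \<beta>_rd[of "\<one>\<^bsub>F\<^esub>" h] H.subset H.rcos_const[OF F.is_group] tH by (auto simp: subset_iff)
  have "rd \<one>\<^bsub>F\<^esub> \<circ> \<beta> \<in> hom K K"
    using hom \<beta>_H by (auto simp: hom_def)
  then have rd\<beta>: "rd \<one>\<^bsub>F\<^esub> (\<beta> w) = w" if "w \<in> carrier K" for w
  proof -
    have "(rd \<one>\<^bsub>F\<^esub> \<circ> \<beta>) w = (\<lambda>w. w) w"
    proof (rule hom_free_group_eqI[where X = Y, OF K.is_group, folded K_def])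
      fix y assume y: "y \<in> Y"
      obtain C x where Cx: "y = (C, x)" by fastforce
      have C: "C \<in> S" and x: "x \<in> X" and nt: "\<not> tree C x" using y by (auto simp: Cx Y_def)
      let ?C' = "C #>\<^bsub>F\<^esub> gen x" and ?h = "\<beta> (gen y)"
      have C': "?C' \<in> S" using SM C gF(1)[OF x] by blast
      have h: "?h \<in> H" "?h \<in> carrier F" using \<beta>_H[of "gen y"] H.subset y by (auto simp: K_def)
      \<comment> \<open>Appending the representative of the end coset does not change the reading,
        and turns the Schreier generator into a tree path followed by the single edge
        \<open>y\<close>.\<close>
      have "rd \<one>\<^bsub>F\<^esub> ?h = rd \<one>\<^bsub>F\<^esub> (?h \<otimes>\<^bsub>F\<^esub> t ?C')"
        using rd_mult[OF F.one_closed h(2) t(1)[OF C']] H_shift[OF h(1) F.one_closed t(1)[OF C']] rd_t[OF C'] h rd[OF _ h(2)]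
        by simp
      also have "?h \<otimes>\<^bsub>F\<^esub> t ?C' = t C \<otimes>\<^bsub>F\<^esub> gen x"
        using \<beta>_gen[of C x] y t(1)[OF C] t(1)[OF C'] gF(1)[OF x] by (simp add: Cx F.m_assoc)
      also have "rd \<one>\<^bsub>F\<^esub> (t C \<otimes>\<^bsub>F\<^esub> gen x) = lab C x"
        using rd_mult[OF F.one_closed t(1)[OF C] gF(1)[OF x]] rd_t[OF C] rd_gen[OF t(1)[OF C] x] t[OF C] lab[OF C x] by simp
      finally show "(rd \<one>\<^bsub>F\<^esub> \<circ> \<beta>) (gen y) = gen y" using nt by (simp add: lab_def Cx)
    qed (use \<open>rd \<one>\<^bsub>F\<^esub> \<circ> \<beta> \<in> hom K K\<close> that in \<open>auto simp: hom_def\<close>)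
    then show ?thesis by simp
  qed
  have "bij_betw (rd \<one>\<^bsub>F\<^esub>) H (carrier K)"
    using hom \<beta>_H \<beta>rd rd\<beta> by (intro bij_betw_byWitness[where f' = \<beta>]) (auto simp: hom_def)
  then have "?H \<cong> K" using hom by (auto intro!: is_isoI isoI)
  then show ?thesis unfolding F_def K_def by blast
qed

section \<open>Centralizers in free groups\<close>

text \<open>Equally many letters are lost at the end of \<open>u\<close> and at the start of
  \<open>v\<close>; this common \<open>j\<close> makes lengths and positions in the product
  computable. A new first letter of \<open>u\<close> either survives or, only if the rest of
  \<open>u\<close> has been used up, cancels one more letter of \<open>v\<close>.\<close>

lemma foldr_red_cons_cancellation:
  "reduced u \<Longrightarrow> \<exists>j \<le> length u. j \<le> length v \<and> foldr red_cons u v = take (length u - j) u @ drop j v"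
proof (induction u)
  case (Cons l u)
  then obtain j where j: "j \<le> length u" "j \<le> length v" "foldr red_cons u v = take (length u - j) u @ drop j v"
    using reduced_tl by blast
  show ?case
  proof (cases "j < length u")
    case True
    then obtain m u' where u: "u = m # u'" by (cases u) auto
    have "length u - j = Suc (length u - Suc j)" using True by simp
    then have "foldr red_cons u v = m # (take (length u - Suc j) u' @ drop j v)"
      using j(3) by (simp add: u)
    then have "red_cons l (foldr red_cons u v) = l # foldr red_cons u v"
      using Cons.prems by (simp add: u)
    then show ?thesis using j True by (intro exI[of _ j]) (simp add: Suc_diff_le)
  next
    case False
    then have jl: "j = length u" and f: "foldr red_cons u v = drop j v" using j by auto
    show ?thesis
    proof (cases "drop j v \<noteq> [] \<and> hd (drop j v) = inv_letter l")
      case True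
      then have "red_cons l (drop j v) = drop (Suc j) v"
        by (cases "drop j v") (auto simp: drop_Suc drop_tl[symmetric] tl_drop[symmetric] dest: arg_cong[where f = tl])
      then show ?thesis using True jl f by (intro exI[of _ "Suc j"]) auto
    next
      case False
      then have "red_cons l (drop j v) = l # drop j v" by (cases "drop j v") auto
      then show ?thesis using jl f j by (intro exI[of _ j]) (auto simp: Suc_diff_le)
    qed
  qed
qed simp

lemma reduced_append_iff:
  "reduced (u @ v) \<longleftrightarrow> reduced u \<and> reduced v \<and> (u = [] \<or> v = [] \<or> hd v \<noteq> inv_letter (last u))"
proof (induction u)
  case (Cons l u)
  then show ?case by (cases u; cases v) auto
qed simp

lemma reduced_Cons_iff: "reduced (l # u) \<longleftrightarrow> reduced u \<and> (u = [] \<or> hd u \<noteq> inv_letter l)"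
  by (cases u) auto

lemma reduced_power: "reduced (a @ a) \<Longrightarrow> reduced (concat (replicate k a))"
proof (induction k)
  case (Suc k)
  then show ?case by (cases k; cases "a = []") (auto simp: reduced_append_iff)
qed simp

lemma nth_concat_replicate: "i < k * length a \<Longrightarrow> concat (replicate k a) ! i = a ! (i mod length a)"
  by (induction k arbitrary: i) (auto simp: nth_append le_mod_geq)

lemma length_concat_replicate: "length (concat (replicate k a)) = k * length a"
  by (induction k) auto

lemma free_group_nat_pow:
  assumes "a \<in> carrier (free_group X)" "reduced (a @ a)"
  shows "a [^]\<^bsub>free_group X\<^esub> k = concat (replicate k a)"
proof (induction k)
  case 0
  show ?case by (simp add: free_group_simps)
next
  case (Suc k)
  interpret F: group "free_group X" by (rule group_free_group)
  have "a [^]\<^bsub>free_group X\<^esub> Suc k = a \<otimes>\<^bsub>free_group X\<^esub> concat (replicate k a)"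
    using F.nat_pow_Suc2[OF assms(1), of k] Suc by simp
  then show ?case
    using mult_free_group_reduced[of a "concat (replicate k a)" X] reduced_power[OF assms(2), of "Suc k"] by simp
qed

lemma (in group) commute_nat_pow:
  assumes "a \<in> carrier G" "c \<in> carrier G" "c \<otimes> a = a \<otimes> c"
  shows "c \<otimes> a [^] (k :: nat) = a [^] k \<otimes> c"
proof (induction k)
  case (Suc k)
  have "c \<otimes> a [^] Suc k = (c \<otimes> a [^] k) \<otimes> a" using assms by (simp add: m_assoc)
  also have "\<dots> = a [^] k \<otimes> (c \<otimes> a)" using assms by (simp add: Suc m_assoc)
  finally show ?case using assms by (simp add: m_assoc)
qed (use assms in simp)

text \<open>An element commuting with \<open>a\<close> shifts the bi-infinite periodic word \<open>\<dots>aaa\<dots>\<close>, since it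
  commutes with the large powers of \<open>a\<close>.\<close>

lemma centralizer_primitive:
  assumes a: "a \<in> carrier (free_group X)" "a \<noteq> []" "reduced (a @ a)"
    and primitive: "\<And>d :: int. (\<And>i. a ! nat ((i + d) mod int (length a)) = a ! nat (i mod int (length a))) \<Longrightarrow>
      int (length a) dvd d"
    and c: "c \<in> carrier (free_group X)" "c \<otimes>\<^bsub>free_group X\<^esub> a = a \<otimes>\<^bsub>free_group X\<^esub> c"
  shows "\<exists>m :: int. c = a [^]\<^bsub>free_group X\<^esub> m"
proof -
  interpret F: group "free_group X" by (rule group_free_group)
  define n where "n = length a"
  have n: "n > 0" using a by (simp add: n_def)
  define P where "P i = a ! nat (i mod int n)" for i :: int
  have P_per: "P (i + int n * z) = P i" for i z by (simp add: P_def)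
  \<comment> \<open>At most \<open>length c\<close> letters cancel at either end, so this exponent
    leaves a full period in which the two forms of \<open>L\<close> overlap.\<close>
  define k where "k = 2 * length c + 1"
  define A where "A = concat (replicate k a)"
  have lA: "length A = k * n" by (simp add: A_def n_def length_concat_replicate)
  have A_P: "A ! i = P (int i)" if "i < k * n" for i
    using nth_concat_replicate[of i k a] that by (simp add: A_def n_def P_def nat_mod_distrib)
  have Apow: "A = a [^]\<^bsub>free_group X\<^esub> k"
    using free_group_nat_pow[OF a(1,3)] by (simp add: A_def)
  have redA: "reduced A" using reduced_power[OF a(3)] by (simp add: A_def)
  have redc: "reduced c" using c by (simp add: free_group_def)
  have big: "k * n \<ge> 2 * length c + n" using n by (simp add: k_def)
  define L where "L = c \<otimes>\<^bsub>free_group X\<^esub> A"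
  have "L = A \<otimes>\<^bsub>free_group X\<^esub> c"
    using F.commute_nat_pow[OF a(1) c] by (simp add: L_def Apow)
  then obtain j' where j': "j' \<le> length c" "L = take (length A - j') A @ drop j' c"
    using foldr_red_cons_cancellation[OF redA, of c] by (auto simp: free_group_simps)
  obtain j where j: "j \<le> length c" "L = take (length c - j) c @ drop j A"
    using foldr_red_cons_cancellation[OF redc, of A] by (auto simp: L_def free_group_simps)
  have "length L = length c - j + (k * n - j)" using j lA by simp
  moreover have "length L = k * n - j' + (length c - j')" using j' lA by simp
  ultimately have jj': "j' = j" using j(1) j'(1) big n by simp
  define e where "e = length c - j"
  \<comment> \<open>The displacement: in the form c times A, position i of \<open>L\<close> shows
    position i + \<open>D\<close> of the periodic word; in the form A times c, it shows position
    i.\<close>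
  define D where "D = int j - int e"
  have lL: "length L = e + (k * n - j)" using j lA by (simp add: e_def)
  have L1: "L ! i = P (int i)" if "i < k * n - j" for i
    using that j'(2) lA A_P by (simp add: jj' nth_append)
  have L2: "L ! i = P (int i + D)" if "e \<le> i" "i < length L" for i
  proof -
    have i': "j + (i - e) < k * n" using that lL by simp
    have "L ! i = A ! (j + (i - e))"
      using that i' j lA by (simp add: nth_append e_def)
    also have "\<dots> = P (int (j + (i - e)))" using A_P[OF i'] .
    also have "int (j + (i - e)) = int i + D" using that by (simp add: D_def of_nat_diff)
    finally show ?thesis .
  qed
  have "P (x + D) = P x" for x
  proof -
    define i where "i = int e + (x - int e) mod int n"
    have i: "int e \<le> i" "i < int e + int n" using n by (simp_all add: i_def)
    define q where "q = (x - int e) div int n"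
    have x: "x = i + int n * q"
      using mult_div_mod_eq[of "int n" "x - int e"] by (simp add: i_def q_def)
    have ni: "e \<le> nat i" "nat i < k * n - j" "nat i < length L" "int (nat i) = i"
      using i big j(1) lL by (auto simp: e_def)
    have "P (i + D) = P i" using L1[OF ni(2)] L2[OF ni(1,3)] ni(4) by simp
    moreover have "x + D = (i + D) + int n * q" using x by simp
    ultimately show ?thesis using P_per x by metis
  qed
  then have "int n dvd D"
    using primitive[of D] by (simp add: P_def n_def)
  then obtain q where q: "D = int n * q" by blast
  have lL': "int (length L) = int n * (int k - q)"
  proof -
    have "j \<le> k * n" using j(1) big by linarith
    then have "int (length L) = int (k * n) - D" by (simp add: lL D_def of_nat_diff)
    then show ?thesis by (simp add: q algebra_simps)
  qed
  have "0 \<le> int n * (int k - q)" unfolding lL'[symmetric] by simp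
  then have kq: "int k - q \<ge> 0" using n by (simp add: zero_le_mult_iff)
  define k' where "k' = nat (int k - q)"
  have lk': "length L = k' * n"
    using lL' kq by (metis k'_def int_nat_eq mult.commute of_nat_eq_iff of_nat_mult)
  have "L = concat (replicate k' a)"
  proof (rule nth_equalityI)
    show "length L = length (concat (replicate k' a))" by (simp add: lk' length_concat_replicate n_def)
    fix i assume i: "i < length L"
    have "L ! i = P (int i)"
    proof (cases "i < k * n - j")
      case False
      then have "e \<le> i" using big j(1) by (simp add: e_def)
      then show ?thesis using L2[of i] i P_per[of "int i" q] by (simp add: q)
    qed (rule L1)
    then show "L ! i = concat (replicate k' a) ! i"
      using nth_concat_replicate[of i k' a] i lk' by (simp add: n_def P_def nat_mod_distrib)
  qed
  then have "c \<otimes>\<^bsub>free_group X\<^esub> a [^]\<^bsub>free_group X\<^esub> k = a [^]\<^bsub>free_group X\<^esub> k'"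
    using free_group_nat_pow[OF a(1,3)] by (simp add: L_def Apow)
  then have "c = a [^]\<^bsub>free_group X\<^esub> k' \<otimes>\<^bsub>free_group X\<^esub> inv\<^bsub>free_group X\<^esub> (a [^]\<^bsub>free_group X\<^esub> k)"
    using a(1) c(1) F.inv_solve_right by simp
  also have "\<dots> = a [^]\<^bsub>free_group X\<^esub> (int k' - int k)"
    using F.int_pow_diff[OF a(1), of "int k'" "int k"] by (simp add: int_pow_int)
  finally show ?thesis by blast
qed

text \<open>The run of M letters x cannot be displaced. A shift by at most M would put x on the
  first letter of \<open>v\<close>, a larger one would put it on a letter of the inverse run, and
  one that wraps around would put it on the last letter of \<open>w\<close>. As \<open>v\<close> and
  \<open>w\<close> are shorter than M, the run cannot miss these places.\<close>

lemma periodic_word_primitive: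
  fixes d :: int
  assumes xy: "x \<noteq> y" and w: "w \<noteq> []" "hd w = (y, True)" "last w = (y, False)"
    and v: "v \<noteq> []" "hd v = (y, True)" and M: "length w < M" "length v < M"
  defines "a \<equiv> w @ replicate M (x, True) @ v @ replicate M (x, False)"
  assumes per: "\<And>i. a ! nat ((i + d) mod int (length a)) = a ! nat (i mod int (length a))"
  shows "int (length a) dvd d"
proof (rule ccontr)
  assume nd: "\<not> int (length a) dvd d"
  define n where "n = length a"
  have n: "n = length w + length v + 2 * M" by (simp add: n_def a_def)
  have n0: "n > 0" using w n by simp
  define P where "P i = a ! nat (i mod int n)" for i :: int
  have P: "P (int i) = a ! i" if "i < n" for i using that by (simp add: P_def)
  define d' where "d' = nat (d mod int n)"
  have "0 \<le> d mod int n" "d mod int n < int n" "d mod int n \<noteq> 0"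
    using nd n0 by (auto simp: n_def[symmetric] dvd_eq_mod_eq_0)
  then have d': "0 < d'" "d' < n" "int d' = d mod int n"
    unfolding d'_def by linarith+
  have shift: "P (i + int d') = P i" for i
    using per[of i] by (simp add: P_def n_def[symmetric] d'(3) mod_add_right_eq)
  have run: "P (int (length w + t + d')) = (x, True)" if "t < M" for t
  proof -
    have "P (int (length w + t)) = (x, True)"
      using that P[of "length w + t"] n by (simp add: a_def nth_append)
    then show ?thesis using shift[of "int (length w + t)"] by simp
  qed
  consider "d' \<le> M" | "d' > M" "length w + d' < n" | "length w + d' \<ge> n" by linarith
  then show False
  proof cases
    case 1
    have "P (int (length w + M)) = (y, True)"
      using P[of "length w + M"] n v by (simp add: a_def nth_append hd_conv_nth)
    then show False using run[of "M - d'"] 1 d'(1) xy by simp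
  next
    case 2
    define i where "i = max (length w + d') (n - M)"
    have i: "n - M \<le> i" "i < n" using 2 M n by (auto simp: i_def)
    have "\<not> i < length w" "\<not> i - length w < M" "\<not> i - length w - M < length v" "i - length w - M - length v < M"
      using i n by auto
    then have "P (int i) = (x, False)"
      using P[of i] i(2) by (simp add: a_def nth_append)
    moreover have "P (int i) = (x, True)"
    proof -
      have "i - (length w + d') < M" "length w + (i - (length w + d')) + d' = i"
        using 2 M n by (auto simp: i_def)
      then show ?thesis using run[of "i - (length w + d')"] by simp
    qed
    ultimately show False by simp
  next
    case 3
    have "length w - 1 < n" using n M by simp
    then have "P (int (length w - 1)) = (y, False)"
      using P[of "length w - 1"] n w by (simp add: a_def nth_append last_conv_nth)
    moreover have "length w + (n - 1 - d') + d' = n + (length w - 1)"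
      using d'(2) w by (cases w) auto
    then have "P (int (n + (length w - 1))) = (x, True)"
      using run[of "n - 1 - d'"] 3 M d'(2) by simp
    then have "P (int (length w - 1)) = (x, True)" by (simp add: P_def)
    ultimately show False by simp
  qed
qed

section \<open>Elements with cyclic centralizer in a coset of a normal subgroup\<close>

lemma (in group) conj_int_pow:
  assumes "f \<in> carrier G" "a \<in> carrier G"
  shows "(f \<otimes> a \<otimes> inv f) [^] (m :: int) = f \<otimes> a [^] m \<otimes> inv f"
proof -
  have "(\<lambda>z. f \<otimes> z \<otimes> inv f) \<in> hom G G"
    using assms by (auto simp: hom_def m_assoc)
  then interpret h: group_hom G G "\<lambda>z. f \<otimes> z \<otimes> inv f" by unfold_locales
  show ?thesis using h.hom_int_pow[OF assms(2), of m] by simp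
qed

lemma word_val_gen_replicate:
  assumes "x \<in> X"
  shows "word_val (free_group X) gen (replicate K (x, True)) = gen x [^]\<^bsub>free_group X\<^esub> int K"
    and "word_val (free_group X) gen (replicate K (x, False)) = gen x [^]\<^bsub>free_group X\<^esub> (- int K)"
proof -
  interpret F: group "free_group X" by (rule group_free_group)
  have "word_exp (\<lambda>_. 1) (replicate K (x, True)) = int K" "word_exp (\<lambda>_. 1) (replicate K (x, False)) = - int K"
    by (induction K) auto
  then show "word_val (free_group X) gen (replicate K (x, True)) = gen x [^]\<^bsub>free_group X\<^esub> int K"
    "word_val (free_group X) gen (replicate K (x, False)) = gen x [^]\<^bsub>free_group X\<^esub> (- int K)"
    using F.word_val_single_letter[of gen x] assms by (metis F.word_val_single_letter fst_conv gen_in_carrier in_set_replicate)+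
qed

lemma reduced_replicate: "reduced (replicate K (x, b))"
proof (induction K)
  case (Suc K)
  then show ?case by (cases K) (auto simp: inv_letter_def)
qed simp

text \<open>Up to powers of x at both ends, \<open>u\<close> is a word \<open>u'\<close> that begins
  and ends with other letters. Conjugating by a suitable power of x and then by y puts runs of x
  between \<open>u'\<close> and the outer letters, so that no cancellation can reach these.\<close>

lemma conjugate_to_bracketed_word:
  assumes xy: "x \<in> X" "y \<in> X" "x \<noteq> y" and u: "u \<in> carrier (free_group X)" "l \<in> set u" "fst l \<noteq> x"
  shows "\<exists>f \<in> carrier (free_group X). let w = f \<otimes>\<^bsub>free_group X\<^esub> u \<otimes>\<^bsub>free_group X\<^esub> inv\<^bsub>free_group X\<^esub> f in
    w \<noteq> [] \<and> hd w = (y, True) \<and> last w = (y, False)"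
proof -
  define F where "F = free_group X"
  interpret F: group F unfolding F_def by (rule group_free_group)
  have gF: "gen \<in> X \<rightarrow> carrier F" by (simp add: F_def)
  have gx: "gen x \<in> carrier F" "gen y \<in> carrier F" using xy by (simp_all add: F_def)
  have "\<exists>l\<in>set u. fst l \<noteq> x" using u by blast
  from split_list_first_prop[OF this] obtain p a r where
    par: "u = p @ a # r" "fst a \<noteq> x" "\<forall>l\<in>set p. fst l = x" by blast
  then have "\<exists>l\<in>set (a # r). fst l \<noteq> x" by simp
  from split_list_last_prop[OF this] obtain q b s where
    qbs: "a # r = q @ b # s" "fst b \<noteq> x" "\<forall>l\<in>set s. fst l = x" by blast
  define u' where "u' = q @ [b]"
  have u': "u = p @ u' @ s" "u' \<noteq> []" "last u' = b" "hd u' = a"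
    using par(1) qbs(1) by (auto simp: u'_def hd_append) (metis hd_append list.sel(1))
  have lu: "u \<in> lists (X \<times> UNIV)" "reduced u" using u by (auto simp: free_group_def)
  then have lists: "p \<in> lists (X \<times> UNIV)" "u' \<in> lists (X \<times> UNIV)" "s \<in> lists (X \<times> UNIV)" and redu': "reduced u'"
    using reduced_append1 reduced_append2 by (auto simp: u'(1))
  define m1 m2 where "m1 = word_exp (\<lambda>_. 1) p" and "m2 = word_exp (\<lambda>_. 1) s"
  have vp: "word_val F gen p = gen x [^]\<^bsub>F\<^esub> m1" and vs: "word_val F gen s = gen x [^]\<^bsub>F\<^esub> m2"
    using F.word_val_single_letter[of gen x] gx par(3) qbs(3) by (auto simp: m1_def m2_def)
  define z where "z = word_val F gen u'"
  have z: "z \<in> carrier F" unfolding z_def by (rule F.word_val_closed[OF gF lists(2)])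
  have "u = word_val F gen u" using word_val_gen[OF u(1)] by (simp add: F_def)
  also have "\<dots> = gen x [^]\<^bsub>F\<^esub> m1 \<otimes>\<^bsub>F\<^esub> (z \<otimes>\<^bsub>F\<^esub> gen x [^]\<^bsub>F\<^esub> m2)"
    using lists F.word_val_append[OF gF] by (simp add: u'(1) vp vs z_def del: in_lists_conv_set)
  finally have u_eq: "u = gen x [^]\<^bsub>F\<^esub> m1 \<otimes>\<^bsub>F\<^esub> (z \<otimes>\<^bsub>F\<^esub> gen x [^]\<^bsub>F\<^esub> m2)" .
  \<comment> \<open>\<open>K\<close> and \<open>K'\<close> are the lengths of the two runs after
    conjugation. Their difference is forced to be m1 + m2, and both have to be positive.\<close>
  define K where "K = nat \<bar>m1 + m2\<bar> + 1"
  define K' where "K' = nat (int K - (m1 + m2))"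
  have K: "K > 0" "K' > 0" "int K' = int K - (m1 + m2)" by (auto simp: K_def K'_def)
  define f where "f = gen y \<otimes>\<^bsub>F\<^esub> gen x [^]\<^bsub>F\<^esub> (int K - m1)"
  have f: "f \<in> carrier F" using gx by (simp add: f_def)
  define w where "w = [(y, True)] @ replicate K (x, True) @ u' @ replicate K' (x, False) @ [(y, False)]"
  have "reduced w"
    using redu' u' K xy(3) par(2) qbs(2)
    by (auto simp: w_def reduced_append_iff reduced_Cons_iff reduced_replicate inv_letter_def hd_append prod_eq_iff)
  moreover have lw: "w \<in> lists (X \<times> UNIV)"
    using lists xy by (auto simp: w_def)
  ultimately have "w \<in> carrier (free_group X)" by (simp add: free_group_def)
  then have "w = word_val F gen w" by (simp add: F_def word_val_gen)
  also have "\<dots> = gen y \<otimes>\<^bsub>F\<^esub> (gen x [^]\<^bsub>F\<^esub> int K \<otimes>\<^bsub>F\<^esub> (z \<otimes>\<^bsub>F\<^esub> (gen x [^]\<^bsub>F\<^esub> (- int K') \<otimes>\<^bsub>F\<^esub> inv\<^bsub>F\<^esub> gen y)))"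
  proof -
    have app: "word_val F gen (v @ v') = word_val F gen v \<otimes>\<^bsub>F\<^esub> word_val F gen v'"
      if "set v \<subseteq> X \<times> UNIV" "set v' \<subseteq> X \<times> UNIV" for v v'
      using F.word_val_append[OF gF, of v v'] that by (simp add: lists_eq_set)
    have sets: "set (replicate K (x, b)) \<subseteq> X \<times> UNIV" "set [(y, b)] \<subseteq> X \<times> UNIV" "set u' \<subseteq> X \<times> UNIV" for K b
      using xy lists(2) by auto
    note rep = word_val_gen_replicate[OF xy(1), folded F_def]
    have "word_val F gen [(y, True)] = gen y" "word_val F gen [(y, False)] = inv\<^bsub>F\<^esub> gen y"
      using gx by (simp_all add: letter_val_def)
    then show ?thesis
      unfolding w_def by (simp only: app sets rep z_def set_append Un_subset_iff simp_thms)
  qed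
  also have "\<dots> = f \<otimes>\<^bsub>F\<^esub> u \<otimes>\<^bsub>F\<^esub> inv\<^bsub>F\<^esub> f"
  proof -
    have "gen x [^]\<^bsub>F\<^esub> (int K - m1) \<otimes>\<^bsub>F\<^esub> gen x [^]\<^bsub>F\<^esub> m1 = gen x [^]\<^bsub>F\<^esub> int K"
      using F.int_pow_mult[OF gx(1), of "int K - m1" m1] by simp
    moreover have "gen x [^]\<^bsub>F\<^esub> m2 \<otimes>\<^bsub>F\<^esub> inv\<^bsub>F\<^esub> (gen x [^]\<^bsub>F\<^esub> (int K - m1)) = gen x [^]\<^bsub>F\<^esub> (- int K')"
    proof -
      have "- int K' = m2 - (int K - m1)" using K(3) by simp
      then show ?thesis using F.int_pow_diff[OF gx(1), of m2 "int K - m1"] by metis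
    qed
    moreover have "g \<otimes>\<^bsub>F\<^esub> (h \<otimes>\<^bsub>F\<^esub> (z \<otimes>\<^bsub>F\<^esub> k)) \<otimes>\<^bsub>F\<^esub> inv\<^bsub>F\<^esub> g = (g \<otimes>\<^bsub>F\<^esub> h) \<otimes>\<^bsub>F\<^esub> (z \<otimes>\<^bsub>F\<^esub> (k \<otimes>\<^bsub>F\<^esub> inv\<^bsub>F\<^esub> g))"
      if "g \<in> carrier F" "h \<in> carrier F" "k \<in> carrier F" for g h k
      using that z by (simp add: F.m_assoc)
    ultimately have "gen x [^]\<^bsub>F\<^esub> (int K - m1) \<otimes>\<^bsub>F\<^esub> u \<otimes>\<^bsub>F\<^esub> inv\<^bsub>F\<^esub> (gen x [^]\<^bsub>F\<^esub> (int K - m1)) =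
        gen x [^]\<^bsub>F\<^esub> int K \<otimes>\<^bsub>F\<^esub> (z \<otimes>\<^bsub>F\<^esub> gen x [^]\<^bsub>F\<^esub> (- int K'))"
      unfolding u_eq using gx by simp
    moreover have "f \<otimes>\<^bsub>F\<^esub> u \<otimes>\<^bsub>F\<^esub> inv\<^bsub>F\<^esub> f = gen y \<otimes>\<^bsub>F\<^esub>
        (gen x [^]\<^bsub>F\<^esub> (int K - m1) \<otimes>\<^bsub>F\<^esub> u \<otimes>\<^bsub>F\<^esub> inv\<^bsub>F\<^esub> (gen x [^]\<^bsub>F\<^esub> (int K - m1))) \<otimes>\<^bsub>F\<^esub> inv\<^bsub>F\<^esub> gen y"
      using gx u(1) by (simp add: f_def F.inv_mult_group F.m_assoc F_def[symmetric])
    ultimately show ?thesis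
      using gx z by (simp add: F.m_assoc)
  qed
  finally have "w = f \<otimes>\<^bsub>F\<^esub> u \<otimes>\<^bsub>F\<^esub> inv\<^bsub>F\<^esub> f" .
  moreover have "w \<noteq> []" "hd w = (y, True)" "last w = (y, False)" by (simp_all add: w_def)
  ultimately show ?thesis using f unfolding F_def Let_def by metis
qed

text \<open>After correction by N and conjugation, \<open>w\<close> becomes a word \<open>w1\<close>
  that begins with y and ends with its inverse. Multiplying by x^M v x^-M, a conjugate of an element
  \<open>v\<close> of N of the same shape, changes nothing modulo N and gives a cyclically reduced
  word without proper period, which generates its own centralizer.\<close>

theorem normal_coset_cyclic_centralizer:
  assumes xy: "x \<in> X" "y \<in> X" "x \<noteq> y" and N: "N \<lhd> free_group X" "N \<noteq> {\<one>\<^bsub>free_group X\<^esub>}"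
    and w: "w \<in> carrier (free_group X)"
  shows "\<exists>n \<in> N. \<forall>c \<in> carrier (free_group X).
    c \<otimes>\<^bsub>free_group X\<^esub> (w \<otimes>\<^bsub>free_group X\<^esub> n) = (w \<otimes>\<^bsub>free_group X\<^esub> n) \<otimes>\<^bsub>free_group X\<^esub> c \<longrightarrow>
    (\<exists>m :: int. c = (w \<otimes>\<^bsub>free_group X\<^esub> n) [^]\<^bsub>free_group X\<^esub> m)"
proof -
  define F where "F = free_group X"
  interpret F: group F unfolding F_def by (rule group_free_group)
  interpret N: normal N F using N by (simp add: F_def)
  have NF: "n \<in> carrier F" if "n \<in> N" for n using that N.subset by blast
  have gx: "gen x \<in> carrier F" using xy by (simp add: F_def)
  define bracketed where "bracketed u \<longleftrightarrow> u \<noteq> [] \<and> hd u = (y, True) \<and> last u = (y, False)" for u :: "'a letter list"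
  have bracket: "\<exists>f \<in> carrier F. bracketed (f \<otimes>\<^bsub>F\<^esub> u \<otimes>\<^bsub>F\<^esub> inv\<^bsub>F\<^esub> f)"
    if "u \<in> carrier F" "l \<in> set u" "fst l \<noteq> x" for u l
    using conjugate_to_bracketed_word[OF xy, of u l] that by (simp add: F_def bracketed_def Let_def)
  have red: "reduced u" if "u \<in> carrier F" for u using that by (simp add: F_def free_group_def)
  have "\<exists>v \<in> N. bracketed v"
  proof -
    obtain v where v: "v \<in> N" "v \<noteq> []"
      using N(2) N.one_closed by (auto simp: F_def free_group_simps)
    show ?thesis
    proof (cases "\<exists>l\<in>set v. fst l \<noteq> x")
      case True
      then obtain f where f: "f \<in> carrier F" "bracketed (f \<otimes>\<^bsub>F\<^esub> v \<otimes>\<^bsub>F\<^esub> inv\<^bsub>F\<^esub> f)"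
        using bracket NF[OF v(1)] by blast
      then show ?thesis using N.inv_op_closed2 v(1) by blast
    next
      case False
      \<comment> \<open>A power of x has no letter other than x to work with; conjugating it by y
        gives the required shape directly.\<close>
      define u where "u = [(y, True)] @ v @ [(y, False)]"
      have "fst (hd v) = x" "fst (last v) = x"
        using False v(2) by auto
      then have ru: "reduced u"
        using red[OF NF[OF v(1)]] v(2) xy(3)
        by (auto simp: u_def reduced_append_iff reduced_Cons_iff inv_letter_def prod_eq_iff)
      have gy: "gen y \<in> carrier F" "[(y, False)] \<in> carrier F" using xy by (auto simp: F_def letter_in_free_group)
      have rv: "reduced (v @ [(y, False)])" using reduced_append2 ru unfolding u_def by blast
      have "gen y \<otimes>\<^bsub>F\<^esub> (v \<otimes>\<^bsub>F\<^esub> [(y, False)]) = u"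
        using mult_free_group_reduced[OF rv, of X] mult_free_group_reduced[OF ru[unfolded u_def], of X]
        by (simp add: u_def F_def gen_def)
      moreover have "inv\<^bsub>F\<^esub> gen y = [(y, False)]"
      proof (rule F.inv_equality)
        show "[(y, False)] \<otimes>\<^bsub>F\<^esub> gen y = \<one>\<^bsub>F\<^esub>"
          by (simp add: F_def free_group_simps gen_def inv_letter_def)
      qed (use gy in auto)
      ultimately have "u = gen y \<otimes>\<^bsub>F\<^esub> v \<otimes>\<^bsub>F\<^esub> inv\<^bsub>F\<^esub> gen y"
        using gy NF[OF v(1)] by (simp add: F.m_assoc)
      then have "u \<in> N" using N.inv_op_closed2[OF gy(1) v(1)] by simp
      moreover have "bracketed u" by (simp add: bracketed_def u_def)
      ultimately show ?thesis by blast
    qed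
  qed
  then obtain v where v: "v \<in> N" "bracketed v" by blast
  have wF: "w \<in> carrier F" using w by (simp add: F_def)
  \<comment> \<open>If \<open>w\<close> is a power of x, the factor \<open>v\<close> brings in
    another letter without cancellation.\<close>
  have "\<exists>n0 \<in> N. \<exists>l \<in> set (w \<otimes>\<^bsub>F\<^esub> n0). fst l \<noteq> x"
  proof (cases "\<exists>l\<in>set w. fst l \<noteq> x")
    case True
    then show ?thesis using N.one_closed wF by (intro bexI[of _ "\<one>\<^bsub>F\<^esub>"]) auto
  next
    case False
    have "w = [] \<or> fst (last w) = x" using False last_in_set by blast
    then have "reduced (w @ v)"
      using red[OF wF] red[OF NF[OF v(1)]] v(2) xy(3)
      by (auto simp: reduced_append_iff bracketed_def inv_letter_def prod_eq_iff)
    then have "w \<otimes>\<^bsub>F\<^esub> v = w @ v"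
      unfolding F_def by (rule mult_free_group_reduced)
    moreover have "hd v \<in> set v" "fst (hd v) \<noteq> x"
      using v(2) xy(3) hd_in_set[of v] by (auto simp: bracketed_def simp del: hd_in_set)
    ultimately show ?thesis using v(1) by (intro bexI[of _ v]) auto
  qed
  then obtain n0 l where n0: "n0 \<in> N" "l \<in> set (w \<otimes>\<^bsub>F\<^esub> n0)" "fst l \<noteq> x" by blast
  have wn0: "w \<otimes>\<^bsub>F\<^esub> n0 \<in> carrier F" using wF NF[OF n0(1)] by simp
  obtain f where f: "f \<in> carrier F" "bracketed (f \<otimes>\<^bsub>F\<^esub> (w \<otimes>\<^bsub>F\<^esub> n0) \<otimes>\<^bsub>F\<^esub> inv\<^bsub>F\<^esub> f)"
    using bracket[OF wn0 n0(2,3)] by blast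
  define w1 where "w1 = f \<otimes>\<^bsub>F\<^esub> (w \<otimes>\<^bsub>F\<^esub> n0) \<otimes>\<^bsub>F\<^esub> inv\<^bsub>F\<^esub> f"
  have w1: "w1 \<in> carrier F" "bracketed w1" using f wn0 by (simp_all add: w1_def)
  define M where "M = Suc (length w1 + length v)"
  then have "M > 0" by simp
  define a where "a = w1 @ replicate M (x, True) @ v @ replicate M (x, False)"
  have redaa: "reduced (a @ a)"
    using w1(2) v(2) red[OF w1(1)] red[OF NF[OF v(1)]] xy(3) \<open>M > 0\<close>
    by (auto simp: a_def reduced_append_iff reduced_replicate bracketed_def inv_letter_def hd_append)
  have "a \<in> lists (X \<times> UNIV)"
    using w1(1) NF[OF v(1)] xy by (auto simp: a_def F_def free_group_def)
  then have aF: "a \<in> carrier F" using reduced_append1[OF redaa] by (simp add: F_def free_group_def)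
  have prim: "int (length a) dvd d"
    if "\<And>i. a ! nat ((i + d) mod int (length a)) = a ! nat (i mod int (length a))" for d
    unfolding a_def
  proof (rule periodic_word_primitive)
    show "length w1 < M" "length v < M" by (simp_all add: M_def)
  qed (use that w1(2) v(2) xy(3) in \<open>auto simp: a_def bracketed_def\<close>)
  define n' where "n' = gen x [^]\<^bsub>F\<^esub> int M \<otimes>\<^bsub>F\<^esub> v \<otimes>\<^bsub>F\<^esub> inv\<^bsub>F\<^esub> (gen x [^]\<^bsub>F\<^esub> int M)"
  have n': "n' \<in> N" unfolding n'_def using v(1) gx by (intro N.inv_op_closed2) auto
  have "a = word_val F gen a" using aF by (simp add: F_def word_val_gen)
  also have "\<dots> = w1 \<otimes>\<^bsub>F\<^esub> n'"
  proof -
    have gF: "gen \<in> X \<rightarrow> carrier F" by (simp add: F_def)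
    have app: "word_val F gen (u @ u') = word_val F gen u \<otimes>\<^bsub>F\<^esub> word_val F gen u'"
      if "set u \<subseteq> X \<times> UNIV" "set u' \<subseteq> X \<times> UNIV" for u u'
      using F.word_val_append[OF gF, of u u'] that by (simp add: lists_eq_set)
    have sets: "set (replicate K (x, b)) \<subseteq> X \<times> UNIV" "set v \<subseteq> X \<times> UNIV" "set w1 \<subseteq> X \<times> UNIV" for K b
      using xy w1(1) NF[OF v(1)] by (auto simp: F_def free_group_def)
    have vals: "word_val F gen w1 = w1" "word_val F gen v = v"
      using w1(1) NF[OF v(1)] by (simp_all add: F_def word_val_gen)
    have "word_val F gen a = w1 \<otimes>\<^bsub>F\<^esub> (gen x [^]\<^bsub>F\<^esub> int M \<otimes>\<^bsub>F\<^esub> (v \<otimes>\<^bsub>F\<^esub> gen x [^]\<^bsub>F\<^esub> (- int M)))"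
      unfolding a_def
      by (simp only: app sets vals word_val_gen_replicate[OF xy(1), folded F_def] set_append Un_subset_iff simp_thms)
    then show ?thesis
      using gx NF[OF v(1)] F.int_pow_neg[OF gx, of "int M"] by (simp add: n'_def F.m_assoc)
  qed
  finally have a_eq: "a = w1 \<otimes>\<^bsub>F\<^esub> n'" .
  define n where "n = n0 \<otimes>\<^bsub>F\<^esub> (inv\<^bsub>F\<^esub> f \<otimes>\<^bsub>F\<^esub> n' \<otimes>\<^bsub>F\<^esub> f)"
  have n: "n \<in> N" unfolding n_def using n0(1) N.inv_op_closed1[OF f(1) n'] by (rule N.m_closed)
  have a_conj: "a = f \<otimes>\<^bsub>F\<^esub> (w \<otimes>\<^bsub>F\<^esub> n) \<otimes>\<^bsub>F\<^esub> inv\<^bsub>F\<^esub> f"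
    using f(1) wF NF[OF n0(1)] NF[OF n'] by (simp add: a_eq w1_def n_def F.m_assoc)
  have wn: "w \<otimes>\<^bsub>F\<^esub> n \<in> carrier F" using wF NF[OF n] by simp
  have "\<exists>m :: int. c = (w \<otimes>\<^bsub>F\<^esub> n) [^]\<^bsub>F\<^esub> m"
    if c: "c \<in> carrier F" "c \<otimes>\<^bsub>F\<^esub> (w \<otimes>\<^bsub>F\<^esub> n) = (w \<otimes>\<^bsub>F\<^esub> n) \<otimes>\<^bsub>F\<^esub> c" for c
  proof -
    define b where "b = w \<otimes>\<^bsub>F\<^esub> n"
    note b = wn[folded b_def] and cb = c(2)[folded b_def] and ab = a_conj[folded b_def]
    define e where "e = f \<otimes>\<^bsub>F\<^esub> c \<otimes>\<^bsub>F\<^esub> inv\<^bsub>F\<^esub> f"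
    have e: "e \<in> carrier F" using f c by (simp add: e_def)
    have "e \<otimes>\<^bsub>F\<^esub> a = f \<otimes>\<^bsub>F\<^esub> (c \<otimes>\<^bsub>F\<^esub> b) \<otimes>\<^bsub>F\<^esub> inv\<^bsub>F\<^esub> f" "a \<otimes>\<^bsub>F\<^esub> e = f \<otimes>\<^bsub>F\<^esub> (b \<otimes>\<^bsub>F\<^esub> c) \<otimes>\<^bsub>F\<^esub> inv\<^bsub>F\<^esub> f"
      using f(1) c(1) b by (simp_all add: e_def ab F.m_assoc)
    then have ea: "e \<otimes>\<^bsub>F\<^esub> a = a \<otimes>\<^bsub>F\<^esub> e" using cb by simp
    have "a \<noteq> []" by (simp add: a_def M_def)
    from centralizer_primitive[of a X e, folded F_def, OF aF this redaa prim e ea]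
    obtain m :: int where "e = a [^]\<^bsub>F\<^esub> m" by blast
    then have "f \<otimes>\<^bsub>F\<^esub> c \<otimes>\<^bsub>F\<^esub> inv\<^bsub>F\<^esub> f = f \<otimes>\<^bsub>F\<^esub> b [^]\<^bsub>F\<^esub> m \<otimes>\<^bsub>F\<^esub> inv\<^bsub>F\<^esub> f"
      using F.conj_int_pow[OF f(1) b] by (simp add: e_def ab)
    then have "c = b [^]\<^bsub>F\<^esub> m"
      using f(1) c(1) b by (simp add: F.m_assoc)
    then show ?thesis unfolding b_def by blast
  qed
  then show ?thesis using n unfolding F_def by blast
qed

section \<open>Direct products of \<open>p\<close>-conjugacy separable groups\<close>

lemma p_conjugacy_separable_DirProd:
  assumes "p_conjugacy_separable p K" "p_conjugacy_separable p L" "group K" "group L"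
  shows "p_conjugacy_separable p (K \<times>\<times> L)"
  unfolding p_conjugacy_separable_def
proof (intro ballI impI)
  fix x y assume "x \<in> carrier (K \<times>\<times> L)" "y \<in> carrier (K \<times>\<times> L)" and nc: "\<not> conjugate_in (K \<times>\<times> L) x y"
  moreover obtain a b a' b' where xy: "x = (a, b)" "y = (a', b')" by fastforce
  ultimately have mem: "a \<in> carrier K" "a' \<in> carrier K" "b \<in> carrier L" "b' \<in> carrier L" by auto
  interpret K: group K by fact
  interpret L: group L by fact
  have "\<not> conjugate_in K a a' \<or> \<not> conjugate_in L b b'"
  proof (rule ccontr)
    assume "\<not> ?thesis"
    then obtain g h where "g \<in> carrier K" "a' = g \<otimes>\<^bsub>K\<^esub> a \<otimes>\<^bsub>K\<^esub> inv\<^bsub>K\<^esub> g"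
      "h \<in> carrier L" "b' = h \<otimes>\<^bsub>L\<^esub> b \<otimes>\<^bsub>L\<^esub> inv\<^bsub>L\<^esub> h" by (auto simp: conjugate_in_def)
    then have "conjugate_in (K \<times>\<times> L) x y"
      unfolding conjugate_in_def xy using assms(3,4) by (intro bexI[of _ "(g, h)"]) auto
    then show False using nc by blast
  qed
  then show "\<exists>(M :: nat monoid) \<phi>. finite_p_group p M \<and> \<phi> \<in> hom (K \<times>\<times> L) M \<and> \<not> conjugate_in M (\<phi> x) (\<phi> y)"
  proof
    assume "\<not> conjugate_in K a a'"
    then obtain M :: "nat monoid" and \<phi> where "finite_p_group p M" "\<phi> \<in> hom K M" "\<not> conjugate_in M (\<phi> a) (\<phi> a')"
      using assms(1) mem unfolding p_conjugacy_separable_def by blast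
    then show ?thesis
      by (intro exI[of _ M] exI[of _ "\<lambda>z. \<phi> (fst z)"]) (auto simp: hom_def xy)
  next
    assume "\<not> conjugate_in L b b'"
    then obtain M :: "nat monoid" and \<phi> where "finite_p_group p M" "\<phi> \<in> hom L M" "\<not> conjugate_in M (\<phi> b) (\<phi> b')"
      using assms(2) mem unfolding p_conjugacy_separable_def by blast
    then show ?thesis
      by (intro exI[of _ M] exI[of _ "\<lambda>z. \<phi> (snd z)"]) (auto simp: hom_def xy)
  qed
qed

lemma p_conjugacy_separable_iso:
  assumes "G \<cong> K" "group G" "group K" "p_conjugacy_separable p K"
  shows "p_conjugacy_separable p G"
  unfolding p_conjugacy_separable_def
proof (intro ballI impI)
  fix x y assume x: "x \<in> carrier G" and y: "y \<in> carrier G" and nc: "\<not> conjugate_in G x y"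
  interpret G: group G by fact
  interpret K: group K by fact
  obtain \<phi> where \<phi>: "\<phi> \<in> iso G K" using assms(1) by (auto simp: is_iso_def)
  then have \<psi>: "inv_into (carrier G) \<phi> \<in> iso K G" by (rule G.iso_set_sym)
  interpret \<psi>: group_hom K G "inv_into (carrier G) \<phi>"
    using \<psi> by unfold_locales (simp add: iso_def)
  have inv: "inv_into (carrier G) \<phi> (\<phi> z) = z" if "z \<in> carrier G" for z
    using \<phi> that by (auto simp: iso_iff)
  have \<phi>_closed: "\<phi> z \<in> carrier K" if "z \<in> carrier G" for z
    using \<phi> that by (auto simp: iso_iff)
  have "\<not> conjugate_in K (\<phi> x) (\<phi> y)"
    using \<psi>.hom_conjugate_in[OF _ \<phi>_closed[OF x], of "\<phi> y"] inv x y nc by auto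
  then obtain M :: "nat monoid" and \<theta> where "finite_p_group p M" "\<theta> \<in> hom K M" "\<not> conjugate_in M (\<theta> (\<phi> x)) (\<theta> (\<phi> y))"
    using assms(4) \<phi>_closed x y unfolding p_conjugacy_separable_def by blast
  moreover from this have "\<theta> \<circ> \<phi> \<in> hom G M"
    using \<phi> hom_compose by (auto simp: iso_def)
  ultimately show "\<exists>(M :: nat monoid) \<phi>. finite_p_group p M \<and> \<phi> \<in> hom G M \<and> \<not> conjugate_in M (\<phi> x) (\<phi> y)"
    by (intro exI[of _ M] exI[of _ "\<theta> \<circ> \<phi>"]) simp
qed

section \<open>Subdirect products\<close>

text \<open>Corestricting to the image, which is free by Nielsen-Schreier, makes the map surjective
  without changing its kernel. This turns a subgroup of a product into a subdirect product.\<close>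

lemma hom_onto_free_group:
  fixes A :: "'a monoid"
  assumes "group G" "\<pi> \<in> hom G A" "is_free_group A"
  shows "\<exists>(Y :: ('a letter list set \<times> 'a) set) \<rho>. \<rho> \<in> hom G (free_group Y) \<and>
    \<rho> ` carrier G = carrier (free_group Y) \<and> (\<forall>g\<in>carrier G. \<rho> g = \<one>\<^bsub>free_group Y\<^esub> \<longleftrightarrow> \<pi> g = \<one>\<^bsub>A\<^esub>)"
proof -
  obtain X :: "'a set" and \<psi> where "group A" and \<psi>: "\<psi> \<in> iso A (free_group X)"
    using assms(3) by (auto simp: is_free_group_def is_iso_def)
  interpret G: group G by fact
  interpret A: group A by fact
  interpret FX: group "free_group X" by (rule group_free_group)
  interpret h: group_hom G "free_group X" "\<psi> \<circ> \<pi>"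
    using assms(2) \<psi> by unfold_locales (auto simp: iso_def intro: hom_compose)
  define H where "H = (\<psi> \<circ> \<pi>) ` carrier G"
  have H: "subgroup H (free_group X)" unfolding H_def by (rule h.img_is_subgroup)
  obtain Y :: "('a letter list set \<times> 'a) set" and \<chi> where \<chi>: "\<chi> \<in> iso ((free_group X)\<lparr>carrier := H\<rparr>) (free_group Y)"
    using nielsen_schreier[OF H] by (auto simp: is_iso_def)
  interpret FY: group "free_group Y" by (rule group_free_group)
  have "\<psi> \<circ> \<pi> \<in> hom G ((free_group X)\<lparr>carrier := H\<rparr>)"
    using h.homh by (auto simp: hom_def H_def)
  then have hom: "\<chi> \<circ> (\<psi> \<circ> \<pi>) \<in> hom G (free_group Y)"
    by (rule hom_compose) (use \<chi> in \<open>simp add: iso_def\<close>)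
  moreover have "(\<chi> \<circ> (\<psi> \<circ> \<pi>)) ` carrier G = carrier (free_group Y)"
  proof -
    have "(\<chi> \<circ> (\<psi> \<circ> \<pi>)) ` carrier G = \<chi> ` H" unfolding H_def by (rule image_comp[symmetric])
    then show ?thesis using \<chi> by (simp add: iso_iff)
  qed
  moreover have "(\<chi> \<circ> (\<psi> \<circ> \<pi>)) g = \<one>\<^bsub>free_group Y\<^esub> \<longleftrightarrow> \<pi> g = \<one>\<^bsub>A\<^esub>" if g: "g \<in> carrier G" for g
  proof -
    interpret \<chi>': group_hom G "free_group Y" "\<chi> \<circ> (\<psi> \<circ> \<pi>)" using hom by unfold_locales
    interpret \<pi>: group_hom G A \<pi> using assms(2) by unfold_locales
    have "inj_on (\<chi> \<circ> \<psi>) (\<pi> ` carrier G)"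
    proof (rule comp_inj_on)
      show "inj_on \<psi> (\<pi> ` carrier G)"
        using \<psi> \<pi>.hom_closed by (auto simp: iso_iff intro: inj_on_subset)
      show "inj_on \<chi> (\<psi> ` \<pi> ` carrier G)"
      proof -
        have "\<psi> ` \<pi> ` carrier G = H" by (simp add: H_def image_image)
        then show ?thesis using \<chi> by (simp add: iso_iff)
      qed
    qed
    then have "\<chi> (\<psi> (\<pi> g)) = \<chi> (\<psi> (\<pi> \<one>\<^bsub>G\<^esub>)) \<longleftrightarrow> \<pi> g = \<pi> \<one>\<^bsub>G\<^esub>"
      using inj_on_eq_iff[of "\<chi> \<circ> \<psi>" "\<pi> ` carrier G" "\<pi> g" "\<pi> \<one>\<^bsub>G\<^esub>"] g
        imageI[OF G.one_closed, of \<pi>] by simp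
    then show ?thesis using \<chi>'.hom_one \<pi>.hom_one by simp
  qed
  ultimately show ?thesis by blast
qed

lemma is_free_group_free_group: "is_free_group (free_group X)"
  by (rule is_free_groupI[OF group_free_group iso_refl])

lemma is_free_group_of_inj_hom:
  fixes A :: "'a monoid" and G :: "'g monoid"
  assumes "group G" "\<pi> \<in> hom G A" "is_free_group A" "\<And>g. g \<in> carrier G \<Longrightarrow> \<pi> g = \<one>\<^bsub>A\<^esub> \<Longrightarrow> g = \<one>\<^bsub>G\<^esub>"
  shows "is_free_group G"
proof -
  obtain Y :: "('a letter list set \<times> 'a) set" and \<rho> where \<rho>: "\<rho> \<in> hom G (free_group Y)"
    "\<rho> ` carrier G = carrier (free_group Y)" "\<And>g. g \<in> carrier G \<Longrightarrow> \<rho> g = \<one>\<^bsub>free_group Y\<^esub> \<longleftrightarrow> \<pi> g = \<one>\<^bsub>A\<^esub>"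
    using hom_onto_free_group[OF assms(1-3)] by blast
  interpret \<rho>: group_hom G "free_group Y" \<rho>
    using assms(1) \<rho>(1) group_free_group by (intro group_hom.intro group_hom_axioms.intro)
  have "inj_on \<rho> (carrier G)"
    using \<rho>(3) assms(4) by (subst \<rho>.inj_on_one_iff) blast
  then have "\<rho> \<in> iso G (free_group Y)" using \<rho> by (simp add: iso_iff)
  then show ?thesis by (intro is_free_groupI[OF assms(1)] is_isoI)
qed

lemma free_group_commute:
  assumes "\<And>x y. x \<in> X \<Longrightarrow> y \<in> X \<Longrightarrow> x = y" "u \<in> carrier (free_group X)" "v \<in> carrier (free_group X)"
  shows "u \<otimes>\<^bsub>free_group X\<^esub> v = v \<otimes>\<^bsub>free_group X\<^esub> u"
proof (cases "X = {}")
  case True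
  then have "u = []" "v = []" using assms(2,3) by (auto simp: free_group_def)
  then show ?thesis by simp
next
  case False
  then obtain x where x: "x \<in> X" by blast
  interpret F: group "free_group X" by (rule group_free_group)
  have "w = gen x [^]\<^bsub>free_group X\<^esub> word_exp (\<lambda>_. 1) w" if w: "w \<in> carrier (free_group X)" for w
  proof -
    have "fst l = x" if "l \<in> set w" for l
      using w that assms(1)[OF _ x] by (auto simp: free_group_def)
    then show ?thesis
      using F.word_val_single_letter[of gen x w] x word_val_gen[OF w] by simp
  qed
  then obtain m n :: int where mn: "u = gen x [^]\<^bsub>free_group X\<^esub> m" "v = gen x [^]\<^bsub>free_group X\<^esub> n"
    using assms(2,3) by blast
  show ?thesis
    using x by (simp add: mn F.int_pow_mult[symmetric] add.commute)
qed

text \<open>\<open>G\<close> comes with two projections instead of being a set of pairs, so that the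
  factors can be exchanged. \<open>A\<close> and \<open>B\<close> are arbitrary groups: inside this
  context freeness enters only through hypotheses on centralizers.\<close>

locale subdirect = h1: group_hom G A \<rho>\<^sub>1 + h2: group_hom G B \<rho>\<^sub>2
  for G :: "('g, 'x) monoid_scheme" (structure) and A :: "('a, 'y) monoid_scheme" and B :: "('b, 'z) monoid_scheme"
    and \<rho>\<^sub>1 \<rho>\<^sub>2 +
  assumes jointly_trivial: "g \<in> carrier G \<Longrightarrow> \<rho>\<^sub>1 g = \<one>\<^bsub>A\<^esub> \<Longrightarrow> \<rho>\<^sub>2 g = \<one>\<^bsub>B\<^esub> \<Longrightarrow> g = \<one>"
    and onto\<^sub>1: "\<rho>\<^sub>1 ` carrier G = carrier A" and onto\<^sub>2: "\<rho>\<^sub>2 ` carrier G = carrier B"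
begin

definition "K\<^sub>1 = kernel G A \<rho>\<^sub>1"
definition "K\<^sub>2 = kernel G B \<rho>\<^sub>2"

lemma K\<^sub>2I: "g \<in> carrier G \<Longrightarrow> \<rho>\<^sub>2 g = \<one>\<^bsub>B\<^esub> \<Longrightarrow> g \<in> K\<^sub>2"
  by (simp_all add: K\<^sub>1_def K\<^sub>2_def kernel_def)

lemma K\<^sub>1D: "g \<in> K\<^sub>1 \<Longrightarrow> g \<in> carrier G" "g \<in> K\<^sub>1 \<Longrightarrow> \<rho>\<^sub>1 g = \<one>\<^bsub>A\<^esub>"
  and K\<^sub>2D: "g \<in> K\<^sub>2 \<Longrightarrow> g \<in> carrier G" "g \<in> K\<^sub>2 \<Longrightarrow> \<rho>\<^sub>2 g = \<one>\<^bsub>B\<^esub>"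
  by (simp_all add: K\<^sub>1_def K\<^sub>2_def kernel_def)

lemma subdirect_swap: "subdirect G B A \<rho>\<^sub>2 \<rho>\<^sub>1"
  by unfold_locales (use jointly_trivial onto\<^sub>1 onto\<^sub>2 in auto)

lemma eqI:
  assumes "u \<in> carrier G" "v \<in> carrier G" "\<rho>\<^sub>1 u = \<rho>\<^sub>1 v" "\<rho>\<^sub>2 u = \<rho>\<^sub>2 v"
  shows "u = v"
proof -
  have "u \<otimes> inv v = \<one>" using assms by (intro jointly_trivial) simp_all
  then show ?thesis using assms by (metis h1.G.inv_equality h1.G.inv_inv h1.G.inv_closed)
qed

lemma normal_image:
  assumes "N = \<rho>\<^sub>1 ` K\<^sub>2" shows "N \<lhd> A"
proof -
  have "subgroup K\<^sub>2 G" unfolding K\<^sub>2_def by (rule h2.subgroup_kernel)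
  then have "subgroup N A" unfolding assms by (rule h1.subgroup_img_is_subgroup)
  moreover have "a \<otimes>\<^bsub>A\<^esub> n \<otimes>\<^bsub>A\<^esub> inv\<^bsub>A\<^esub> a \<in> N" if a: "a \<in> carrier A" and n: "n \<in> N" for a n
  proof -
    obtain g where g: "a = \<rho>\<^sub>1 g" "g \<in> carrier G" using a unfolding onto\<^sub>1[symmetric] by (rule imageE)
    obtain k where k: "n = \<rho>\<^sub>1 k" "k \<in> K\<^sub>2" using n unfolding assms by (rule imageE)
    have "g \<otimes> k \<otimes> inv g \<in> K\<^sub>2"
      using g(2) K\<^sub>2D[OF k(2)] by (intro K\<^sub>2I) simp_all
    moreover have "a \<otimes>\<^bsub>A\<^esub> n \<otimes>\<^bsub>A\<^esub> inv\<^bsub>A\<^esub> a = \<rho>\<^sub>1 (g \<otimes> k \<otimes> inv g)"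
      using g(2) K\<^sub>2D[OF k(2)] by (simp add: g(1) k(1))
    ultimately show ?thesis unfolding assms by (metis imageI)
  qed
  ultimately show ?thesis by (simp add: h1.H.normal_inv_iff)
qed

text \<open>\<open>Q\<close> is the quotient of \<open>G\<close> by the product of both kernels,
  taken inside the first factor. The class of an element is nevertheless determined by either of its
  coordinates, which \<open>quot_cong\<^sub>1\<close> and \<open>quot_cong\<^sub>2\<close>
  record.\<close>

definition "quot g = (\<rho>\<^sub>1 ` K\<^sub>2) #>\<^bsub>A\<^esub> \<rho>\<^sub>1 g"
definition "Q = A Mod (\<rho>\<^sub>1 ` K\<^sub>2)"

lemma quot_hom: "group_hom G Q quot"
proof -
  interpret N: normal "\<rho>\<^sub>1 ` K\<^sub>2" A by (rule normal_image) simp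
  have "quot = (\<lambda>a. (\<rho>\<^sub>1 ` K\<^sub>2) #>\<^bsub>A\<^esub> a) \<circ> \<rho>\<^sub>1" by (simp add: quot_def fun_eq_iff)
  then have "quot \<in> hom G Q" using hom_compose[OF h1.homh N.r_coset_hom_Mod] by (simp add: Q_def)
  then show ?thesis
    using N.factorgroup_is_group unfolding Q_def by (intro group_hom.intro group_hom_axioms.intro h1.G.is_group)
qed

lemma quot_eq_one:
  assumes "g \<in> carrier G" "quot g = \<one>\<^bsub>Q\<^esub>"
  obtains k where "k \<in> K\<^sub>2" "\<rho>\<^sub>1 k = \<rho>\<^sub>1 g"
proof -
  interpret N: normal "\<rho>\<^sub>1 ` K\<^sub>2" A by (rule normal_image) simp
  have "\<rho>\<^sub>1 g \<in> (\<rho>\<^sub>1 ` K\<^sub>2) #>\<^bsub>A\<^esub> \<rho>\<^sub>1 g"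
    using assms(1) h1.H.rcos_self[OF _ N.subgroup_axioms] by simp
  then have "\<rho>\<^sub>1 g \<in> \<rho>\<^sub>1 ` K\<^sub>2" using assms(2) by (simp add: quot_def Q_def)
  then show ?thesis using that by auto
qed

lemma quot_K\<^sub>2: "k \<in> K\<^sub>2 \<Longrightarrow> quot k = \<one>\<^bsub>Q\<^esub>"
proof -
  interpret N: normal "\<rho>\<^sub>1 ` K\<^sub>2" A by (rule normal_image) simp
  show "k \<in> K\<^sub>2 \<Longrightarrow> quot k = \<one>\<^bsub>Q\<^esub>"
    using N.rcos_const[OF h1.H.is_group] by (simp add: quot_def Q_def)
qed

lemma quot_cong\<^sub>1: "\<rho>\<^sub>1 u = \<rho>\<^sub>1 v \<Longrightarrow> quot u = quot v"
  by (simp add: quot_def)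

lemma quot_cong\<^sub>2:
  assumes "u \<in> carrier G" "v \<in> carrier G" "\<rho>\<^sub>2 u = \<rho>\<^sub>2 v"
  shows "quot u = quot v"
proof -
  interpret quot: group_hom G Q quot by (rule quot_hom)
  have "u \<otimes> inv v \<in> K\<^sub>2" using assms by (intro K\<^sub>2I) simp_all
  then have "quot u \<otimes>\<^bsub>Q\<^esub> inv\<^bsub>Q\<^esub> quot v = \<one>\<^bsub>Q\<^esub>"
    using quot_K\<^sub>2[of "u \<otimes> inv v"] assms by simp
  then show ?thesis using assms quot.H.inv_equality[of "quot u" "inv\<^bsub>Q\<^esub> quot v"] by simp
qed

text \<open>If \<open>quot g\<close> is not a power of its \<open>r\<close>-th power, the elements \<open>x\<close> and \<open>y\<close> below
  cannot be conjugate, as a conjugating element is known modulo \<open>K\<^sub>1\<close> and modulo \<open>K\<^sub>2\<close>. In a finite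
  \<open>p\<close>-group, however, \<open>g\<close> has the same image as \<open>z = g [^] (r * j)\<close> for a suitable \<open>j\<close>, and
  replacing \<open>g\<close> by \<open>z\<close> in \<open>y\<close> gives a conjugate of \<open>x\<close>.\<close>

lemma quot_power_of_power:
  fixes p r :: nat
  assumes sep: "p_conjugacy_separable p G" and r: "coprime r p" and g: "g \<in> carrier G"
    and cent\<^sub>1: "\<And>w. w \<in> carrier G \<Longrightarrow> \<exists>k\<in>K\<^sub>2. \<forall>c\<in>carrier A. c \<otimes>\<^bsub>A\<^esub> \<rho>\<^sub>1 (w \<otimes> k) = \<rho>\<^sub>1 (w \<otimes> k) \<otimes>\<^bsub>A\<^esub> c \<longrightarrow>
      (\<exists>m :: int. c = \<rho>\<^sub>1 (w \<otimes> k) [^]\<^bsub>A\<^esub> m)"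
    and cent\<^sub>2: "\<And>w. w \<in> carrier G \<Longrightarrow> \<exists>k\<in>K\<^sub>1. \<forall>c\<in>carrier B. c \<otimes>\<^bsub>B\<^esub> \<rho>\<^sub>2 (w \<otimes> k) = \<rho>\<^sub>2 (w \<otimes> k) \<otimes>\<^bsub>B\<^esub> c \<longrightarrow>
      (\<exists>m :: int. c = \<rho>\<^sub>2 (w \<otimes> k) [^]\<^bsub>B\<^esub> m)"
  shows "\<exists>j :: int. quot g = quot g [^]\<^bsub>Q\<^esub> (int r * j)"
proof (rule ccontr)
  assume no: "\<not> ?thesis"
  interpret quot: group_hom G Q quot by (rule quot_hom)
  let ?w = "g [^] int r"
  have w: "?w \<in> carrier G" using g by simp
  obtain k\<^sub>2 where k\<^sub>2: "k\<^sub>2 \<in> K\<^sub>2" and c\<^sub>1: "\<And>c. c \<in> carrier A \<Longrightarrow> c \<otimes>\<^bsub>A\<^esub> \<rho>\<^sub>1 (?w \<otimes> k\<^sub>2) = \<rho>\<^sub>1 (?w \<otimes> k\<^sub>2) \<otimes>\<^bsub>A\<^esub> c \<Longrightarrow>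
      \<exists>m :: int. c = \<rho>\<^sub>1 (?w \<otimes> k\<^sub>2) [^]\<^bsub>A\<^esub> m"
    using cent\<^sub>1[OF w] by blast
  obtain k\<^sub>1 where k\<^sub>1: "k\<^sub>1 \<in> K\<^sub>1" and c\<^sub>2: "\<And>c. c \<in> carrier B \<Longrightarrow> c \<otimes>\<^bsub>B\<^esub> \<rho>\<^sub>2 (?w \<otimes> k\<^sub>1) = \<rho>\<^sub>2 (?w \<otimes> k\<^sub>1) \<otimes>\<^bsub>B\<^esub> c \<Longrightarrow>
      \<exists>m :: int. c = \<rho>\<^sub>2 (?w \<otimes> k\<^sub>1) [^]\<^bsub>B\<^esub> m"
    using cent\<^sub>2[OF w] by blast
  note k = K\<^sub>1D[OF k\<^sub>1] K\<^sub>2D[OF k\<^sub>2]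
  \<comment> \<open>Its first coordinate is that of \<open>?w \<otimes> k\<^sub>2\<close> and its
    second that of \<open>?w \<otimes> k\<^sub>1\<close>, so \<open>x\<close> has a cyclic
    centralizer in each factor. In \<open>y z\<close> only the part seen by the first factor is
    conjugated; if \<open>z\<close> commutes with \<open>?w\<close>, this conjugates the whole first
    coordinate by \<open>z\<close>.\<close>
  define x where "x = ?w \<otimes> k\<^sub>2 \<otimes> k\<^sub>1"
  define y where "y z = ?w \<otimes> (z \<otimes> k\<^sub>2 \<otimes> inv z) \<otimes> k\<^sub>1" for z
  have xG: "x \<in> carrier G" using w k by (simp add: x_def)
  have yG: "y z \<in> carrier G" if "z \<in> carrier G" for z using w k that by (simp add: y_def)
  define a where "a = \<rho>\<^sub>1 x"
  define b where "b = \<rho>\<^sub>2 x"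
  have aA: "a \<in> carrier A" and bB: "b \<in> carrier B" using xG by (simp_all add: a_def b_def)
  have a: "a = \<rho>\<^sub>1 (?w \<otimes> k\<^sub>2)" using w k by (simp add: a_def x_def)
  have b: "b = \<rho>\<^sub>2 (?w \<otimes> k\<^sub>1)" using w k by (simp add: b_def x_def)
  have quot_x: "quot x = quot g [^]\<^bsub>Q\<^esub> int r"
  proof -
    have "quot x = quot ?w \<otimes>\<^bsub>Q\<^esub> quot k\<^sub>2 \<otimes>\<^bsub>Q\<^esub> quot k\<^sub>1" using w k by (simp add: x_def)
    moreover have "quot k\<^sub>1 = \<one>\<^bsub>Q\<^esub>" using quot_cong\<^sub>1[of k\<^sub>1 \<one>] k by simp
    ultimately show ?thesis using quot_K\<^sub>2[OF k\<^sub>2] g by (simp add: quot.hom_int_pow)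
  qed
  have y1: "\<rho>\<^sub>1 (y z) = \<rho>\<^sub>1 z \<otimes>\<^bsub>A\<^esub> a \<otimes>\<^bsub>A\<^esub> inv\<^bsub>A\<^esub> \<rho>\<^sub>1 z" if "z = g [^] (i :: int)" for z i
  proof -
    have z: "z \<in> carrier G" using that g by simp
    have "?w \<otimes> z = z \<otimes> ?w"
      using g by (simp add: that h1.G.int_pow_mult[symmetric] add.commute)
    then have "\<rho>\<^sub>1 ?w \<otimes>\<^bsub>A\<^esub> \<rho>\<^sub>1 z = \<rho>\<^sub>1 z \<otimes>\<^bsub>A\<^esub> \<rho>\<^sub>1 ?w"
      using w z by (metis h1.hom_mult)
    moreover have "\<rho>\<^sub>1 (y z) = (\<rho>\<^sub>1 ?w \<otimes>\<^bsub>A\<^esub> \<rho>\<^sub>1 z) \<otimes>\<^bsub>A\<^esub> (\<rho>\<^sub>1 k\<^sub>2 \<otimes>\<^bsub>A\<^esub> inv\<^bsub>A\<^esub> \<rho>\<^sub>1 z)"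
      using w z k by (simp add: y_def h1.H.m_assoc)
    ultimately show ?thesis
      using w z k by (simp add: a h1.H.m_assoc)
  qed
  have y2: "\<rho>\<^sub>2 (y z) = b" if "z \<in> carrier G" for z
    using w k that by (simp add: y_def b)
  have "\<not> conjugate_in G x (y g)"
  proof
    assume "conjugate_in G x (y g)"
    then obtain u where u: "u \<in> carrier G" and yu: "y g = u \<otimes> x \<otimes> inv u" by (auto simp: conjugate_in_def)
    have "b = \<rho>\<^sub>2 u \<otimes>\<^bsub>B\<^esub> b \<otimes>\<^bsub>B\<^esub> inv\<^bsub>B\<^esub> \<rho>\<^sub>2 u"
      using y2[OF g] u xG by (simp add: yu b_def)
    then have "\<rho>\<^sub>2 u \<otimes>\<^bsub>B\<^esub> b = b \<otimes>\<^bsub>B\<^esub> \<rho>\<^sub>2 u"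
      using u bB by (metis h2.H.inv_solve_right h2.H.m_closed h2.hom_closed)
    then obtain m :: int where "\<rho>\<^sub>2 u = b [^]\<^bsub>B\<^esub> m"
      using c\<^sub>2[of "\<rho>\<^sub>2 u"] u by (auto simp: b)
    then have qu: "quot u = quot x [^]\<^bsub>Q\<^esub> m"
      using quot_cong\<^sub>2[of u "x [^] m"] u xG by (simp add: b_def h2.hom_int_pow quot.hom_int_pow)
    \<comment> \<open>In the second factor \<open>u\<close> centralizes \<open>b\<close>; in the
      first, \<open>u\<close> and \<open>g\<close> conjugate \<open>a\<close> to the same element,
      so \<open>v\<close> centralizes \<open>a\<close>. Together this writes the class of
      \<open>g\<close> as a power of that of \<open>x\<close>.\<close>
    define v where "v = inv g \<otimes> u"
    have v: "v \<in> carrier G" using g u by (simp add: v_def)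
    have "\<rho>\<^sub>1 g \<otimes>\<^bsub>A\<^esub> a \<otimes>\<^bsub>A\<^esub> inv\<^bsub>A\<^esub> \<rho>\<^sub>1 g = \<rho>\<^sub>1 u \<otimes>\<^bsub>A\<^esub> a \<otimes>\<^bsub>A\<^esub> inv\<^bsub>A\<^esub> \<rho>\<^sub>1 u"
      using y1[of g 1] g u xG by (simp add: yu a_def)
    then have "inv\<^bsub>A\<^esub> \<rho>\<^sub>1 g \<otimes>\<^bsub>A\<^esub> (\<rho>\<^sub>1 g \<otimes>\<^bsub>A\<^esub> a \<otimes>\<^bsub>A\<^esub> inv\<^bsub>A\<^esub> \<rho>\<^sub>1 g) \<otimes>\<^bsub>A\<^esub> \<rho>\<^sub>1 u =
        inv\<^bsub>A\<^esub> \<rho>\<^sub>1 g \<otimes>\<^bsub>A\<^esub> (\<rho>\<^sub>1 u \<otimes>\<^bsub>A\<^esub> a \<otimes>\<^bsub>A\<^esub> inv\<^bsub>A\<^esub> \<rho>\<^sub>1 u) \<otimes>\<^bsub>A\<^esub> \<rho>\<^sub>1 u" by simp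
    then have "\<rho>\<^sub>1 v \<otimes>\<^bsub>A\<^esub> a = a \<otimes>\<^bsub>A\<^esub> \<rho>\<^sub>1 v"
      using g u aA by (simp add: v_def h1.H.m_assoc)
    then obtain l :: int where "\<rho>\<^sub>1 v = a [^]\<^bsub>A\<^esub> l"
      using c\<^sub>1[of "\<rho>\<^sub>1 v"] v by (auto simp: a)
    then have qv: "quot v = quot x [^]\<^bsub>Q\<^esub> l"
      using quot_cong\<^sub>1[of v "x [^] l"] xG by (simp add: a_def h1.hom_int_pow quot.hom_int_pow)
    have "g = u \<otimes> inv v" using g u by (simp add: v_def h1.G.inv_mult_group)
    then have "quot g = quot x [^]\<^bsub>Q\<^esub> m \<otimes>\<^bsub>Q\<^esub> inv\<^bsub>Q\<^esub> (quot x [^]\<^bsub>Q\<^esub> l)"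
      using u v qu qv by simp
    also have "\<dots> = quot x [^]\<^bsub>Q\<^esub> (m - l)"
      using quot.H.int_pow_diff[of "quot x" m l] xG by simp
    also have "\<dots> = quot g [^]\<^bsub>Q\<^esub> (int r * (m - l))"
      using g by (simp add: quot_x quot.H.int_pow_pow)
    finally show False using no by blast
  qed
  then obtain M :: "nat monoid" and \<psi> where M: "finite_p_group p M" and \<psi>: "\<psi> \<in> hom G M"
    and nM: "\<not> conjugate_in M (\<psi> x) (\<psi> (y g))"
    using sep xG yG[OF g] unfolding p_conjugacy_separable_def by blast
  obtain e where e: "order M = p ^ e" and "group M" using M by (auto simp: finite_p_group_def)
  interpret \<psi>: group_hom G M \<psi>
    using \<psi> \<open>group M\<close> by (intro group_hom.intro group_hom_axioms.intro h1.G.is_group)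
  have "coprime (int r) (int (p ^ e))" using r by simp
  then obtain j i where ji: "j * int r + i * int (p ^ e) = 1"
    using bezout_int[of "int r" "int (p ^ e)"] by (metis coprime_iff_gcd_eq_1)
  define z where "z = g [^] (int r * j)"
  have z: "z \<in> carrier G" using g by (simp add: z_def)
  define P where "P = int (p ^ e)"
  have \<psi>g: "\<psi> g \<in> carrier M" using g by simp
  have "\<psi> g [^]\<^bsub>M\<^esub> P = \<one>\<^bsub>M\<^esub>"
    using \<psi>.H.pow_order_eq_1[OF \<psi>g] unfolding P_def e[symmetric] int_pow_int .
  then have "\<psi> g [^]\<^bsub>M\<^esub> (P * i) = \<one>\<^bsub>M\<^esub>"
    using \<psi>g by (simp add: \<psi>.H.int_pow_pow[symmetric])
  then have "\<psi> z = \<psi> g [^]\<^bsub>M\<^esub> (int r * j) \<otimes>\<^bsub>M\<^esub> \<psi> g [^]\<^bsub>M\<^esub> (P * i)"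
    using g by (simp add: z_def \<psi>.hom_int_pow)
  also have "\<dots> = \<psi> g [^]\<^bsub>M\<^esub> (int r * j + P * i)"
    using \<psi>g by (simp add: \<psi>.H.int_pow_mult)
  also have "int r * j + P * i = 1" using ji by (simp add: P_def mult.commute)
  finally have \<psi>z: "\<psi> z = \<psi> g" using \<psi>g by simp
  have "\<psi> (y z) = \<psi> (y g)" using z g w k \<psi>z by (simp add: y_def)
  moreover have "conjugate_in G x (y z)"
  proof -
    \<comment> \<open>\<open>z\<close> conjugates the first coordinate as wanted but may disturb the
      second. Dividing by a power of \<open>x\<close>, which commutes with \<open>x\<close>, makes
      the class trivial, so that some element of \<open>K\<^sub>2\<close> has the same first
      coordinate.\<close>
    define \<kappa> where "\<kappa> = z \<otimes> x [^] (- j)"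
    have \<kappa>: "\<kappa> \<in> carrier G" using z xG by (simp add: \<kappa>_def)
    have "quot \<kappa> = quot g [^]\<^bsub>Q\<^esub> (int r * j) \<otimes>\<^bsub>Q\<^esub> quot g [^]\<^bsub>Q\<^esub> (int r * - j)"
      using z xG g by (simp add: \<kappa>_def z_def quot.hom_int_pow quot_x quot.H.int_pow_pow)
    also have "\<dots> = \<one>\<^bsub>Q\<^esub>"
      using g quot.H.int_pow_mult[of "quot g" "int r * j" "int r * - j"] by simp
    finally obtain k where k: "k \<in> K\<^sub>2" and k1: "\<rho>\<^sub>1 k = \<rho>\<^sub>1 \<kappa>" using quot_eq_one[OF \<kappa>] by blast
    note kG = K\<^sub>2D[OF k]
    have "y z = k \<otimes> x \<otimes> inv k"
    proof (rule eqI)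
      have "a [^]\<^bsub>A\<^esub> (- j) \<otimes>\<^bsub>A\<^esub> a = a \<otimes>\<^bsub>A\<^esub> a [^]\<^bsub>A\<^esub> (- j)"
        using aA h1.H.int_pow_mult[of a "- j" 1] h1.H.int_pow_mult[of a 1 "- j"] by simp
      then have "\<rho>\<^sub>1 z \<otimes>\<^bsub>A\<^esub> a [^]\<^bsub>A\<^esub> (- j) \<otimes>\<^bsub>A\<^esub> a \<otimes>\<^bsub>A\<^esub> inv\<^bsub>A\<^esub> (\<rho>\<^sub>1 z \<otimes>\<^bsub>A\<^esub> a [^]\<^bsub>A\<^esub> (- j)) =
          \<rho>\<^sub>1 z \<otimes>\<^bsub>A\<^esub> (a \<otimes>\<^bsub>A\<^esub> a [^]\<^bsub>A\<^esub> (- j)) \<otimes>\<^bsub>A\<^esub> inv\<^bsub>A\<^esub> (\<rho>\<^sub>1 z \<otimes>\<^bsub>A\<^esub> a [^]\<^bsub>A\<^esub> (- j))"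
        using z aA by (simp add: h1.H.m_assoc)
      also have "\<dots> = \<rho>\<^sub>1 z \<otimes>\<^bsub>A\<^esub> a \<otimes>\<^bsub>A\<^esub> inv\<^bsub>A\<^esub> \<rho>\<^sub>1 z"
        using z aA by (simp add: h1.H.inv_mult_group h1.H.m_assoc)
      finally show "\<rho>\<^sub>1 (y z) = \<rho>\<^sub>1 (k \<otimes> x \<otimes> inv k)"
        using y1[OF z_def] z xG kG k1 by (simp add: \<kappa>_def h1.hom_int_pow a_def)
      show "\<rho>\<^sub>2 (y z) = \<rho>\<^sub>2 (k \<otimes> x \<otimes> inv k)"
        using y2[OF z] xG kG by (simp add: b_def)
    qed (use z xG kG yG in auto)
    then show ?thesis using kG by (auto simp: conjugate_in_def)
  qed
  ultimately show False using nM \<psi>.hom_conjugate_in xG by metis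
qed

text \<open>Separability at p with exponent q gives the class of \<open>g\<close> a finite order
  dividing a number \<open>o'\<close> prime to q. Separability at q with exponent \<open>o'\<close>
  then makes the class a power of its \<open>o'\<close>-th power, which is trivial.\<close>

lemma quot_trivial:
  assumes pq: "prime p" "prime q" "p \<noteq> q"
    and sep: "p_conjugacy_separable p G" "p_conjugacy_separable q G" and g: "g \<in> carrier G"
    and cent\<^sub>1: "\<And>w. w \<in> carrier G \<Longrightarrow> \<exists>k\<in>K\<^sub>2. \<forall>c\<in>carrier A. c \<otimes>\<^bsub>A\<^esub> \<rho>\<^sub>1 (w \<otimes> k) = \<rho>\<^sub>1 (w \<otimes> k) \<otimes>\<^bsub>A\<^esub> c \<longrightarrow>
      (\<exists>m :: int. c = \<rho>\<^sub>1 (w \<otimes> k) [^]\<^bsub>A\<^esub> m)"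
    and cent\<^sub>2: "\<And>w. w \<in> carrier G \<Longrightarrow> \<exists>k\<in>K\<^sub>1. \<forall>c\<in>carrier B. c \<otimes>\<^bsub>B\<^esub> \<rho>\<^sub>2 (w \<otimes> k) = \<rho>\<^sub>2 (w \<otimes> k) \<otimes>\<^bsub>B\<^esub> c \<longrightarrow>
      (\<exists>m :: int. c = \<rho>\<^sub>2 (w \<otimes> k) [^]\<^bsub>B\<^esub> m)"
  shows "quot g = \<one>\<^bsub>Q\<^esub>"
proof -
  interpret quot: group_hom G Q quot by (rule quot_hom)
  let ?t = "quot g"
  have t: "?t \<in> carrier Q" using g by simp
  have "coprime q p" using pq by (metis primes_coprime)
  then obtain j :: int where j: "?t = ?t [^]\<^bsub>Q\<^esub> (int q * j)"
    using quot_power_of_power[OF sep(1) _ g cent\<^sub>1 cent\<^sub>2] by blast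
  define o' where "o' = nat \<bar>int q * j - 1\<bar>"
  have "?t [^]\<^bsub>Q\<^esub> (int q * j - 1) = \<one>\<^bsub>Q\<^esub>"
    using quot.H.int_pow_diff[OF t, of "int q * j" 1] j t by simp
  then have to: "?t [^]\<^bsub>Q\<^esub> int o' = \<one>\<^bsub>Q\<^esub>"
    using quot.H.int_pow_neg[OF t, of "int q * j - 1"] by (auto simp: o'_def abs_if)
  have "\<not> q dvd o'"
  proof
    assume "q dvd o'"
    then have "int q dvd int q * j - 1" by (simp add: o'_def)
    then have "int q dvd int q * j - (int q * j - 1)" by (rule dvd_diff[rotated]) simp
    moreover have "int q * j - (int q * j - 1) = 1" by simp
    ultimately have "int q dvd 1" by metis
    then show False using pq(2) by simp
  qed
  then have "coprime o' q" using pq(2) by (metis coprime_commute prime_imp_coprime)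
  then obtain i :: int where "?t = ?t [^]\<^bsub>Q\<^esub> (int o' * i)"
    using quot_power_of_power[OF sep(2) _ g cent\<^sub>1 cent\<^sub>2] by blast
  also have "\<dots> = \<one>\<^bsub>Q\<^esub>" using to t by (simp add: quot.H.int_pow_pow[symmetric])
  finally show ?thesis .
qed

text \<open>To hit \<open>(a, b)\<close>, the coordinates are lifted separately to \<open>g\<close>
  and \<open>h\<close>. As all classes are trivial, some \<open>k\<close> in
  \<open>K\<^sub>2\<close> accounts for the difference in the first coordinate without touching the
  second.\<close>

lemma iso_DirProd_of_quot_trivial:
  assumes "\<And>g. g \<in> carrier G \<Longrightarrow> quot g = \<one>\<^bsub>Q\<^esub>"
  shows "G \<cong> A \<times>\<times> B"
proof -
  define \<rho> where "\<rho> g = (\<rho>\<^sub>1 g, \<rho>\<^sub>2 g)" for g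
  have "\<rho> \<in> hom G (A \<times>\<times> B)" by (auto simp: hom_def \<rho>_def)
  moreover have "inj_on \<rho> (carrier G)" using eqI by (auto simp: inj_on_def \<rho>_def)
  moreover have "(a, b) \<in> \<rho> ` carrier G" if "a \<in> carrier A" "b \<in> carrier B" for a b
  proof -
    obtain g h where gh: "g \<in> carrier G" "a = \<rho>\<^sub>1 g" "h \<in> carrier G" "b = \<rho>\<^sub>2 h"
      using \<open>a \<in> carrier A\<close> \<open>b \<in> carrier B\<close> unfolding onto\<^sub>1[symmetric] onto\<^sub>2[symmetric] by (elim imageE)
    have d: "g \<otimes> inv h \<in> carrier G" using gh by simp
    obtain k where k: "k \<in> K\<^sub>2" "\<rho>\<^sub>1 k = \<rho>\<^sub>1 (g \<otimes> inv h)" by (rule quot_eq_one[OF d assms[OF d]])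
    note kG = K\<^sub>2D[OF k(1)]
    have "\<rho> (k \<otimes> h) = (a, b)" using kG k(2) gh by (simp add: \<rho>_def h1.H.m_assoc)
    then show ?thesis using kG gh by (metis h1.G.m_closed image_eqI)
  qed
  ultimately have "\<rho> \<in> iso G (A \<times>\<times> B)"
    by (auto simp: iso_iff \<rho>_def)
  then show ?thesis by (rule is_isoI)
qed

end

section \<open>Splitting off a central kernel\<close>

lemma (in group) central_extension_splits:
  assumes \<rho>: "\<rho> \<in> hom G (free_group X)" and onto: "\<rho> ` carrier G = carrier (free_group X)"
    and central: "\<And>k g. k \<in> kernel G (free_group X) \<rho> \<Longrightarrow> g \<in> carrier G \<Longrightarrow> k \<otimes> g = g \<otimes> k"
  shows "G \<cong> (G\<lparr>carrier := kernel G (free_group X) \<rho>\<rparr>) \<times>\<times> free_group X"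
proof -
  interpret F: group "free_group X" by (rule group_free_group)
  interpret \<rho>: group_hom G "free_group X" \<rho> using \<rho> by unfold_locales
  define K where "K = kernel G (free_group X) \<rho>"
  have sub: "subgroup K G" unfolding K_def by (rule \<rho>.subgroup_kernel)
  have K: "k \<in> carrier G" "\<rho> k = \<one>\<^bsub>free_group X\<^esub>" if "k \<in> K" for k
    using that by (simp_all add: K_def kernel_def)
  \<comment> \<open>Arbitrary preimages of the generators: by the universal property they extend to
    a section of \<rho>.\<close>
  define s where "s x = (SOME g. g \<in> carrier G \<and> \<rho> g = gen x)" for x
  have s: "s x \<in> carrier G \<and> \<rho> (s x) = gen x" if "x \<in> X" for x
  proof -
    have "gen x \<in> \<rho> ` carrier G" using that onto by simp
    then have "\<exists>g. g \<in> carrier G \<and> \<rho> g = gen x" by (metis imageE)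
    then show ?thesis unfolding s_def by (rule someI_ex)
  qed
  have sX: "s \<in> X \<rightarrow> carrier G" using s by blast
  interpret \<sigma>: group_hom "free_group X" G "word_val G s" by (rule group_hom_word_val[OF is_group sX])
  have "\<rho> \<circ> word_val G s \<in> hom (free_group X) (free_group X)"
    using \<sigma>.homh \<rho>.homh by (rule Group.hom_compose)
  then have \<rho>\<sigma>: "\<rho> (word_val G s w) = w" if "w \<in> carrier (free_group X)" for w
    using hom_free_group_eqI[OF F.is_group, of "\<rho> \<circ> word_val G s" X "\<lambda>w. w" w]
      free_group_universal(2)[OF is_group sX] s that by (auto simp: hom_def)
  define \<phi> where "\<phi> = (\<lambda>(k, w). k \<otimes> word_val G s w)"
  interpret P: group "(G\<lparr>carrier := K\<rparr>) \<times>\<times> free_group X"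
    by (intro DirProd_group subgroup_imp_group sub F.is_group)
  have "\<phi> (kv \<otimes>\<^bsub>(G\<lparr>carrier := K\<rparr>) \<times>\<times> free_group X\<^esub> lw) = \<phi> kv \<otimes> \<phi> lw"
    if "kv \<in> carrier ((G\<lparr>carrier := K\<rparr>) \<times>\<times> free_group X)" "lw \<in> carrier ((G\<lparr>carrier := K\<rparr>) \<times>\<times> free_group X)" for kv lw
  proof -
    obtain k v l w where kl: "kv = (k, v)" "lw = (l, w)" by fastforce
    then have mem: "k \<in> K" "v \<in> carrier (free_group X)" "l \<in> K" "w \<in> carrier (free_group X)" using that by auto
    \<comment> \<open>Centrality of the kernel is what makes multiplication by the section a
      homomorphism on the product.\<close>
    have "l \<otimes> word_val G s v = word_val G s v \<otimes> l" 
      using mem by (intro central) (simp_all add: K_def)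
    then have "l \<otimes> (word_val G s v \<otimes> word_val G s w) = word_val G s v \<otimes> (l \<otimes> word_val G s w)"
      using mem K(1) by (simp add: m_assoc[symmetric])
    then show ?thesis using mem K(1) by (simp add: kl \<phi>_def m_assoc)
  qed
  then have hom: "\<phi> \<in> hom ((G\<lparr>carrier := K\<rparr>) \<times>\<times> free_group X) G"
    using K(1) by (auto simp: hom_def \<phi>_def)
  then interpret \<phi>: group_hom "(G\<lparr>carrier := K\<rparr>) \<times>\<times> free_group X" G \<phi> by unfold_locales
  have "inj_on \<phi> (carrier ((G\<lparr>carrier := K\<rparr>) \<times>\<times> free_group X))"
  proof (rule iffD2[OF \<phi>.inj_on_one_iff], intro allI impI)
    fix kw assume kw: "kw \<in> carrier ((G\<lparr>carrier := K\<rparr>) \<times>\<times> free_group X)" and one: "\<phi> kw = \<one>"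
    obtain k w where kwe: "kw = (k, w)" by fastforce
    then have mem: "k \<in> K" "w \<in> carrier (free_group X)" using kw by auto
    have "\<rho> (k \<otimes> word_val G s w) = \<one>\<^bsub>free_group X\<^esub>" using one by (simp add: \<phi>_def kwe)
    then have "w = \<one>\<^bsub>free_group X\<^esub>" using mem K \<rho>\<sigma> by simp
    then show "kw = \<one>\<^bsub>(G\<lparr>carrier := K\<rparr>) \<times>\<times> free_group X\<^esub>"
      using one mem K(1) by (simp add: \<phi>_def kwe)
  qed
  moreover have "g \<in> \<phi> ` carrier ((G\<lparr>carrier := K\<rparr>) \<times>\<times> free_group X)" if g: "g \<in> carrier G" for g
  proof -
    let ?s = "word_val G s (\<rho> g)"
    have "g \<otimes> inv ?s \<in> K" using g \<rho>\<sigma> by (simp add: K_def kernel_def)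
    moreover have "g = \<phi> (g \<otimes> inv ?s, \<rho> g)" using g by (simp add: \<phi>_def m_assoc)
    ultimately show ?thesis using g by (intro image_eqI[of _ _ "(g \<otimes> inv ?s, \<rho> g)"]) auto
  qed
  ultimately have "\<phi> \<in> iso ((G\<lparr>carrier := K\<rparr>) \<times>\<times> free_group X) G"
    using hom by (auto simp: iso_iff)
  then show ?thesis unfolding K_def[symmetric] by (intro P.iso_sym is_isoI)
qed

lemma (in subdirect) commute_of_K\<^sub>2:
  assumes "k \<in> K\<^sub>2" "g \<in> carrier G" "\<rho>\<^sub>1 k \<otimes>\<^bsub>A\<^esub> \<rho>\<^sub>1 g = \<rho>\<^sub>1 g \<otimes>\<^bsub>A\<^esub> \<rho>\<^sub>1 k"
  shows "k \<otimes> g = g \<otimes> k"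
  using K\<^sub>2D[OF assms(1)] assms(2,3) by (intro eqI) simp_all

lemma subdirect_cyclic_centralizers:
  assumes "subdirect G (free_group X) B \<rho>\<^sub>1 \<rho>\<^sub>2" and xy: "x \<in> X" "y \<in> X" "x \<noteq> y"
    and K: "subdirect.K\<^sub>2 G B \<rho>\<^sub>2 \<noteq> {\<one>\<^bsub>G\<^esub>}" and w: "w \<in> carrier G"
  shows "\<exists>k\<in>subdirect.K\<^sub>2 G B \<rho>\<^sub>2. \<forall>c\<in>carrier (free_group X). c \<otimes>\<^bsub>free_group X\<^esub> \<rho>\<^sub>1 (w \<otimes>\<^bsub>G\<^esub> k) = \<rho>\<^sub>1 (w \<otimes>\<^bsub>G\<^esub> k) \<otimes>\<^bsub>free_group X\<^esub> c \<longrightarrow>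
    (\<exists>m :: int. c = \<rho>\<^sub>1 (w \<otimes>\<^bsub>G\<^esub> k) [^]\<^bsub>free_group X\<^esub> m)"
proof -
  interpret subdirect G "free_group X" B \<rho>\<^sub>1 \<rho>\<^sub>2 by fact
  have "\<one>\<^bsub>G\<^esub> \<in> K\<^sub>2" by (rule K\<^sub>2I) simp_all
  then obtain k where k: "k \<in> K\<^sub>2" "k \<noteq> \<one>\<^bsub>G\<^esub>" using K by blast
  have "\<rho>\<^sub>1 k \<noteq> \<one>\<^bsub>free_group X\<^esub>" using jointly_trivial[of k] k(2) K\<^sub>2D[OF k(1)] by blast
  then have "\<rho>\<^sub>1 ` K\<^sub>2 \<noteq> {\<one>\<^bsub>free_group X\<^esub>}" using k(1) by blast
  moreover have "\<rho>\<^sub>1 ` K\<^sub>2 \<lhd> free_group X" by (rule normal_image) simp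
  moreover have "\<rho>\<^sub>1 w \<in> carrier (free_group X)" using w by simp
  ultimately obtain n where n: "n \<in> \<rho>\<^sub>1 ` K\<^sub>2" and c: "\<forall>c\<in>carrier (free_group X). c \<otimes>\<^bsub>free_group X\<^esub> (\<rho>\<^sub>1 w \<otimes>\<^bsub>free_group X\<^esub> n) = (\<rho>\<^sub>1 w \<otimes>\<^bsub>free_group X\<^esub> n) \<otimes>\<^bsub>free_group X\<^esub> c \<longrightarrow>
      (\<exists>m :: int. c = (\<rho>\<^sub>1 w \<otimes>\<^bsub>free_group X\<^esub> n) [^]\<^bsub>free_group X\<^esub> m)"
    using normal_coset_cyclic_centralizer[OF xy] by blast
  obtain l where l: "n = \<rho>\<^sub>1 l" "l \<in> K\<^sub>2" using n by (rule imageE)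
  have "\<rho>\<^sub>1 (w \<otimes>\<^bsub>G\<^esub> l) = \<rho>\<^sub>1 w \<otimes>\<^bsub>free_group X\<^esub> n" using w K\<^sub>2D(1)[OF l(2)] by (simp add: l(1))
  then show ?thesis using c l(2) by (intro bexI[of _ l]) simp_all
qed

text \<open>Either alternative makes \<open>K\<^sub>2\<close> central: a free group of rank at most
  one is abelian, and elements of \<open>K\<^sub>2\<close> are trivial in the second coordinate. The
  kernel itself is free since \<open>\<rho>\<^sub>1\<close> embeds it into a free group.\<close>

lemma subdirect_central_splits:
  fixes G :: "'g monoid" and X :: "'c set" and Y :: "'d set"
  assumes "subdirect G (free_group X) (free_group Y) \<rho>\<^sub>1 \<rho>\<^sub>2"
    and central: "(\<forall>x\<in>X. \<forall>y\<in>X. x = y) \<or> subdirect.K\<^sub>2 G (free_group Y) \<rho>\<^sub>2 = {\<one>\<^bsub>G\<^esub>}"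
  shows "\<exists>K :: 'g monoid. is_free_group K \<and> G \<cong> K \<times>\<times> free_group Y"
proof -
  interpret subdirect G "free_group X" "free_group Y" \<rho>\<^sub>1 \<rho>\<^sub>2 by fact
  let ?K = "G\<lparr>carrier := K\<^sub>2\<rparr>"
  have "k \<otimes>\<^bsub>G\<^esub> g = g \<otimes>\<^bsub>G\<^esub> k" if k: "k \<in> K\<^sub>2" and g: "g \<in> carrier G" for k g
    using central
  proof
    assume "\<forall>x\<in>X. \<forall>y\<in>X. x = y"
    then show ?thesis
      using g K\<^sub>2D(1)[OF k] by (intro commute_of_K\<^sub>2 k free_group_commute) auto
  next
    assume "K\<^sub>2 = {\<one>\<^bsub>G\<^esub>}"
    then show ?thesis using k g by simp
  qed
  then have "G \<cong> ?K \<times>\<times> free_group Y"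
    unfolding K\<^sub>2_def by (intro h1.G.central_extension_splits h2.homh onto\<^sub>2)
  moreover have "is_free_group ?K"
  proof (rule is_free_group_of_inj_hom)
    have "subgroup K\<^sub>2 G" unfolding K\<^sub>2_def by (rule h2.subgroup_kernel)
    then show "group ?K" by (rule h1.G.subgroup_imp_group)
    show "\<rho>\<^sub>1 \<in> hom ?K (free_group X)" using K\<^sub>2D by (auto simp: hom_def)
    show "is_free_group (free_group X)" by (rule is_free_group_free_group)
    show "g = \<one>\<^bsub>?K\<^esub>" if "g \<in> carrier ?K" "\<rho>\<^sub>1 g = \<one>\<^bsub>free_group X\<^esub>" for g
      using that K\<^sub>2D jointly_trivial by simp
  qed
  ultimately show ?thesis by blast
qed

text \<open>Unless one factor has rank at most one or one kernel is trivial, both bases have two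
  distinct elements and both kernels are nontrivial, as the construction of cyclic centralizers
  requires.\<close>

theorem subdirect_product_of_free_groups:
  fixes G :: "'g monoid" and X :: "'c set" and Y :: "'d set"
  assumes "subdirect G (free_group X) (free_group Y) \<rho>\<^sub>1 \<rho>\<^sub>2"
    and pq: "prime p" "prime q" "p \<noteq> q" "p_conjugacy_separable p G" "p_conjugacy_separable q G"
  shows "\<exists>(K :: 'g monoid) (L :: 'g monoid). is_free_group K \<and> is_free_group L \<and> G \<cong> K \<times>\<times> L"
proof -
  interpret subdirect G "free_group X" "free_group Y" \<rho>\<^sub>1 \<rho>\<^sub>2 by fact
  interpret swap: subdirect G "free_group Y" "free_group X" \<rho>\<^sub>2 \<rho>\<^sub>1 by (rule subdirect_swap)
  have K: "swap.K\<^sub>2 = K\<^sub>1" by (simp add: swap.K\<^sub>2_def K\<^sub>1_def)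
  note any_type = direct_product_of_free_groups_any_type[OF h1.G.is_group]
  consider "(\<forall>x\<in>X. \<forall>y\<in>X. x = y) \<or> K\<^sub>2 = {\<one>\<^bsub>G\<^esub>}" | "(\<forall>x\<in>Y. \<forall>y\<in>Y. x = y) \<or> K\<^sub>1 = {\<one>\<^bsub>G\<^esub>}"
    | x y x' y' where "x \<in> X" "y \<in> X" "x \<noteq> y" "x' \<in> Y" "y' \<in> Y" "x' \<noteq> y'" "K\<^sub>1 \<noteq> {\<one>\<^bsub>G\<^esub>}" "K\<^sub>2 \<noteq> {\<one>\<^bsub>G\<^esub>}"
    by blast
  then show ?thesis
  proof cases
    case 1
    from subdirect_central_splits[OF subdirect_axioms this] show ?thesis
      using any_type is_free_group_free_group by blast
  next
    case 2
    from subdirect_central_splits[OF swap.subdirect_axioms] 2 K show ?thesis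
      using any_type is_free_group_free_group by metis
  next
    case 3
    have "quot g = \<one>\<^bsub>Q\<^esub>" if "g \<in> carrier G" for g
      using subdirect_cyclic_centralizers[OF subdirect_axioms 3(1-3,8)]
        subdirect_cyclic_centralizers[OF swap.subdirect_axioms 3(4-6)] 3(7) K
      by (intro quot_trivial[OF pq that]) auto
    then have "G \<cong> free_group X \<times>\<times> free_group Y" by (rule iso_DirProd_of_quot_trivial)
    then show ?thesis by (rule any_type[OF is_free_group_free_group is_free_group_free_group])
  qed
qed

section \<open>Separability of products of free groups, and the equivalence\<close>

lemma p_conjugacy_separable_is_free_group:
  fixes K :: "'a monoid"
  assumes "prime p" "is_free_group K"
  shows "p_conjugacy_separable p K"
proof -
  obtain X :: "'a set" where "group K" "K \<cong> free_group X" using assms(2) by (auto simp: is_free_group_def)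
  then show ?thesis
    using p_conjugacy_separable_iso group_free_group p_conjugacy_separable_free_group[OF assms(1)] by blast
qed

theorem corollary1p9:
  fixes F\<^sub>1 :: "'a monoid" and F\<^sub>2 :: "'b monoid"
    and H :: "('a \<times> 'b) set" and G :: "('a \<times> 'b) monoid"
  assumes "is_free_group F\<^sub>1" and "is_free_group F\<^sub>2"
    and "subgroup H (F\<^sub>1 \<times>\<times> F\<^sub>2)"
    and "G = (F\<^sub>1 \<times>\<times> F\<^sub>2)\<lparr>carrier := H\<rparr>"
  shows "(\<exists>p q. prime p \<and> prime q \<and> p \<noteq> q \<and>
            p_conjugacy_separable p G \<and> p_conjugacy_separable q G)
     \<longleftrightarrow> (\<exists>(K :: ('a \<times> 'b) monoid) (L :: ('a \<times> 'b) monoid).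
            is_free_group K \<and> is_free_group L \<and> G \<cong> K \<times>\<times> L)"
proof
  have F: "group F\<^sub>1" "group F\<^sub>2" using assms(1,2) by (simp_all add: is_free_group_def)
  interpret P: group "F\<^sub>1 \<times>\<times> F\<^sub>2" using F by (rule DirProd_group)
  interpret H: subgroup H "F\<^sub>1 \<times>\<times> F\<^sub>2" by fact
  have G: "group G" unfolding assms(4) by (rule P.subgroup_imp_group) fact
  {
    assume "\<exists>p q. prime p \<and> prime q \<and> p \<noteq> q \<and> p_conjugacy_separable p G \<and> p_conjugacy_separable q G"
    then obtain p q where pq: "prime p" "prime q" "p \<noteq> q" "p_conjugacy_separable p G" "p_conjugacy_separable q G"
      by blast
    have proj: "fst \<in> hom G F\<^sub>1" "snd \<in> hom G F\<^sub>2"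
      using H.subset by (auto simp: assms(4) hom_def mult_DirProd')
    obtain X :: "('a letter list set \<times> 'a) set" and \<rho>\<^sub>1 where \<rho>\<^sub>1: "\<rho>\<^sub>1 \<in> hom G (free_group X)"
      "\<rho>\<^sub>1 ` carrier G = carrier (free_group X)" "\<forall>g\<in>carrier G. \<rho>\<^sub>1 g = \<one>\<^bsub>free_group X\<^esub> \<longleftrightarrow> fst g = \<one>\<^bsub>F\<^sub>1\<^esub>"
      using hom_onto_free_group[OF G proj(1) assms(1)] by (elim exE conjE) (rule that)
    obtain Y :: "('b letter list set \<times> 'b) set" and \<rho>\<^sub>2 where \<rho>\<^sub>2: "\<rho>\<^sub>2 \<in> hom G (free_group Y)"
      "\<rho>\<^sub>2 ` carrier G = carrier (free_group Y)" "\<forall>g\<in>carrier G. \<rho>\<^sub>2 g = \<one>\<^bsub>free_group Y\<^esub> \<longleftrightarrow> snd g = \<one>\<^bsub>F\<^sub>2\<^esub>"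
      using hom_onto_free_group[OF G proj(2) assms(2)] by (elim exE conjE) (rule that)
    have "subdirect G (free_group X) (free_group Y) \<rho>\<^sub>1 \<rho>\<^sub>2"
      using G \<rho>\<^sub>1 \<rho>\<^sub>2
      by (intro subdirect.intro subdirect_axioms.intro group_hom.intro group_hom_axioms.intro group_free_group)
        (auto simp: assms(4) prod_eq_iff)
    then show "\<exists>(K :: ('a \<times> 'b) monoid) (L :: ('a \<times> 'b) monoid). is_free_group K \<and> is_free_group L \<and> G \<cong> K \<times>\<times> L"
      using pq by (rule subdirect_product_of_free_groups)
  next
    assume "\<exists>(K :: ('a \<times> 'b) monoid) (L :: ('a \<times> 'b) monoid). is_free_group K \<and> is_free_group L \<and> G \<cong> K \<times>\<times> L"
    then obtain K L :: "('a \<times> 'b) monoid" where KL: "is_free_group K" "is_free_group L" and iso: "G \<cong> K \<times>\<times> L" by blast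
    have gr: "group K" "group L" using KL by (simp_all add: is_free_group_def)
    have "p_conjugacy_separable p G" if "prime p" for p
      using p_conjugacy_separable_iso[OF iso G DirProd_group[OF gr]]
        p_conjugacy_separable_DirProd[OF _ _ gr] p_conjugacy_separable_is_free_group[OF that] KL by blast
    \<comment> \<open>Such a product is separable at every prime, so any two primes may
      serve.\<close>
    moreover have "prime (2 :: nat)" "prime (3 :: nat)" "(2 :: nat) \<noteq> 3" by simp_all
    ultimately show "\<exists>p q. prime p \<and> prime q \<and> p \<noteq> q \<and> p_conjugacy_separable p G \<and> p_conjugacy_separable q G"
      by blast
  }
qed

end
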